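(* Let $(M^{2n+s},\phi,\xi_i,\eta_j,g)$, $s\ge 1$, be a contact metric $f$-manifold. Then $M^{2n+s}$ admits an almost metric $\phi$-connection $\nabla$ with skew-torsion $T$ if and only if $M^{2n+s}$ is an $\mathcal{S}$-manifold. If this is the case, the uniquely determined connection $\nabla$ has $\nabla$-parallel torsion 3-form $T$ given by $$T=\sum_{i=1}^{s}\eta_i\wedge d\eta_i=2\bar\eta\wedge F,\qquad\text{where}\quad \bar\eta:=\sum_{i=1}^{s}\eta_i.$$
   Context: Manifolds are smooth and connected. A metric $f$-manifold $(M^{2n+s},\phi,\xi_i,\eta_j,g)$ is a $(2n+s)$-dimensional manifold $M$ with a $(1,1)$-tensor field $\phi$ of constant rank $2n$ satisfying $\phi^3+\phi=0$, global vector fields $\xi_1,\dots,\xi_s$ and 1-forms $\eta_1,\dots,\eta_s$ with $\ker\phi=\langle\xi_1,\dots,\xi_s\rangle$, $\eta_i(\xi_j)=\delta_{ij}$, $\eta_i\circ\phi=0$, $\phi^2=-\mathrm{Id}+\sum_i\eta_i\otimes\xi_i$, and a Riemannian metric $g$ with $g(\phi X,\phi Y)=g(X,Y)-\sum_i\eta_i(X)\eta_i(Y)$. The fundamental 2-form is $F(X,Y)=g(X,\phi Y)$. Convention: $d\eta(X,Y)=X\eta(Y)-Y\eta(X)-\eta([X,Y])$; for a 1-form $\eta$ and a 2-form $\omega$, $(\eta\wedge\omega)(X,Y,Z)=\eta(X)\omega(Y,Z)-\eta(Y)\omega(X,Z)+\eta(Z)\omega(X,Y)$. The Nijenhuis tensor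 is $N^{(1)}=N_\phi+\sum_i d\eta_i\otimes\xi_i$ with $N_\phi(X,Y)=[\phi X,\phi Y]+\phi^2[X,Y]-\phi[X,\phi Y]-\phi[\phi X,Y]$; the structure is normal if $N^{(1)}=0$. A contact metric $f$-manifold (or almost $\mathcal{S}$-manifold) is a metric $f$-manifold with $2F=d\eta_i$ for all $i=1,\dots,s$. An $\mathcal{S}$-manifold is a normal contact metric $f$-manifold. An affine connection $\nabla$ is an almost metric $\phi$-connection if $\nabla g=0$, $\nabla\phi=0$, $\nabla\xi_i=0$, $\nabla\eta_i=0$ for all $i$. It has skew-torsion if $T(X,Y,Z):=g(T(X,Y),Z)$ is a 3-form, where $T(X,Y)=\nabla_XY-\nabla_YX-[X,Y]$. *)

theory Defs
  imports "HOL-Analysis.Analysis"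
begin

section \<open>Smooth maps between Euclidean spaces\<close>

text \<open>Only used for open \<open>S\<close>: all iterated directional derivatives up to order \<open>k\<close> exist and
  are continuous.\<close>

primrec Ck_on :: "nat \<Rightarrow> 'e::euclidean_space set \<Rightarrow> ('e \<Rightarrow> 'b::real_normed_vector) \<Rightarrow> bool" where
  "Ck_on 0 S f \<longleftrightarrow> continuous_on S f"
| "Ck_on (Suc k) S f \<longleftrightarrow>
     (\<forall>x\<in>S. f differentiable (at x)) \<and> (\<forall>v. Ck_on k S (\<lambda>x. frechet_derivative f (at x) v))"

definition smooth_on :: "'e::euclidean_space set \<Rightarrow> ('e \<Rightarrow> 'b::real_normed_vector) \<Rightarrow> bool" where
  "smooth_on S f \<longleftrightarrow> (\<forall>k. Ck_on k S f)"


section \<open>Smooth manifolds, functions, and vector fields\<close>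

text \<open>The points of the manifold are all the elements of a Hausdorff, second countable type. A chart
  is a pair of its domain and its coordinate map; the values of the coordinate map outside the
  domain are irrelevant.\<close>

type_synonym ('a, 'e) chart = "'a set \<times> ('a \<Rightarrow> 'e)"

abbreviation chart_dom :: "('a, 'e) chart \<Rightarrow> 'a set" where
  "chart_dom c \<equiv> fst c"

abbreviation chart_map :: "('a, 'e) chart \<Rightarrow> 'a \<Rightarrow> 'e" where
  "chart_map c \<equiv> snd c"

definition chart_inv :: "('a, 'e) chart \<Rightarrow> 'e \<Rightarrow> 'a" where
  "chart_inv c = inv_into (chart_dom c) (chart_map c)"

text \<open>The atlas need not be maximal.\<close>

definition smooth_atlas ::
  "('a::{t2_space,second_countable_topology}, 'e::euclidean_space) chart set \<Rightarrow> bool" where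
  "smooth_atlas A \<longleftrightarrow>
     (\<Union>c\<in>A. chart_dom c) = UNIV \<and>
     (\<forall>c\<in>A. open (chart_dom c) \<and> open (chart_map c ` chart_dom c) \<and>
        homeomorphism (chart_dom c) (chart_map c ` chart_dom c) (chart_map c) (chart_inv c)) \<and>
     (\<forall>c\<in>A. \<forall>c'\<in>A.
        smooth_on (chart_map c ` (chart_dom c \<inter> chart_dom c')) (chart_map c' \<circ> chart_inv c))"

definition smooth_manifold ::
  "('a::{t2_space,second_countable_topology}, 'e::euclidean_space) chart set \<Rightarrow> bool" where
  "smooth_manifold A \<longleftrightarrow> smooth_atlas A \<and> connected (UNIV :: 'a set)"

text \<open>At every point a chart around it is selected once and for all. The tangent space at \<open>p\<close> is the
  model space \<open>'e\<close>, a vector of \<open>'e\<close> being read as the tangent vector at \<open>p\<close> that has it as its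
  coordinates in the chart selected at \<open>p\<close>. A vector field is thus a function \<open>'a \<Rightarrow> 'e\<close>; as the
  selected chart may jump from point to point, its smoothness has to be tested in the charts of
  the atlas, after the change of coordinates \<open>to_chart\<close>.\<close>

definition chart_at :: "('a, 'e) chart set \<Rightarrow> 'a \<Rightarrow> ('a, 'e) chart" where
  "chart_at A p = (SOME c. c \<in> A \<and> p \<in> chart_dom c)"

definition to_chart ::
  "('a, 'e::euclidean_space) chart set \<Rightarrow> ('a, 'e) chart \<Rightarrow> 'a \<Rightarrow> 'e \<Rightarrow> 'e" where
  "to_chart A c p =
     frechet_derivative (chart_map c \<circ> chart_inv (chart_at A p)) (at (chart_map (chart_at A p) p))"

definition field_in_chart ::
  "('a, 'e::euclidean_space) chart set \<Rightarrow> ('a, 'e) chart \<Rightarrow> ('a \<Rightarrow> 'e) \<Rightarrow> 'e \<Rightarrow> 'e" where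
  "field_in_chart A c X y = to_chart A c (chart_inv c y) (X (chart_inv c y))"

definition smooth_fun_on ::
  "('a, 'e::euclidean_space) chart set \<Rightarrow> 'a set \<Rightarrow> ('a \<Rightarrow> real) \<Rightarrow> bool" where
  "smooth_fun_on A W f \<longleftrightarrow> (\<forall>c\<in>A. smooth_on (chart_map c ` (chart_dom c \<inter> W)) (f \<circ> chart_inv c))"

definition smooth_field_on ::
  "('a, 'e::euclidean_space) chart set \<Rightarrow> 'a set \<Rightarrow> ('a \<Rightarrow> 'e) \<Rightarrow> bool" where
  "smooth_field_on A W X \<longleftrightarrow>
     (\<forall>c\<in>A. smooth_on (chart_map c ` (chart_dom c \<inter> W)) (field_in_chart A c X))"

definition smooth_funs :: "('a, 'e::euclidean_space) chart set \<Rightarrow> ('a \<Rightarrow> real) set" where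
  "smooth_funs A = {f. smooth_fun_on A UNIV f}"

definition vector_fields :: "('a, 'e::euclidean_space) chart set \<Rightarrow> ('a \<Rightarrow> 'e) set" where
  "vector_fields A = {X. smooth_field_on A UNIV X}"

text \<open>The function \<open>X f\<close>.\<close>

definition field_deriv ::
  "('a, 'e::euclidean_space) chart set \<Rightarrow> ('a \<Rightarrow> 'e) \<Rightarrow> ('a \<Rightarrow> real) \<Rightarrow> 'a \<Rightarrow> real" where
  "field_deriv A X f p =
     frechet_derivative (f \<circ> chart_inv (chart_at A p)) (at (chart_map (chart_at A p) p)) (X p)"

text \<open>The Lie bracket at \<open>p\<close>, computed in the chart selected at \<open>p\<close>.\<close>

definition lie_bracket ::
  "('a, 'e::euclidean_space) chart set \<Rightarrow> ('a \<Rightarrow> 'e) \<Rightarrow> ('a \<Rightarrow> 'e) \<Rightarrow> 'a \<Rightarrow> 'e" where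
  "lie_bracket A X Y p =
     (let c = chart_at A p in
        frechet_derivative (field_in_chart A c Y) (at (chart_map c p)) (X p)
      - frechet_derivative (field_in_chart A c X) (at (chart_map c p)) (Y p))"


section \<open>Tensor fields and forms\<close>

text \<open>A tensor field is a family of multilinear maps on the tangent spaces. It is smooth if it
  takes smooth vector fields, given on any open set, to smooth objects on that set.\<close>

definition endo_apply :: "('a \<Rightarrow> 'e \<Rightarrow> 'e) \<Rightarrow> ('a \<Rightarrow> 'e) \<Rightarrow> 'a \<Rightarrow> 'e" where
  "endo_apply \<phi> X p = \<phi> p (X p)"

definition form_apply :: "('a \<Rightarrow> 'e \<Rightarrow> real) \<Rightarrow> ('a \<Rightarrow> 'e) \<Rightarrow> 'a \<Rightarrow> real" where
  "form_apply \<eta> X p = \<eta> p (X p)"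

definition metric_apply ::
  "('a \<Rightarrow> 'e \<Rightarrow> 'e \<Rightarrow> real) \<Rightarrow> ('a \<Rightarrow> 'e) \<Rightarrow> ('a \<Rightarrow> 'e) \<Rightarrow> 'a \<Rightarrow> real" where
  "metric_apply g X Y p = g p (X p) (Y p)"

definition endo_field ::
  "('a::topological_space, 'e::euclidean_space) chart set \<Rightarrow> ('a \<Rightarrow> 'e \<Rightarrow> 'e) \<Rightarrow> bool" where
  "endo_field A \<phi> \<longleftrightarrow>
     (\<forall>p. linear (\<phi> p)) \<and>
     (\<forall>W X. open W \<longrightarrow> smooth_field_on A W X \<longrightarrow> smooth_field_on A W (endo_apply \<phi> X))"

definition one_form ::
  "('a::topological_space, 'e::euclidean_space) chart set \<Rightarrow> ('a \<Rightarrow> 'e \<Rightarrow> real) \<Rightarrow> bool" where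
  "one_form A \<eta> \<longleftrightarrow>
     (\<forall>p. linear (\<eta> p)) \<and>
     (\<forall>W X. open W \<longrightarrow> smooth_field_on A W X \<longrightarrow> smooth_fun_on A W (form_apply \<eta> X))"

definition riemannian_metric ::
  "('a::topological_space, 'e::euclidean_space) chart set \<Rightarrow> ('a \<Rightarrow> 'e \<Rightarrow> 'e \<Rightarrow> real) \<Rightarrow> bool" where
  "riemannian_metric A g \<longleftrightarrow>
     (\<forall>p. bilinear (g p) \<and> (\<forall>u v. g p u v = g p v u) \<and> (\<forall>v. v \<noteq> 0 \<longrightarrow> g p v v > 0)) \<and>
     (\<forall>W X Y. open W \<longrightarrow> smooth_field_on A W X \<longrightarrow> smooth_field_on A W Y \<longrightarrow>
        smooth_fun_on A W (metric_apply g X Y))"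

text \<open>Differential 2-forms and 3-forms occur through their values on smooth vector fields, i.e. as
  alternating multilinear maps over the ring of smooth functions.\<close>

definition ext_deriv ::
  "('a, 'e::euclidean_space) chart set \<Rightarrow> ('a \<Rightarrow> 'e \<Rightarrow> real) \<Rightarrow> ('a \<Rightarrow> 'e) \<Rightarrow> ('a \<Rightarrow> 'e) \<Rightarrow> 'a \<Rightarrow> real"
  where
  "ext_deriv A \<eta> X Y p =
     field_deriv A X (form_apply \<eta> Y) p - field_deriv A Y (form_apply \<eta> X) p
     - form_apply \<eta> (lie_bracket A X Y) p"

definition wedge12 ::
  "('a \<Rightarrow> 'e \<Rightarrow> real) \<Rightarrow> (('a \<Rightarrow> 'e) \<Rightarrow> ('a \<Rightarrow> 'e) \<Rightarrow> 'a \<Rightarrow> real) \<Rightarrow>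
   ('a \<Rightarrow> 'e) \<Rightarrow> ('a \<Rightarrow> 'e) \<Rightarrow> ('a \<Rightarrow> 'e) \<Rightarrow> 'a \<Rightarrow> real" where
  "wedge12 \<eta> \<omega> X Y Z p =
     form_apply \<eta> X p * \<omega> Y Z p - form_apply \<eta> Y p * \<omega> X Z p + form_apply \<eta> Z p * \<omega> X Y p"

text \<open>With antisymmetry in both adjacent pairs, linearity in the first argument gives it in all.\<close>

definition three_form ::
  "('a, 'e::euclidean_space) chart set \<Rightarrow>
   (('a \<Rightarrow> 'e) \<Rightarrow> ('a \<Rightarrow> 'e) \<Rightarrow> ('a \<Rightarrow> 'e) \<Rightarrow> 'a \<Rightarrow> real) \<Rightarrow> bool" where
  "three_form A T \<longleftrightarrow>
     (\<forall>X\<in>vector_fields A. \<forall>Y\<in>vector_fields A. \<forall>Z\<in>vector_fields A.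
        T X Y Z \<in> smooth_funs A \<and>
        (\<forall>p. T Y X Z p = - T X Y Z p) \<and>
        (\<forall>p. T X Z Y p = - T X Y Z p) \<and>
        (\<forall>X'\<in>vector_fields A. \<forall>p. T (\<lambda>q. X q + X' q) Y Z p = T X Y Z p + T X' Y Z p) \<and>
        (\<forall>f\<in>smooth_funs A. \<forall>p. T (\<lambda>q. f q *\<^sub>R X q) Y Z p = f p * T X Y Z p))"


section \<open>Metric f-manifolds\<close>

definition metric_f_manifold ::
  "('a::{t2_space,second_countable_topology}, 'e::euclidean_space) chart set \<Rightarrow> nat \<Rightarrow> nat \<Rightarrow>
   ('a \<Rightarrow> 'e \<Rightarrow> 'e) \<Rightarrow> (nat \<Rightarrow> 'a \<Rightarrow> 'e) \<Rightarrow> (nat \<Rightarrow> 'a \<Rightarrow> 'e \<Rightarrow> real) \<Rightarrow>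
   ('a \<Rightarrow> 'e \<Rightarrow> 'e \<Rightarrow> real) \<Rightarrow> bool" where
  "metric_f_manifold A n s \<phi> \<xi> \<eta> g \<longleftrightarrow>
     smooth_manifold A \<and> DIM('e) = 2 * n + s \<and>
     endo_field A \<phi> \<and> (\<forall>p. dim (range (\<phi> p)) = 2 * n) \<and>
     (\<forall>p v. \<phi> p (\<phi> p (\<phi> p v)) + \<phi> p v = 0) \<and>
     (\<forall>i\<in>{1..s}. \<xi> i \<in> vector_fields A) \<and>
     (\<forall>i\<in>{1..s}. one_form A (\<eta> i)) \<and>
     (\<forall>p. {v. \<phi> p v = 0} = span ((\<lambda>i. \<xi> i p) ` {1..s})) \<and>
     (\<forall>i\<in>{1..s}. \<forall>j\<in>{1..s}. \<forall>p. \<eta> i p (\<xi> j p) = (if i = j then 1 else 0)) \<and>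
     (\<forall>i\<in>{1..s}. \<forall>p v. \<eta> i p (\<phi> p v) = 0) \<and>
     (\<forall>p v. \<phi> p (\<phi> p v) = - v + (\<Sum>i\<in>{1..s}. \<eta> i p v *\<^sub>R \<xi> i p)) \<and>
     riemannian_metric A g \<and>
     (\<forall>p u v. g p (\<phi> p u) (\<phi> p v) = g p u v - (\<Sum>i\<in>{1..s}. \<eta> i p u * \<eta> i p v))"

definition fundamental_form ::
  "('a \<Rightarrow> 'e \<Rightarrow> 'e) \<Rightarrow> ('a \<Rightarrow> 'e \<Rightarrow> 'e \<Rightarrow> real) \<Rightarrow> ('a \<Rightarrow> 'e) \<Rightarrow> ('a \<Rightarrow> 'e) \<Rightarrow> 'a \<Rightarrow> real" where
  "fundamental_form \<phi> g X Y = metric_apply g X (endo_apply \<phi> Y)"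

definition contact_metric_f_manifold ::
  "('a::{t2_space,second_countable_topology}, 'e::euclidean_space) chart set \<Rightarrow> nat \<Rightarrow> nat \<Rightarrow>
   ('a \<Rightarrow> 'e \<Rightarrow> 'e) \<Rightarrow> (nat \<Rightarrow> 'a \<Rightarrow> 'e) \<Rightarrow> (nat \<Rightarrow> 'a \<Rightarrow> 'e \<Rightarrow> real) \<Rightarrow>
   ('a \<Rightarrow> 'e \<Rightarrow> 'e \<Rightarrow> real) \<Rightarrow> bool" where
  "contact_metric_f_manifold A n s \<phi> \<xi> \<eta> g \<longleftrightarrow>
     metric_f_manifold A n s \<phi> \<xi> \<eta> g \<and>
     (\<forall>i\<in>{1..s}. \<forall>X\<in>vector_fields A. \<forall>Y\<in>vector_fields A. \<forall>p.
        2 * fundamental_form \<phi> g X Y p = ext_deriv A (\<eta> i) X Y p)"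

definition nijenhuis ::
  "('a, 'e::euclidean_space) chart set \<Rightarrow> ('a \<Rightarrow> 'e \<Rightarrow> 'e) \<Rightarrow>
   ('a \<Rightarrow> 'e) \<Rightarrow> ('a \<Rightarrow> 'e) \<Rightarrow> 'a \<Rightarrow> 'e" where
  "nijenhuis A \<phi> X Y p =
     lie_bracket A (endo_apply \<phi> X) (endo_apply \<phi> Y) p
     + endo_apply \<phi> (endo_apply \<phi> (lie_bracket A X Y)) p
     - endo_apply \<phi> (lie_bracket A X (endo_apply \<phi> Y)) p
     - endo_apply \<phi> (lie_bracket A (endo_apply \<phi> X) Y) p"

definition normality_tensor ::
  "('a, 'e::euclidean_space) chart set \<Rightarrow> nat \<Rightarrow> ('a \<Rightarrow> 'e \<Rightarrow> 'e) \<Rightarrow> (nat \<Rightarrow> 'a \<Rightarrow> 'e) \<Rightarrow>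
   (nat \<Rightarrow> 'a \<Rightarrow> 'e \<Rightarrow> real) \<Rightarrow> ('a \<Rightarrow> 'e) \<Rightarrow> ('a \<Rightarrow> 'e) \<Rightarrow> 'a \<Rightarrow> 'e" where
  "normality_tensor A s \<phi> \<xi> \<eta> X Y p =
     nijenhuis A \<phi> X Y p + (\<Sum>i\<in>{1..s}. ext_deriv A (\<eta> i) X Y p *\<^sub>R \<xi> i p)"

definition S_manifold ::
  "('a::{t2_space,second_countable_topology}, 'e::euclidean_space) chart set \<Rightarrow> nat \<Rightarrow> nat \<Rightarrow>
   ('a \<Rightarrow> 'e \<Rightarrow> 'e) \<Rightarrow> (nat \<Rightarrow> 'a \<Rightarrow> 'e) \<Rightarrow> (nat \<Rightarrow> 'a \<Rightarrow> 'e \<Rightarrow> real) \<Rightarrow>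
   ('a \<Rightarrow> 'e \<Rightarrow> 'e \<Rightarrow> real) \<Rightarrow> bool" where
  "S_manifold A n s \<phi> \<xi> \<eta> g \<longleftrightarrow>
     contact_metric_f_manifold A n s \<phi> \<xi> \<eta> g \<and>
     (\<forall>X\<in>vector_fields A. \<forall>Y\<in>vector_fields A. \<forall>p. normality_tensor A s \<phi> \<xi> \<eta> X Y p = 0)"


section \<open>Affine connections\<close>

text \<open>\<open>D X Y\<close> is the covariant derivative of \<open>Y\<close> along \<open>X\<close>. Its values are only meaningful for
  smooth vector fields \<open>X\<close> and \<open>Y\<close>.\<close>

definition affine_connection ::
  "('a, 'e::euclidean_space) chart set \<Rightarrow> (('a \<Rightarrow> 'e) \<Rightarrow> ('a \<Rightarrow> 'e) \<Rightarrow> 'a \<Rightarrow> 'e) \<Rightarrow> bool" where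
  "affine_connection A D \<longleftrightarrow>
     (\<forall>X\<in>vector_fields A. \<forall>Y\<in>vector_fields A.
        D X Y \<in> vector_fields A \<and>
        (\<forall>X'\<in>vector_fields A. \<forall>p. D (\<lambda>q. X q + X' q) Y p = D X Y p + D X' Y p) \<and>
        (\<forall>Y'\<in>vector_fields A. \<forall>p. D X (\<lambda>q. Y q + Y' q) p = D X Y p + D X Y' p) \<and>
        (\<forall>f\<in>smooth_funs A. \<forall>p. D (\<lambda>q. f q *\<^sub>R X q) Y p = f p *\<^sub>R D X Y p) \<and>
        (\<forall>f\<in>smooth_funs A. \<forall>p.
           D X (\<lambda>q. f q *\<^sub>R Y q) p = field_deriv A X f p *\<^sub>R Y p + f p *\<^sub>R D X Y p))"

text \<open>Covariant derivatives along \<open>X\<close> of a 1-form, a (1,1)-tensor, a metric and a 3-form.\<close>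

definition cov_form ::
  "('a, 'e::euclidean_space) chart set \<Rightarrow> (('a \<Rightarrow> 'e) \<Rightarrow> ('a \<Rightarrow> 'e) \<Rightarrow> 'a \<Rightarrow> 'e) \<Rightarrow>
   ('a \<Rightarrow> 'e \<Rightarrow> real) \<Rightarrow> ('a \<Rightarrow> 'e) \<Rightarrow> ('a \<Rightarrow> 'e) \<Rightarrow> 'a \<Rightarrow> real" where
  "cov_form A D \<eta> X Y p = field_deriv A X (form_apply \<eta> Y) p - form_apply \<eta> (D X Y) p"

definition cov_endo ::
  "(('a \<Rightarrow> 'e) \<Rightarrow> ('a \<Rightarrow> 'e) \<Rightarrow> 'a \<Rightarrow> 'e::euclidean_space) \<Rightarrow>
   ('a \<Rightarrow> 'e \<Rightarrow> 'e) \<Rightarrow> ('a \<Rightarrow> 'e) \<Rightarrow> ('a \<Rightarrow> 'e) \<Rightarrow> 'a \<Rightarrow> 'e" where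
  "cov_endo D \<phi> X Y p = D X (endo_apply \<phi> Y) p - endo_apply \<phi> (D X Y) p"

definition cov_metric ::
  "('a, 'e::euclidean_space) chart set \<Rightarrow> (('a \<Rightarrow> 'e) \<Rightarrow> ('a \<Rightarrow> 'e) \<Rightarrow> 'a \<Rightarrow> 'e) \<Rightarrow>
   ('a \<Rightarrow> 'e \<Rightarrow> 'e \<Rightarrow> real) \<Rightarrow> ('a \<Rightarrow> 'e) \<Rightarrow> ('a \<Rightarrow> 'e) \<Rightarrow> ('a \<Rightarrow> 'e) \<Rightarrow> 'a \<Rightarrow> real" where
  "cov_metric A D g X Y Z p =
     field_deriv A X (metric_apply g Y Z) p
     - metric_apply g (D X Y) Z p - metric_apply g Y (D X Z) p"

definition cov_three_form ::
  "('a, 'e::euclidean_space) chart set \<Rightarrow> (('a \<Rightarrow> 'e) \<Rightarrow> ('a \<Rightarrow> 'e) \<Rightarrow> 'a \<Rightarrow> 'e) \<Rightarrow>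
   (('a \<Rightarrow> 'e) \<Rightarrow> ('a \<Rightarrow> 'e) \<Rightarrow> ('a \<Rightarrow> 'e) \<Rightarrow> 'a \<Rightarrow> real) \<Rightarrow>
   ('a \<Rightarrow> 'e) \<Rightarrow> ('a \<Rightarrow> 'e) \<Rightarrow> ('a \<Rightarrow> 'e) \<Rightarrow> ('a \<Rightarrow> 'e) \<Rightarrow> 'a \<Rightarrow> real" where
  "cov_three_form A D T X Y Z V p =
     field_deriv A X (T Y Z V) p - T (D X Y) Z V p - T Y (D X Z) V p - T Y Z (D X V) p"

definition torsion ::
  "('a, 'e::euclidean_space) chart set \<Rightarrow> (('a \<Rightarrow> 'e) \<Rightarrow> ('a \<Rightarrow> 'e) \<Rightarrow> 'a \<Rightarrow> 'e) \<Rightarrow>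
   ('a \<Rightarrow> 'e) \<Rightarrow> ('a \<Rightarrow> 'e) \<Rightarrow> 'a \<Rightarrow> 'e" where
  "torsion A D X Y p = D X Y p - D Y X p - lie_bracket A X Y p"

definition torsion3 ::
  "('a, 'e::euclidean_space) chart set \<Rightarrow> ('a \<Rightarrow> 'e \<Rightarrow> 'e \<Rightarrow> real) \<Rightarrow>
   (('a \<Rightarrow> 'e) \<Rightarrow> ('a \<Rightarrow> 'e) \<Rightarrow> 'a \<Rightarrow> 'e) \<Rightarrow>
   ('a \<Rightarrow> 'e) \<Rightarrow> ('a \<Rightarrow> 'e) \<Rightarrow> ('a \<Rightarrow> 'e) \<Rightarrow> 'a \<Rightarrow> real" where
  "torsion3 A g D X Y Z = metric_apply g (torsion A D X Y) Z"

definition has_skew_torsion ::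
  "('a, 'e::euclidean_space) chart set \<Rightarrow> ('a \<Rightarrow> 'e \<Rightarrow> 'e \<Rightarrow> real) \<Rightarrow>
   (('a \<Rightarrow> 'e) \<Rightarrow> ('a \<Rightarrow> 'e) \<Rightarrow> 'a \<Rightarrow> 'e) \<Rightarrow> bool" where
  "has_skew_torsion A g D \<longleftrightarrow> three_form A (torsion3 A g D)"

definition almost_metric_phi_connection ::
  "('a, 'e::euclidean_space) chart set \<Rightarrow> nat \<Rightarrow> ('a \<Rightarrow> 'e \<Rightarrow> 'e) \<Rightarrow> (nat \<Rightarrow> 'a \<Rightarrow> 'e) \<Rightarrow>
   (nat \<Rightarrow> 'a \<Rightarrow> 'e \<Rightarrow> real) \<Rightarrow> ('a \<Rightarrow> 'e \<Rightarrow> 'e \<Rightarrow> real) \<Rightarrow>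
   (('a \<Rightarrow> 'e) \<Rightarrow> ('a \<Rightarrow> 'e) \<Rightarrow> 'a \<Rightarrow> 'e) \<Rightarrow> bool" where
  "almost_metric_phi_connection A s \<phi> \<xi> \<eta> g D \<longleftrightarrow>
     affine_connection A D \<and>
     (\<forall>X\<in>vector_fields A. \<forall>Y\<in>vector_fields A. \<forall>Z\<in>vector_fields A. \<forall>p.
        cov_metric A D g X Y Z p = 0) \<and>
     (\<forall>X\<in>vector_fields A. \<forall>Y\<in>vector_fields A. \<forall>p. cov_endo D \<phi> X Y p = 0) \<and>
     (\<forall>i\<in>{1..s}. \<forall>X\<in>vector_fields A. \<forall>p. D X (\<xi> i) p = 0) \<and>
     (\<forall>i\<in>{1..s}. \<forall>X\<in>vector_fields A. \<forall>Y\<in>vector_fields A. \<forall>p. cov_form A D (\<eta> i) X Y p = 0)"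

definition parallel_three_form ::
  "('a, 'e::euclidean_space) chart set \<Rightarrow> (('a \<Rightarrow> 'e) \<Rightarrow> ('a \<Rightarrow> 'e) \<Rightarrow> 'a \<Rightarrow> 'e) \<Rightarrow>
   (('a \<Rightarrow> 'e) \<Rightarrow> ('a \<Rightarrow> 'e) \<Rightarrow> ('a \<Rightarrow> 'e) \<Rightarrow> 'a \<Rightarrow> real) \<Rightarrow> bool" where
  "parallel_three_form A D T \<longleftrightarrow>
     (\<forall>X\<in>vector_fields A. \<forall>Y\<in>vector_fields A. \<forall>Z\<in>vector_fields A. \<forall>V\<in>vector_fields A. \<forall>p.
        cov_three_form A D T X Y Z V p = 0)"

definition eta_bar :: "nat \<Rightarrow> (nat \<Rightarrow> 'a \<Rightarrow> 'e \<Rightarrow> real) \<Rightarrow> 'a \<Rightarrow> 'e \<Rightarrow> real" where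
  "eta_bar s \<eta> p v = (\<Sum>i\<in>{1..s}. \<eta> i p v)"

end

theory Submission
  imports Defs
begin

text \<open>
  Write \<open>F(X,Y) = g(X, \<phi> Y)\<close> and \<open>\<tau> = 2 \<eta>bar \<and> F\<close>, where \<open>\<eta>bar\<close> is the sum of the \<open>\<eta>\<^sub>i\<close>. The argument rests on
  two facts: \<open>F\<close> is closed, because \<open>2F = d\<eta>\<^sub>1\<close>; and the metric connections with skew torsion correspond
  bijectively to 3-forms, by the Koszul formula.

  \<^bold>\<open>The torsion is forced.\<close> Let \<open>\<nabla>\<close> be an almost metric \<open>\<phi>\<close>-connection with skew torsion \<open>T\<close>. Since
  \<open>\<nabla>\<eta>\<^sub>i = 0\<close>, the contact condition says \<open>T(X,Y,\<xi>\<^sub>i) = d\<eta>\<^sub>i(X,Y) = 2F(X,Y)\<close>; since \<open>\<nabla>F = 0\<close>, the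
  equation \<open>dF = 0\<close> says that the cyclic sum of \<open>T(X,Y,\<phi>Z)\<close> vanishes. On the common kernel of the \<open>\<eta>\<^sub>i\<close>, where
  \<open>\<phi>\<^sup>2 = -1\<close>, the latter leaves no room for a nonzero 3-form, so \<open>T\<close> is determined by its contractions with
  the \<open>\<xi>\<^sub>i\<close> and equals \<open>\<tau>\<close> (\<open>three_form_eq_tor\<close>, \<open>torsion_determined\<close>). In terms of such a connection the
  normality tensor is an expression in \<open>T\<close> alone, which vanishes for \<open>T = \<tau>\<close> (\<open>normality_connection\<close>).

  \<^bold>\<open>Existence.\<close> Conversely let \<open>nabla\<close> be the metric connection with torsion \<open>\<tau>\<close>. Normality makes
  \<open>\<phi>\<close> invariant under the flows of the \<open>\<xi>\<^sub>i\<close>; as \<open>F\<close> is invariant as well, the \<open>\<xi>\<^sub>i\<close> are Killing fields. In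
  the Koszul formula for \<open>nabla \<xi>\<^sub>i\<close> the torsion cancels \<open>d\<eta>\<^sub>i\<close>, and what remains is half the Lie derivative of
  \<open>g\<close> along \<open>\<xi>\<^sub>i\<close>; hence \<open>nabla \<xi>\<^sub>i = 0\<close> and \<open>nabla \<eta>\<^sub>i = 0\<close>. Then \<open>nabla \<phi> = 0\<close> follows as the
  vanishing of \<open>\<nabla>J\<close> on a Kaehler manifold follows from \<open>dF = 0\<close> and \<open>N = 0\<close>: the torsion \<open>\<tau>\<close> drops out of both
  equations (\<open>nabla_phi\<close>). Finally \<open>\<tau>\<close> is built from the parallel objects \<open>\<eta>\<^sub>i\<close>, \<open>\<phi>\<close> and \<open>g\<close>, so it
  is parallel; and a second such connection has the same torsion \<open>\<tau>\<close>, hence is the same connection.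

  Besides this algebra the proof needs the basic calculus on a manifold, developed first: the
  bracket of vector fields and its Jacobi identity, enough global vector fields (\<open>global_frame\<close>), and
  the fact that a function-linear functional on vector fields is represented by a vector field
  (\<open>riesz\<close>), which makes the Koszul formula define a connection.
\<close>

section \<open>Calculus of smooth maps\<close>

lemma Ck_on_has_derivative:
  "Ck_on (Suc k) S f \<Longrightarrow> x \<in> S \<Longrightarrow> (f has_derivative frechet_derivative f (at x)) (at x)"
  using frechet_derivative_works[of f "at x"] by simp

text \<open>Openness of \<open>S\<close> is essential: the derivatives in \<open>Ck_on\<close> are taken at points of \<open>S\<close> but within
  the whole space, so they see a neighbourhood of each point.\<close>

lemma Ck_on_cong_open:
  assumes "open S" "\<And>x. x \<in> S \<Longrightarrow> f x = g x" "Ck_on k S f"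
  shows "Ck_on k S g"
  using assms(2,3)
proof (induction k arbitrary: f g)
  case 0
  then show ?case
    using continuous_on_cong by fastforce
next
  case (Suc k)
  have 1: "frechet_derivative f (at x) = frechet_derivative g (at x)" and 2: "g differentiable (at x)"
    if "x \<in> S" for x
  proof -
    have "(f has_derivative frechet_derivative f (at x)) (at x)"
      using Ck_on_has_derivative Suc.prems(2) that .
    then have "(g has_derivative frechet_derivative f (at x)) (at x)"
      by (rule has_derivative_transform_within_open[OF _ assms(1) that]) (use Suc in auto)
    then show "frechet_derivative f (at x) = frechet_derivative g (at x)" "g differentiable (at x)"
      using frechet_derivative_at by (auto simp: differentiable_def)
  qed
  have "Ck_on k S (\<lambda>x. frechet_derivative g (at x) v)" for v
    by (rule Suc.IH[of "\<lambda>x. frechet_derivative f (at x) v"]) (use 1 Suc in auto)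
  then show ?case using 2 by auto
qed

lemma Ck_on_imp_continuous_on: "Ck_on k S f \<Longrightarrow> continuous_on S f"
  by (cases k) (auto simp: differentiable_imp_continuous_within
      intro!: differentiable_imp_continuous_on differentiable_at_imp_differentiable_on)

lemma Ck_on_SucD: "Ck_on (Suc k) S f \<Longrightarrow> Ck_on k S f"
proof (induction k arbitrary: f)
  case 0
  then show ?case using Ck_on_imp_continuous_on Ck_on.simps(1) by blast
next
  case (Suc k)
  then show ?case by (metis Ck_on.simps(2))
qed

lemma Ck_on_subset: "Ck_on k S f \<Longrightarrow> T \<subseteq> S \<Longrightarrow> Ck_on k T f"
  by (induction k arbitrary: f) (auto intro: continuous_on_subset)

lemma Ck_on_local:
  assumes "\<And>x. x \<in> S \<Longrightarrow> \<exists>T. open T \<and> x \<in> T \<and> Ck_on k T f"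
  shows "Ck_on k S f"
  using assms
proof (induction k arbitrary: f)
  case 0
  then show ?case
    by (metis Ck_on.simps(1) continuous_at_imp_continuous_on continuous_on_eq_continuous_at)
next
  case (Suc k)
  then show ?case by simp meson
qed

lemma Ck_on_const: "Ck_on k S (\<lambda>x. c)"
  by (induction k arbitrary: c) auto

lemma Ck_on_add:
  assumes "open S"
  shows "Ck_on k S f \<Longrightarrow> Ck_on k S g \<Longrightarrow> Ck_on k S (\<lambda>x. f x + g x)"
proof (induction k arbitrary: f g)
  case 0
  then show ?case by (auto intro: continuous_intros)
next
  case (Suc k)
  have 1: "frechet_derivative (\<lambda>x. f x + g x) (at x) =
      (\<lambda>v. frechet_derivative f (at x) v + frechet_derivative g (at x) v)" if "x \<in> S" for x
    using Suc.prems that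
    by (intro frechet_derivative_at[symmetric] has_derivative_add Ck_on_has_derivative)
  have "Ck_on k S (\<lambda>x. frechet_derivative (\<lambda>x. f x + g x) (at x) v)" for v
    by (rule Ck_on_cong_open[OF assms _ Suc.IH[of "\<lambda>x. frechet_derivative f (at x) v"
        "\<lambda>x. frechet_derivative g (at x) v"]])
       (use Suc.prems in \<open>auto simp: 1\<close>)
  then show ?case using Suc.prems by auto
qed

text \<open>The product rule has the same shape as the claim, with one factor differentiated; so the claim for
  order \<open>k\<close> and all pairs of functions gives order \<open>Suc k\<close>. Products, scalar multiples and inner products
  are all instances, and so are linear maps, with a constant second factor.\<close>

lemma Ck_on_bilinear:
  assumes "open S" "bounded_bilinear (bop :: 'b::real_normed_vector \<Rightarrow> 'c::real_normed_vector \<Rightarrow> 'd::real_normed_vector)"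
  shows "Ck_on k S f \<Longrightarrow> Ck_on k S g \<Longrightarrow> Ck_on k S (\<lambda>x. bop (f x) (g x))"
proof (induction k arbitrary: f g)
  case 0
  then show ?case using bounded_bilinear.continuous_on[OF assms(2)] by auto
next
  case (Suc k)
  have 0: "((\<lambda>x. bop (f x) (g x)) has_derivative
      (\<lambda>v. bop (f x) (frechet_derivative g (at x) v) + bop (frechet_derivative f (at x) v) (g x))) (at x)"
    if "x \<in> S" for x
    using Suc.prems that
    by (intro bounded_bilinear.FDERIV[OF assms(2)] Ck_on_has_derivative)
  have 1: "frechet_derivative (\<lambda>x. bop (f x) (g x)) (at x) v =
      bop (f x) (frechet_derivative g (at x) v) + bop (frechet_derivative f (at x) v) (g x)"
    if "x \<in> S" for x v
    using frechet_derivative_at[OF 0[OF that]] by (simp add: fun_eq_iff)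
  have "Ck_on k S (\<lambda>x. frechet_derivative (\<lambda>x. bop (f x) (g x)) (at x) v)" for v
  proof (rule Ck_on_cong_open[OF assms(1) 1[symmetric]])
    show "Ck_on k S (\<lambda>x. bop (f x) (frechet_derivative g (at x) v) + bop (frechet_derivative f (at x) v) (g x))"
      using Suc.prems Suc.prems[THEN Ck_on_SucD] by (intro Ck_on_add[OF assms(1)] Suc.IH) simp_all
  qed
  then show ?case using 0 by (auto simp: differentiable_def)
qed

lemma Ck_on_linear:
  assumes "open S" "bounded_linear L" "Ck_on k S f"
  shows "Ck_on k S (\<lambda>x. L (f x))"
proof -
  have "bounded_bilinear (\<lambda>(c::real) x. c *\<^sub>R L x)"
    using bounded_bilinear.comp[OF bounded_bilinear_scaleR bounded_linear_ident assms(2)] .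
  then have "bounded_bilinear (\<lambda>(x::'b) (c::real). c *\<^sub>R L x)"
    by (rule bounded_bilinear.flip)
  \<comment> \<open>a linear map as a bilinear one whose second argument is \<open>1\<close>\<close>
  from Ck_on_bilinear[OF assms(1) this assms(3) Ck_on_const[of _ _ 1]]
  show ?thesis by simp
qed

lemma Ck_on_sum:
  assumes "open S" "\<And>i. i \<in> I \<Longrightarrow> Ck_on k S (f i)"
  shows "Ck_on k S (\<lambda>x. \<Sum>i\<in>I. f i x)"
  using assms(2)
proof (induction I rule: infinite_finite_induct)
  case (insert i I)
  then show ?case using Ck_on_add[OF assms(1), of k "f i" "\<lambda>x. \<Sum>i\<in>I. f i x"] by auto
qed (auto simp: Ck_on_const)

text \<open>\<open>Ck_on\<close> speaks of the derivative in a fixed direction only. A direction that depends on the point is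
  handled by expanding it in the basis.\<close>

lemma frechet_derivative_in_basis:
  fixes f :: "'e::euclidean_space \<Rightarrow> 'b::real_normed_vector"
  assumes "f differentiable (at x)"
  shows "frechet_derivative f (at x) v = (\<Sum>b\<in>Basis. (v \<bullet> b) *\<^sub>R frechet_derivative f (at x) b)"
proof -
  have "linear (frechet_derivative f (at x))"
    using assms by (rule linear_frechet_derivative)
  then have "frechet_derivative f (at x) (\<Sum>b\<in>Basis. (v \<bullet> b) *\<^sub>R b) =
      (\<Sum>b\<in>Basis. (v \<bullet> b) *\<^sub>R frechet_derivative f (at x) b)"
    by (simp add: linear_sum linear_cmul)
  then show ?thesis by (simp add: euclidean_representation)
qed

text \<open>By the chain rule the derivative of \<open>f \<circ> h\<close> is a sum of products of a component of the derivative of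
  \<open>h\<close> with a partial derivative of \<open>f\<close> composed with \<open>h\<close>: the induction runs over all \<open>f\<close>.\<close>

lemma Ck_on_compose:
  fixes f :: "'e::euclidean_space \<Rightarrow> 'b::real_normed_vector" and h :: "'c::euclidean_space \<Rightarrow> 'e"
  assumes "open S" "open T"
  shows "Ck_on k T f \<Longrightarrow> Ck_on k S h \<Longrightarrow> h ` S \<subseteq> T \<Longrightarrow> Ck_on k S (\<lambda>x. f (h x))"
proof (induction k arbitrary: f)
  case 0
  then show ?case by (auto intro: continuous_on_compose2)
next
  case (Suc k)
  have 0: "((\<lambda>x. f (h x)) has_derivative
      (\<lambda>v. frechet_derivative f (at (h x)) (frechet_derivative h (at x) v))) (at x)"
    if "x \<in> S" for x
    using Suc.prems that
    by (intro has_derivative_compose[of h _ x UNIV f] Ck_on_has_derivative) auto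
  have 1: "frechet_derivative (\<lambda>x. f (h x)) (at x) v =
      (\<Sum>b\<in>Basis. (frechet_derivative h (at x) v \<bullet> b) *\<^sub>R frechet_derivative f (at (h x)) b)"
    if "x \<in> S" for x v
    using frechet_derivative_at[OF 0[OF that]] Suc.prems that
    by (subst frechet_derivative_in_basis[symmetric]) (auto simp: fun_eq_iff image_subset_iff)
  have "Ck_on k S (\<lambda>x. frechet_derivative (\<lambda>x. f (h x)) (at x) v)" for v
  proof (rule Ck_on_cong_open[OF assms(1)])
    show "Ck_on k S (\<lambda>x. \<Sum>b\<in>Basis. (frechet_derivative h (at x) v \<bullet> b) *\<^sub>R frechet_derivative f (at (h x)) b)"
    proof (intro Ck_on_sum[OF assms(1)] Ck_on_bilinear[OF assms(1) bounded_bilinear_scaleR])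
      fix b :: 'e
      show "Ck_on k S (\<lambda>x. frechet_derivative h (at x) v \<bullet> b)"
        using Suc.prems by (intro Ck_on_linear[OF assms(1) bounded_linear_inner_left]) auto
      show "Ck_on k S (\<lambda>x. frechet_derivative f (at (h x)) b)"
        by (rule Suc.IH[of "\<lambda>y. frechet_derivative f (at y) b"])
          (use Suc.prems Suc.prems(2)[THEN Ck_on_SucD] in auto)
    qed
  qed (simp add: 1)
  then show ?case using 0 by (auto simp: differentiable_def)
qed

lemma Ck_on_inverse:
  fixes f :: "'e::euclidean_space \<Rightarrow> real"
  assumes "open S" "\<And>x. x \<in> S \<Longrightarrow> f x \<noteq> 0"
  shows "Ck_on k S f \<Longrightarrow> Ck_on k S (\<lambda>x. inverse (f x))"
proof (induction k)
  case 0
  then show ?case using assms by (auto intro: continuous_intros)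
next
  case (Suc k)
  have 0: "((\<lambda>x. inverse (f x)) has_derivative
      (\<lambda>v. - (inverse (f x) * frechet_derivative f (at x) v * inverse (f x)))) (at x)"
    if "x \<in> S" for x
    using Suc.prems that assms(2)
    by (intro Deriv.has_derivative_inverse Ck_on_has_derivative)
  have 1: "frechet_derivative (\<lambda>x. inverse (f x)) (at x) v =
      (-1) * (inverse (f x) * frechet_derivative f (at x) v * inverse (f x))"
    if "x \<in> S" for x v
    using frechet_derivative_at[OF 0[OF that]] by (auto simp: fun_eq_iff)
  have I: "Ck_on k S (\<lambda>x. inverse (f x))"
    using Suc Ck_on_SucD by blast
  have "Ck_on k S (\<lambda>x. frechet_derivative (\<lambda>x. inverse (f x)) (at x) v)" for v
  proof (rule Ck_on_cong_open[OF assms(1) 1[symmetric]])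
    show "Ck_on k S (\<lambda>x. - 1 * (inverse (f x) * frechet_derivative f (at x) v * inverse (f x)))"
      using Suc.prems
      by (intro Ck_on_bilinear[OF assms(1) bounded_bilinear_mult] Ck_on_const I) simp
  qed
  then show ?case using 0 by (auto simp: differentiable_def)
qed

lemma smooth_on_cong_open:
  "open S \<Longrightarrow> smooth_on S f \<Longrightarrow> (\<And>x. x \<in> S \<Longrightarrow> f x = g x) \<Longrightarrow> smooth_on S g"
  unfolding smooth_on_def using Ck_on_cong_open by metis

lemma smooth_on_subset: "smooth_on S f \<Longrightarrow> T \<subseteq> S \<Longrightarrow> smooth_on T f"
  unfolding smooth_on_def using Ck_on_subset by blast

lemma smooth_on_local:
  "(\<And>x. x \<in> S \<Longrightarrow> \<exists>T. open T \<and> x \<in> T \<and> smooth_on T f) \<Longrightarrow> smooth_on S f"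
  unfolding smooth_on_def using Ck_on_local by metis

lemma smooth_on_const: "smooth_on S (\<lambda>x. c)"
  unfolding smooth_on_def by (simp add: Ck_on_const)

lemma smooth_on_add: "open S \<Longrightarrow> smooth_on S f \<Longrightarrow> smooth_on S g \<Longrightarrow> smooth_on S (\<lambda>x. f x + g x)"
  unfolding smooth_on_def by (simp add: Ck_on_add)

lemma smooth_on_bilinear:
  "open S \<Longrightarrow> bounded_bilinear bop \<Longrightarrow> smooth_on S f \<Longrightarrow> smooth_on S g \<Longrightarrow>
    smooth_on S (\<lambda>x. bop (f x) (g x))"
  unfolding smooth_on_def by (simp add: Ck_on_bilinear)

lemmas smooth_on_mult = smooth_on_bilinear[OF _ bounded_bilinear_mult]
lemmas smooth_on_scaleR = smooth_on_bilinear[OF _ bounded_bilinear_scaleR]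

lemma smooth_on_linear:
  "open S \<Longrightarrow> bounded_linear L \<Longrightarrow> smooth_on S f \<Longrightarrow> smooth_on S (\<lambda>x. L (f x))"
  unfolding smooth_on_def by (simp add: Ck_on_linear)

lemma smooth_on_sum:
  "open S \<Longrightarrow> (\<And>i. i \<in> I \<Longrightarrow> smooth_on S (f i)) \<Longrightarrow> smooth_on S (\<lambda>x. \<Sum>i\<in>I. f i x)"
  unfolding smooth_on_def by (simp add: Ck_on_sum)

lemma smooth_on_compose:
  "open S \<Longrightarrow> open T \<Longrightarrow> smooth_on T f \<Longrightarrow> smooth_on S h \<Longrightarrow> h ` S \<subseteq> T \<Longrightarrow>
    smooth_on S (\<lambda>x. f (h x))"
  for h :: "'c::euclidean_space \<Rightarrow> 'e::euclidean_space"
  unfolding smooth_on_def by (simp add: Ck_on_compose)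

lemma smooth_on_inverse:
  "open S \<Longrightarrow> smooth_on S f \<Longrightarrow> (\<And>x. x \<in> S \<Longrightarrow> f x \<noteq> 0) \<Longrightarrow> smooth_on S (\<lambda>x. inverse (f x))"
  for f :: "'e::euclidean_space \<Rightarrow> real"
  unfolding smooth_on_def by (simp add: Ck_on_inverse)

lemma smooth_on_imp_differentiable: "smooth_on S f \<Longrightarrow> x \<in> S \<Longrightarrow> f differentiable (at x)"
  unfolding smooth_on_def using Ck_on.simps(2) by blast

lemma smooth_on_has_derivative:
  "smooth_on S f \<Longrightarrow> x \<in> S \<Longrightarrow> (f has_derivative frechet_derivative f (at x)) (at x)"
  using frechet_derivative_works[of f "at x"] smooth_on_imp_differentiable by metis

lemma smooth_on_imp_continuous_on: "smooth_on S f \<Longrightarrow> continuous_on S f"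
  unfolding smooth_on_def using Ck_on.simps(1) by blast

lemma smooth_on_derivative: "smooth_on S f \<Longrightarrow> smooth_on S (\<lambda>x. frechet_derivative f (at x) v)"
  unfolding smooth_on_def using Ck_on.simps(2) by blast

lemma smooth_on_directional_derivative:
  assumes "open S" "smooth_on S f" "smooth_on S X"
  shows "smooth_on S (\<lambda>x. frechet_derivative f (at x) (X x))"
proof (rule smooth_on_cong_open[OF assms(1)])
  show "smooth_on S (\<lambda>x. \<Sum>b\<in>Basis. (X x \<bullet> b) *\<^sub>R frechet_derivative f (at x) b)"
    by (intro smooth_on_sum smooth_on_scaleR smooth_on_derivative assms
        smooth_on_linear[OF _ bounded_linear_inner_left])
qed (use assms in \<open>simp add: frechet_derivative_in_basis[symmetric] smooth_on_imp_differentiable\<close>)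

section \<open>Symmetry of second derivatives\<close>

text \<open>The mean value theorem is applied in the direction \<open>u\<close> and then to the resulting derivative in the
  direction \<open>v\<close>. As the second difference is symmetric in \<open>u\<close> and \<open>v\<close>, exchanging their roles expresses it
  through the other mixed derivative.\<close>

lemma second_difference:
  fixes f :: "'e::euclidean_space \<Rightarrow> real"
  assumes "smooth_on S f" "h > 0"
    and square: "\<And>a b. 0 \<le> a \<Longrightarrow> a \<le> h \<Longrightarrow> 0 \<le> b \<Longrightarrow> b \<le> h \<Longrightarrow> x + a *\<^sub>R u + b *\<^sub>R v \<in> S"
  shows "\<exists>a b. 0 < a \<and> a < h \<and> 0 < b \<and> b < h \<and>
    f (x + h *\<^sub>R u + h *\<^sub>R v) - f (x + h *\<^sub>R u) - f (x + h *\<^sub>R v) + f x =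
    h * h * frechet_derivative (\<lambda>y. frechet_derivative f (at y) u) (at (x + a *\<^sub>R u + b *\<^sub>R v)) v"
proof -
  have A: "((\<lambda>a. f (x + a *\<^sub>R u + b *\<^sub>R v)) has_real_derivative
      frechet_derivative f (at (x + a *\<^sub>R u + b *\<^sub>R v)) u) (at a)"
    if "0 \<le> a" "a \<le> h" "0 \<le> b" "b \<le> h" for a b
  proof -
    have "((\<lambda>a. f (x + a *\<^sub>R u + b *\<^sub>R v)) has_derivative
        (\<lambda>t. frechet_derivative f (at (x + a *\<^sub>R u + b *\<^sub>R v)) (t *\<^sub>R u))) (at a)"
      by (rule has_derivative_compose[of "\<lambda>a. x + a *\<^sub>R u + b *\<^sub>R v" _ a UNIV f])
         (auto intro!: derivative_eq_intros smooth_on_has_derivative[OF assms(1) square] that)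
    moreover have "(\<lambda>t. frechet_derivative f (at (x + a *\<^sub>R u + b *\<^sub>R v)) (t *\<^sub>R u)) =
        (\<lambda>t. t * frechet_derivative f (at (x + a *\<^sub>R u + b *\<^sub>R v)) u)"
      using linear_frechet_derivative[OF smooth_on_imp_differentiable[OF assms(1) square[OF that]]]
      by (simp add: linear_cmul)
    ultimately show ?thesis
      by (metis (no_types, lifting) has_derivative_imp_has_field_derivative)
  qed
  define d where "d = (\<lambda>y. frechet_derivative f (at y) u)"
  have d: "smooth_on S d"
    unfolding d_def using assms(1) by (rule smooth_on_derivative)
  have "((\<lambda>a. f (x + a *\<^sub>R u + h *\<^sub>R v) - f (x + a *\<^sub>R u + 0 *\<^sub>R v)) has_real_derivative
      (d (x + a *\<^sub>R u + h *\<^sub>R v) - d (x + a *\<^sub>R u + 0 *\<^sub>R v))) (at a)"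
    if "0 \<le> a" "a \<le> h" for a
    unfolding d_def using that assms(2) by (intro DERIV_diff A) auto
  from MVT2[OF \<open>h > 0\<close> this] obtain a where a: "0 < a" "a < h" and
    "(f (x + h *\<^sub>R u + h *\<^sub>R v) - f (x + h *\<^sub>R u + 0 *\<^sub>R v)) - (f (x + 0 *\<^sub>R u + h *\<^sub>R v) - f (x + 0 *\<^sub>R u + 0 *\<^sub>R v)) =
      (h - 0) * (d (x + a *\<^sub>R u + h *\<^sub>R v) - d (x + a *\<^sub>R u + 0 *\<^sub>R v))"
    by blast
  then have 1: "f (x + h *\<^sub>R u + h *\<^sub>R v) - f (x + h *\<^sub>R u) - f (x + h *\<^sub>R v) + f x =
      h * (d (x + a *\<^sub>R u + h *\<^sub>R v) - d (x + a *\<^sub>R u + 0 *\<^sub>R v))"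
    by simp
  have B: "((\<lambda>b. d (x + a *\<^sub>R u + b *\<^sub>R v)) has_real_derivative
      frechet_derivative d (at (x + a *\<^sub>R u + b *\<^sub>R v)) v) (at b)"
    if b: "0 \<le> b" "b \<le> h" for b
  proof -
    have sq: "x + a *\<^sub>R u + b *\<^sub>R v \<in> S" using square a b by simp
    have "((\<lambda>b. d (x + a *\<^sub>R u + b *\<^sub>R v)) has_derivative
        (\<lambda>t. frechet_derivative d (at (x + a *\<^sub>R u + b *\<^sub>R v)) (t *\<^sub>R v))) (at b)"
      by (rule has_derivative_compose[of "\<lambda>b. x + a *\<^sub>R u + b *\<^sub>R v" _ b UNIV d])
         (auto intro!: derivative_eq_intros smooth_on_has_derivative[OF d sq])
    moreover have "(\<lambda>t. frechet_derivative d (at (x + a *\<^sub>R u + b *\<^sub>R v)) (t *\<^sub>R v)) =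
        (\<lambda>t. t * frechet_derivative d (at (x + a *\<^sub>R u + b *\<^sub>R v)) v)"
      using linear_frechet_derivative[OF smooth_on_imp_differentiable[OF d sq]]
      by (simp add: linear_cmul)
    ultimately show ?thesis
      by (metis (no_types, lifting) has_derivative_imp_has_field_derivative)
  qed
  obtain b where "0 < b" "b < h"
    "d (x + a *\<^sub>R u + h *\<^sub>R v) - d (x + a *\<^sub>R u + 0 *\<^sub>R v) =
      (h - 0) * frechet_derivative d (at (x + a *\<^sub>R u + b *\<^sub>R v)) v"
    using MVT2[OF \<open>h > 0\<close> B] by blast
  then show ?thesis
    using a 1 unfolding d_def by auto
qed

lemma second_derivative_symmetric:
  fixes f :: "'e::euclidean_space \<Rightarrow> real"
  assumes "open S" "smooth_on S f" "x \<in> S"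
  shows "frechet_derivative (\<lambda>y. frechet_derivative f (at y) u) (at x) v =
         frechet_derivative (\<lambda>y. frechet_derivative f (at y) v) (at x) u"
proof (rule ccontr)
  define F where "F = (\<lambda>u v y. frechet_derivative (\<lambda>z. frechet_derivative f (at z) u) (at y) v)"
  assume "\<not> ?thesis"
  then have ne: "F u v x \<noteq> F v u x" unfolding F_def .
  define e where "e = \<bar>F u v x - F v u x\<bar> / 2"
  have "e > 0" using ne e_def by auto
  have cont: "continuous_on S (F u v)" for u v
    unfolding F_def
    by (intro smooth_on_imp_continuous_on smooth_on_derivative assms)
  have "\<exists>r>0. ball x r \<subseteq> S \<and> (\<forall>y\<in>ball x r. \<bar>F u v y - F u v x\<bar> < e)" for u v
  proof -
    have "isCont (F u v) x"
      using cont assms(1,3) continuous_on_eq_continuous_at by blast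
    then obtain d where d: "d > 0" "\<And>y. dist y x < d \<Longrightarrow> dist (F u v y) (F u v x) < e"
      using \<open>e > 0\<close> unfolding continuous_at_eps_delta by metis
    obtain r where "r > 0" "ball x r \<subseteq> S" using assms(1,3) open_contains_ball by blast
    then show ?thesis using d
      by (intro exI[of _ "min d r"]) (auto simp: dist_real_def dist_commute)
  qed
  then obtain r1 r2 where r: "r1 > 0" "ball x r1 \<subseteq> S" "\<And>y. y \<in> ball x r1 \<Longrightarrow> \<bar>F u v y - F u v x\<bar> < e"
    "r2 > 0" "\<And>y. y \<in> ball x r2 \<Longrightarrow> \<bar>F v u y - F v u x\<bar> < e"
    by metis
  \<comment> \<open>\<open>h\<close> is so small that the square with sides \<open>h u\<close>, \<open>h v\<close> lies in both balls\<close>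
  define m where "m = norm u + norm v + 1"
  define h where "h = min r1 r2 / (2 * m)"
  have "m > 0" unfolding m_def by (simp add: add_nonneg_pos)
  have "h > 0" unfolding h_def using r \<open>m > 0\<close> by auto
  have hm: "h * m < min r1 r2" unfolding h_def using r \<open>m > 0\<close> by (auto simp: field_simps)
  have sq: "x + a *\<^sub>R u + b *\<^sub>R v \<in> ball x (min r1 r2)" if "0 \<le> a" "a \<le> h" "0 \<le> b" "b \<le> h" for a b
  proof -
    have "norm (a *\<^sub>R u + b *\<^sub>R v) \<le> a * norm u + b * norm v"
      using norm_triangle_ineq[of "a *\<^sub>R u" "b *\<^sub>R v"] that by simp
    also have "\<dots> \<le> h * norm u + h * norm v"
      using that by (intro add_mono mult_right_mono) auto
    also have "\<dots> \<le> h * m" unfolding m_def using \<open>h > 0\<close> by (simp add: algebra_simps)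
    finally have "norm (a *\<^sub>R u + b *\<^sub>R v) < min r1 r2" using hm by simp
    moreover have "dist x (x + a *\<^sub>R u + b *\<^sub>R v) = norm (a *\<^sub>R u + b *\<^sub>R v)"
      by (metis add.assoc add_diff_cancel_left' dist_commute dist_norm)
    ultimately show ?thesis by simp
  qed
  have sqS: "x + a *\<^sub>R u + b *\<^sub>R v \<in> S" "x + a *\<^sub>R v + b *\<^sub>R u \<in> S"
    if "0 \<le> a" "a \<le> h" "0 \<le> b" "b \<le> h" for a b
    using sq[OF that] sq[of b a] that r(2) by (auto simp: add.assoc add.commute[of "a *\<^sub>R v"])
  obtain a b where ab: "0 < a" "a < h" "0 < b" "b < h" and 1:
    "f (x + h *\<^sub>R u + h *\<^sub>R v) - f (x + h *\<^sub>R u) - f (x + h *\<^sub>R v) + f x = h * h * F u v (x + a *\<^sub>R u + b *\<^sub>R v)"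
    using second_difference[OF assms(2) \<open>h > 0\<close> sqS(1)] unfolding F_def by auto
  obtain a' b' where ab': "0 < a'" "a' < h" "0 < b'" "b' < h" and 2:
    "f (x + h *\<^sub>R v + h *\<^sub>R u) - f (x + h *\<^sub>R v) - f (x + h *\<^sub>R u) + f x = h * h * F v u (x + a' *\<^sub>R v + b' *\<^sub>R u)"
    using second_difference[OF assms(2) \<open>h > 0\<close> sqS(2)] unfolding F_def by auto
  have "h * h * F u v (x + a *\<^sub>R u + b *\<^sub>R v) = h * h * F v u (x + a' *\<^sub>R v + b' *\<^sub>R u)"
    using 1 2 by (simp add: algebra_simps)
  then have "F u v (x + a *\<^sub>R u + b *\<^sub>R v) = F v u (x + b' *\<^sub>R u + a' *\<^sub>R v)"
    using \<open>h > 0\<close> by (simp add: algebra_simps)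
  moreover have "\<bar>F u v (x + a *\<^sub>R u + b *\<^sub>R v) - F u v x\<bar> < e"
    using sq[of a b] ab r(3) by auto
  moreover have "\<bar>F v u (x + b' *\<^sub>R u + a' *\<^sub>R v) - F v u x\<bar> < e"
    using sq[of b' a'] ab' r(5) by auto
  ultimately show False unfolding e_def by argo
qed

text \<open>The product rule for the pairing of the derivative of \<open>F\<close> with a direction \<open>Y\<close> that depends on the
  point. The first term, in which \<open>Y\<close> is held fixed, is the second derivative of \<open>F\<close>.\<close>

lemma directional_derivative_has_derivative:
  fixes F :: "'e::euclidean_space \<Rightarrow> 'b::real_normed_vector"
  assumes "open S" "smooth_on S F" "smooth_on S Y" "y \<in> S"
  shows "((\<lambda>z. frechet_derivative F (at z) (Y z)) has_derivative
    (\<lambda>v. frechet_derivative (\<lambda>z. frechet_derivative F (at z) (Y y)) (at y) v +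
         frechet_derivative F (at y) (frechet_derivative Y (at y) v))) (at y)"
proof -
  define G where "G = (\<lambda>b z. frechet_derivative F (at z) b)"
  have G: "smooth_on S (G b)" for b
    unfolding G_def using assms(2) by (rule smooth_on_derivative)
  have F: "frechet_derivative F (at z) w = (\<Sum>b\<in>Basis. (w \<bullet> b) *\<^sub>R G b z)" if "z \<in> S" for z w
    unfolding G_def using frechet_derivative_in_basis[OF smooth_on_imp_differentiable[OF assms(2) that]] .
  have GY: "((\<lambda>z. \<Sum>b\<in>Basis. (w \<bullet> b) *\<^sub>R G b z) has_derivative
      (\<lambda>v. \<Sum>b\<in>Basis. (w \<bullet> b) *\<^sub>R frechet_derivative (G b) (at y) v)) (at y)" for w
    by (intro has_derivative_sum has_derivative_scaleR_right smooth_on_has_derivative[OF G assms(4)])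
  have "(G w has_derivative
      (\<lambda>v. \<Sum>b\<in>Basis. (w \<bullet> b) *\<^sub>R frechet_derivative (G b) (at y) v)) (at y)" for w
    by (rule has_derivative_transform_within_open[OF GY assms(1,4)]) (simp only: F[symmetric], simp add: G_def)
  from frechet_derivative_at[OF this]
  have D: "frechet_derivative (G w) (at y) v = (\<Sum>b\<in>Basis. (w \<bullet> b) *\<^sub>R frechet_derivative (G b) (at y) v)" for w v
    by (simp add: fun_eq_iff)
  have "((\<lambda>z. \<Sum>b\<in>Basis. (Y z \<bullet> b) *\<^sub>R G b z) has_derivative
      (\<lambda>v. \<Sum>b\<in>Basis. (Y y \<bullet> b) *\<^sub>R frechet_derivative (G b) (at y) v +
        (frechet_derivative Y (at y) v \<bullet> b) *\<^sub>R G b y)) (at y)"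
    by (intro has_derivative_sum has_derivative_scaleR has_derivative_inner_left
        smooth_on_has_derivative[OF G assms(4)] smooth_on_has_derivative[OF assms(3,4)])
  then have "((\<lambda>z. \<Sum>b\<in>Basis. (Y z \<bullet> b) *\<^sub>R G b z) has_derivative
      (\<lambda>v. frechet_derivative (G (Y y)) (at y) v + frechet_derivative F (at y) (frechet_derivative Y (at y) v))) (at y)"
    by (simp add: sum.distrib F[OF assms(4)] D[symmetric])
  then have "((\<lambda>z. frechet_derivative F (at z) (Y z)) has_derivative
      (\<lambda>v. frechet_derivative (G (Y y)) (at y) v + frechet_derivative F (at y) (frechet_derivative Y (at y) v))) (at y)"
    by (rule has_derivative_transform_within_open[OF _ assms(1,4)]) (simp only: F)
  then show ?thesis unfolding G_def .
qed

text \<open>Symmetry of the second derivative cancels the second-order terms of the commutator, which is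
  why the bracket of two vector fields is again a first-order operator.\<close>

lemma directional_derivative_commutator:
  fixes F :: "'e::euclidean_space \<Rightarrow> real"
  assumes "open S" "smooth_on S F" "smooth_on S X" "smooth_on S Y" "y \<in> S"
  shows "frechet_derivative (\<lambda>z. frechet_derivative F (at z) (Y z)) (at y) (X y)
    - frechet_derivative (\<lambda>z. frechet_derivative F (at z) (X z)) (at y) (Y y)
    = frechet_derivative F (at y)
        (frechet_derivative Y (at y) (X y) - frechet_derivative X (at y) (Y y))"
  using second_derivative_symmetric[OF assms(1,2,5), of "Y y" "X y"]
    frechet_derivative_at[OF directional_derivative_has_derivative[OF assms(1,2,4,5)], symmetric]
    frechet_derivative_at[OF directional_derivative_has_derivative[OF assms(1,2,3,5)], symmetric]
    linear_diff[OF linear_frechet_derivative[OF smooth_on_imp_differentiable[OF assms(2,5)]]]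
  by simp

section \<open>A smooth function that is flat at the origin\<close>

text \<open>The factor \<open>inverse x ^ m\<close> makes the family closed under differentiation, so that smoothness of all
  its members at \<open>0\<close> is a single induction.\<close>

definition flat :: "nat \<Rightarrow> real \<Rightarrow> real" where
  "flat m x = (if x > 0 then exp (- inverse x) * inverse x ^ m else 0)"

lemma flat_has_real_derivative:
  "(flat m has_real_derivative flat (m + 2) x - real m * flat (m + 1) x) (at x)"
proof -
  consider "x > 0" | "x < 0" | "x = 0" by linarith
  then show ?thesis
  proof cases
    case 1
    have "((\<lambda>x. exp (- inverse x) * inverse x ^ m) has_real_derivative
        flat (m + 2) x - real m * flat (m + 1) x) (at x)"
      using 1 unfolding flat_def
      apply (auto intro!: derivative_eq_intros)
      by (cases m) (auto simp: field_simps power2_eq_square)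
    then show ?thesis
      using 1 has_field_derivative_transform_within_open[of _ _ x "{0<..}" "flat m"]
      by (auto simp: flat_def)
  next
    case 2
    have "((\<lambda>x. 0) has_real_derivative 0) (at x)" by simp
    then have "(flat m has_real_derivative 0) (at x)"
      by (rule has_field_derivative_transform_within_open[of _ _ x "{..<0}"])
         (use 2 in \<open>auto simp: flat_def\<close>)
    then show ?thesis using 2 by (simp add: flat_def)
  next
    case 3
    have R: "((\<lambda>h. exp (- inverse h) * inverse h ^ m / h) \<longlongrightarrow> 0) (at_right (0::real))"
    proof (rule Lim_transform_eventually)
      show "((\<lambda>h::real. inverse h ^ (m + 1) / exp (inverse h)) \<longlongrightarrow> 0) (at_right 0)"
        by (rule filterlim_compose[OF tendsto_power_div_exp_0 filterlim_inverse_at_top_right])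
      show "\<forall>\<^sub>F h::real in at_right 0. inverse h ^ (m + 1) / exp (inverse h) = exp (- inverse h) * inverse h ^ m / h"
        by (auto simp: eventually_at_filter exp_minus field_simps)
    qed
    have "((\<lambda>h. (flat m (0 + h) - flat m 0) / h) \<longlongrightarrow> 0) (at_right 0)"
      by (rule Lim_transform_eventually[OF R])
         (auto simp: flat_def eventually_at_filter)
    moreover have "((\<lambda>h. (flat m (0 + h) - flat m 0) / h) \<longlongrightarrow> 0) (at_left 0)"
      by (rule Lim_transform_eventually[OF tendsto_const])
         (auto simp: flat_def eventually_at_filter)
    ultimately have "(\<lambda>h. (flat m (0 + h) - flat m 0) / h) \<midarrow>0\<rightarrow> 0"
      using filterlim_split_at by blast
    then show ?thesis using 3 by (simp add: DERIV_def flat_def)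
  qed
qed

lemma smooth_on_flat: "smooth_on UNIV (flat m)"
proof -
  have "Ck_on k UNIV (flat m)" for k
  proof (induction k arbitrary: m)
    case 0
    then show ?case
      by (auto intro!: DERIV_isCont flat_has_real_derivative continuous_at_imp_continuous_on)
  next
    case (Suc k)
    have d: "(flat m has_derivative (\<lambda>v. (flat (m + 2) x + (- real m) * flat (m + 1) x) * v)) (at x)" for x
      using flat_has_real_derivative[of m x] by (simp add: has_field_derivative_def)
    have "frechet_derivative (flat m) (at x) = (\<lambda>v. (flat (m + 2) x + (- real m) * flat (m + 1) x) * v)" for x
      using frechet_derivative_at[OF d] by simp
    moreover have "Ck_on k UNIV (\<lambda>x. (flat (m + 2) x + (- real m) * flat (m + 1) x) * v)" for v
      by (intro Ck_on_bilinear[OF _ bounded_bilinear_mult] Ck_on_const Ck_on_add Suc) auto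
    ultimately show ?case using d by (auto simp: differentiable_def simp del: of_nat_add)
  qed
  then show ?thesis unfolding smooth_on_def by blast
qed

section \<open>Charts and tangent vectors\<close>

definition chart_change ::
  "('a, 'e::euclidean_space) chart \<Rightarrow> ('a, 'e) chart \<Rightarrow> 'a \<Rightarrow> 'e \<Rightarrow> 'e" where
  "chart_change c c' p = frechet_derivative (chart_map c' \<circ> chart_inv c) (at (chart_map c p))"

locale atlas =
  fixes A :: "('a::{t2_space,second_countable_topology}, 'e::euclidean_space) chart set"
  assumes smooth_atlas: "smooth_atlas A"
begin

lemma ex_chart: "\<exists>c\<in>A. p \<in> chart_dom c"
  using smooth_atlas unfolding smooth_atlas_def by blast

lemma chart_at [simp]: "chart_at A p \<in> A" "p \<in> chart_dom (chart_at A p)"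
  using someI_ex[of "\<lambda>c. c \<in> A \<and> p \<in> chart_dom c"] ex_chart[of p]
  unfolding chart_at_def by blast+

lemma homeomorphism_chart:
  "c \<in> A \<Longrightarrow> homeomorphism (chart_dom c) (chart_map c ` chart_dom c) (chart_map c) (chart_inv c)"
  using smooth_atlas unfolding smooth_atlas_def by blast

lemma open_chart_dom [simp]: "c \<in> A \<Longrightarrow> open (chart_dom c)"
  using smooth_atlas unfolding smooth_atlas_def by blast

lemma chart_inv_map [simp]: "c \<in> A \<Longrightarrow> p \<in> chart_dom c \<Longrightarrow> chart_inv c (chart_map c p) = p"
  using homeomorphism_chart unfolding homeomorphism_def by blast

lemma open_chart_image:
  assumes "c \<in> A" "open W"
  shows "open (chart_map c ` (chart_dom c \<inter> W))"
proof -
  have "chart_map c ` (chart_dom c \<inter> W) = chart_map c ` chart_dom c \<inter> chart_inv c -` W"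
    using assms(1) by (auto simp: image_iff)
  moreover have "continuous_on (chart_map c ` chart_dom c) (chart_inv c)"
    using homeomorphism_chart[OF assms(1)] unfolding homeomorphism_def by blast
  moreover have "open (chart_map c ` chart_dom c)"
    using smooth_atlas assms(1) unfolding smooth_atlas_def by blast
  ultimately show ?thesis
    using assms(2) by (simp add: continuous_open_preimage)
qed

lemma open_chart_image': "c \<in> A \<Longrightarrow> open U \<Longrightarrow> U \<subseteq> chart_dom c \<Longrightarrow> open (chart_map c ` U)"
  using open_chart_image[of c U] by (simp add: inf.absorb2)

lemma smooth_chart_change:
  "c \<in> A \<Longrightarrow> c' \<in> A \<Longrightarrow>
    smooth_on (chart_map c ` (chart_dom c \<inter> chart_dom c')) (chart_map c' \<circ> chart_inv c)"
  using smooth_atlas unfolding smooth_atlas_def by blast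

lemma chart_change_has_derivative:
  assumes "c \<in> A" "c' \<in> A" "p \<in> chart_dom c" "p \<in> chart_dom c'"
  shows "((chart_map c' \<circ> chart_inv c) has_derivative chart_change c c' p) (at (chart_map c p))"
  unfolding chart_change_def
  using assms by (intro smooth_on_has_derivative[OF smooth_chart_change]) auto

lemma linear_chart_change:
  "c \<in> A \<Longrightarrow> c' \<in> A \<Longrightarrow> p \<in> chart_dom c \<Longrightarrow> p \<in> chart_dom c' \<Longrightarrow> linear (chart_change c c' p)"
  using chart_change_has_derivative has_derivative_linear by blast

lemma to_chart_eq: "to_chart A c p = chart_change (chart_at A p) c p"
  unfolding to_chart_def chart_change_def ..

lemma linear_to_chart: "c \<in> A \<Longrightarrow> p \<in> chart_dom c \<Longrightarrow> linear (to_chart A c p)"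
  by (simp add: to_chart_eq linear_chart_change)

text \<open>The chain rule for passing from one chart to another. It serves both for functions on the manifold
  and, with a coordinate map as \<open>f\<close>, for the cocycle law of the coordinate changes.\<close>

lemma has_derivative_through_chart:
  assumes "c \<in> A" "c' \<in> A" "open W" "p \<in> W" "p \<in> chart_dom c" "p \<in> chart_dom c'"
    and "smooth_on (chart_map c' ` (chart_dom c' \<inter> W)) (f \<circ> chart_inv c')"
  shows "((f \<circ> chart_inv c) has_derivative
    (\<lambda>v. frechet_derivative (f \<circ> chart_inv c') (at (chart_map c' p)) (chart_change c c' p v)))
    (at (chart_map c p))"
proof (rule has_derivative_transform_within_open)
  let ?S = "chart_map c ` (chart_dom c \<inter> (W \<inter> chart_dom c'))"
  show "open ?S" "chart_map c p \<in> ?S"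
    using assms by (auto intro!: open_chart_image open_Int)
  have "((f \<circ> chart_inv c') has_derivative frechet_derivative (f \<circ> chart_inv c') (at (chart_map c' p)))
      (at ((chart_map c' \<circ> chart_inv c) (chart_map c p)))"
    using assms by (simp, intro smooth_on_has_derivative[OF assms(7)]) auto
  from has_derivative_compose[OF chart_change_has_derivative[OF assms(1,2,5,6)] this]
  show "((\<lambda>y. (f \<circ> chart_inv c') ((chart_map c' \<circ> chart_inv c) y)) has_derivative
      (\<lambda>v. frechet_derivative (f \<circ> chart_inv c') (at (chart_map c' p)) (chart_change c c' p v)))
      (at (chart_map c p))" .
qed (use assms in auto)

lemma chart_change_comp:
  assumes "c \<in> A" "c' \<in> A" "c'' \<in> A" "p \<in> chart_dom c" "p \<in> chart_dom c'" "p \<in> chart_dom c''"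
  shows "chart_change c' c'' p (chart_change c c' p v) = chart_change c c'' p v"
  using frechet_derivative_at[OF has_derivative_through_chart[of c c' "chart_dom c''" p "chart_map c''"]]
    assms smooth_chart_change[of c' c''] open_chart_dom
  by (simp add: chart_change_def fun_eq_iff)

lemma chart_change_self [simp]:
  assumes "c \<in> A" "p \<in> chart_dom c"
  shows "chart_change c c p v = v"
proof -
  have "((chart_map c \<circ> chart_inv c) has_derivative (\<lambda>v. v)) (at (chart_map c p))"
    by (rule has_derivative_transform_within_open[OF has_derivative_ident
          open_chart_image[OF assms(1) open_chart_dom[OF assms(1)]]])
       (use assms in auto)
  from frechet_derivative_at[OF this] show ?thesis
    unfolding chart_change_def by (simp add: fun_eq_iff)
qed

lemma to_chart_chart_at [simp]: "to_chart A (chart_at A p) p v = v"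
  by (simp add: to_chart_eq)

lemma field_in_chart_map:
  "c \<in> A \<Longrightarrow> p \<in> chart_dom c \<Longrightarrow> field_in_chart A c X (chart_map c p) = to_chart A c p (X p)"
  by (simp add: field_in_chart_def)

lemma field_in_chart_change:
  "c \<in> A \<Longrightarrow> c' \<in> A \<Longrightarrow> p \<in> chart_dom c \<Longrightarrow> p \<in> chart_dom c' \<Longrightarrow>
    field_in_chart A c' X (chart_map c' p) = chart_change c c' p (field_in_chart A c X (chart_map c p))"
  by (simp add: field_in_chart_map to_chart_eq chart_change_comp)

section \<open>Smooth functions and vector fields\<close>

text \<open>Smoothness may be tested in one chart around each point, since the transition to any other chart is
  smooth.\<close>

lemma smooth_fun_onI:
  assumes "\<And>p. p \<in> W \<Longrightarrow> \<exists>c\<in>A. \<exists>U. open U \<and> p \<in> U \<and> U \<subseteq> chart_dom c \<and>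
    smooth_on (chart_map c ` U) (f \<circ> chart_inv c)"
  shows "smooth_fun_on A W f"
  unfolding smooth_fun_on_def
proof (intro ballI smooth_on_local)
  fix c' y assume c': "c' \<in> A" and "y \<in> chart_map c' ` (chart_dom c' \<inter> W)"
  then obtain p where p: "y = chart_map c' p" "p \<in> chart_dom c'" "p \<in> W" by auto
  with assms obtain c U where c: "c \<in> A" "open U" "p \<in> U" "U \<subseteq> chart_dom c"
    "smooth_on (chart_map c ` U) (f \<circ> chart_inv c)" by meson
  let ?T = "chart_map c' ` (chart_dom c' \<inter> U)"
  have T: "open ?T" using c' c by (simp add: open_chart_image)
  have "smooth_on ?T (\<lambda>y. (f \<circ> chart_inv c) ((chart_map c \<circ> chart_inv c') y))"
  proof (rule smooth_on_compose[OF T _ c(5)])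
    show "open (chart_map c ` U)" using c by (simp add: open_chart_image')
    show "smooth_on ?T (chart_map c \<circ> chart_inv c')"
      by (rule smooth_on_subset[OF smooth_chart_change[OF c' c(1)]]) (use c in auto)
  qed (use c c' in auto)
  then have "smooth_on ?T (f \<circ> chart_inv c')"
    by (rule smooth_on_cong_open[OF T]) (use c c' in auto)
  then show "\<exists>T. open T \<and> y \<in> T \<and> smooth_on T (f \<circ> chart_inv c')"
    using T p c by auto
qed

text \<open>As for functions, but the components also have to be multiplied by the Jacobian of the transition
  map.\<close>

lemma smooth_field_onI:
  assumes "\<And>p. p \<in> W \<Longrightarrow> \<exists>c\<in>A. \<exists>U. open U \<and> p \<in> U \<and> U \<subseteq> chart_dom c \<and>
    smooth_on (chart_map c ` U) (field_in_chart A c X)"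
  shows "smooth_field_on A W X"
  unfolding smooth_field_on_def
proof (intro ballI smooth_on_local)
  fix c' y assume c': "c' \<in> A" and "y \<in> chart_map c' ` (chart_dom c' \<inter> W)"
  then obtain p where p: "y = chart_map c' p" "p \<in> chart_dom c'" "p \<in> W" by auto
  with assms obtain c U where c: "c \<in> A" "open U" "p \<in> U" "U \<subseteq> chart_dom c"
    "smooth_on (chart_map c ` U) (field_in_chart A c X)" by meson
  let ?T = "chart_map c' ` (chart_dom c' \<inter> U)" and ?S = "chart_map c ` (U \<inter> chart_dom c')"
  have T: "open ?T" using c' c by (simp add: open_chart_image)
  have S: "open ?S" using c c' by (intro open_chart_image' open_Int open_chart_dom) auto
  have "smooth_on ?T (\<lambda>y. frechet_derivative (chart_map c' \<circ> chart_inv c)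
      (at ((chart_map c \<circ> chart_inv c') y)) (field_in_chart A c X ((chart_map c \<circ> chart_inv c') y)))"
  proof (rule smooth_on_compose[OF T S, of "\<lambda>y. frechet_derivative (chart_map c' \<circ> chart_inv c) (at y)
        (field_in_chart A c X y)" "chart_map c \<circ> chart_inv c'"])
    show "smooth_on ?S (\<lambda>y. frechet_derivative (chart_map c' \<circ> chart_inv c) (at y) (field_in_chart A c X y))"
      by (intro smooth_on_directional_derivative S
          smooth_on_subset[OF smooth_chart_change[OF c(1) c']] smooth_on_subset[OF c(5)])
         (use c in auto)
    show "smooth_on ?T (chart_map c \<circ> chart_inv c')"
      by (rule smooth_on_subset[OF smooth_chart_change[OF c' c(1)]]) (use c in auto)
  qed (use c c' in auto)
  then have "smooth_on ?T (field_in_chart A c' X)"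
  proof (rule smooth_on_cong_open[OF T])
    fix y assume "y \<in> ?T"
    then obtain q where q: "y = chart_map c' q" "q \<in> chart_dom c'" "q \<in> U" by auto
    then show "frechet_derivative (chart_map c' \<circ> chart_inv c)
      (at ((chart_map c \<circ> chart_inv c') y)) (field_in_chart A c X ((chart_map c \<circ> chart_inv c') y)) =
      field_in_chart A c' X y"
      using c c' field_in_chart_change[of c c' q X] by (auto simp: chart_change_def)
  qed
  then show "\<exists>T. open T \<and> y \<in> T \<and> smooth_on T (field_in_chart A c' X)"
    using T p c by auto
qed

lemma smooth_fun_onD:
  "smooth_fun_on A W f \<Longrightarrow> c \<in> A \<Longrightarrow> smooth_on (chart_map c ` (chart_dom c \<inter> W)) (f \<circ> chart_inv c)"
  unfolding smooth_fun_on_def by blast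

lemma smooth_field_onD:
  "smooth_field_on A W X \<Longrightarrow> c \<in> A \<Longrightarrow> smooth_on (chart_map c ` (chart_dom c \<inter> W)) (field_in_chart A c X)"
  unfolding smooth_field_on_def by blast

lemma smooth_fun_on_subset: "smooth_fun_on A W f \<Longrightarrow> V \<subseteq> W \<Longrightarrow> smooth_fun_on A V f"
  unfolding smooth_fun_on_def by (blast intro: smooth_on_subset)

lemma smooth_field_on_subset: "smooth_field_on A W X \<Longrightarrow> V \<subseteq> W \<Longrightarrow> smooth_field_on A V X"
  unfolding smooth_field_on_def by (blast intro: smooth_on_subset)

lemma smooth_fun_on_cong:
  assumes "open W" "smooth_fun_on A W f" "\<And>p. p \<in> W \<Longrightarrow> f p = h p"
  shows "smooth_fun_on A W h"
  unfolding smooth_fun_on_def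
proof
  fix c assume c: "c \<in> A"
  show "smooth_on (chart_map c ` (chart_dom c \<inter> W)) (h \<circ> chart_inv c)"
    by (rule smooth_on_cong_open[OF open_chart_image[OF c assms(1)] smooth_fun_onD[OF assms(2) c]])
       (use c assms(3) in auto)
qed

lemma smooth_field_on_cong:
  assumes "open W" "smooth_field_on A W X" "\<And>p. p \<in> W \<Longrightarrow> X p = Y p"
  shows "smooth_field_on A W Y"
  unfolding smooth_field_on_def
proof
  fix c assume c: "c \<in> A"
  show "smooth_on (chart_map c ` (chart_dom c \<inter> W)) (field_in_chart A c Y)"
    by (rule smooth_on_cong_open[OF open_chart_image[OF c assms(1)] smooth_field_onD[OF assms(2) c]])
       (use c assms(3) in \<open>auto simp: field_in_chart_map\<close>)
qed

lemma smooth_fun_on_local: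
  assumes "\<And>p. p \<in> W \<Longrightarrow> \<exists>V. open V \<and> p \<in> V \<and> smooth_fun_on A V f"
  shows "smooth_fun_on A W f"
proof (rule smooth_fun_onI)
  fix p assume "p \<in> W"
  with assms obtain V where V: "open V" "p \<in> V" "smooth_fun_on A V f" by blast
  show "\<exists>c\<in>A. \<exists>U. open U \<and> p \<in> U \<and> U \<subseteq> chart_dom c \<and> smooth_on (chart_map c ` U) (f \<circ> chart_inv c)"
    using V smooth_fun_onD[OF V(3), of "chart_at A p"]
    by (intro bexI[of _ "chart_at A p"] exI[of _ "chart_dom (chart_at A p) \<inter> V"]) auto
qed

lemma smooth_field_on_local:
  assumes "\<And>p. p \<in> W \<Longrightarrow> \<exists>V. open V \<and> p \<in> V \<and> smooth_field_on A V X"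
  shows "smooth_field_on A W X"
proof (rule smooth_field_onI)
  fix p assume "p \<in> W"
  with assms obtain V where V: "open V" "p \<in> V" "smooth_field_on A V X" by blast
  show "\<exists>c\<in>A. \<exists>U. open U \<and> p \<in> U \<and> U \<subseteq> chart_dom c \<and> smooth_on (chart_map c ` U) (field_in_chart A c X)"
    using V smooth_field_onD[OF V(3), of "chart_at A p"]
    by (intro bexI[of _ "chart_at A p"] exI[of _ "chart_dom (chart_at A p) \<inter> V"]) auto
qed

lemma smooth_fun_on_const: "smooth_fun_on A W (\<lambda>p. k)"
  unfolding smooth_fun_on_def by (simp add: o_def smooth_on_const)

lemma smooth_fun_on_add:
  "open W \<Longrightarrow> smooth_fun_on A W f \<Longrightarrow> smooth_fun_on A W h \<Longrightarrow> smooth_fun_on A W (\<lambda>p. f p + h p)"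
  unfolding smooth_fun_on_def by (auto simp: o_def intro!: smooth_on_add open_chart_image)

lemma smooth_fun_on_mult:
  "open W \<Longrightarrow> smooth_fun_on A W f \<Longrightarrow> smooth_fun_on A W h \<Longrightarrow> smooth_fun_on A W (\<lambda>p. f p * h p)"
  unfolding smooth_fun_on_def by (auto simp: o_def intro!: smooth_on_mult open_chart_image)

lemma smooth_fun_on_diff:
  "open W \<Longrightarrow> smooth_fun_on A W f \<Longrightarrow> smooth_fun_on A W h \<Longrightarrow> smooth_fun_on A W (\<lambda>p. f p - h p)"
  using smooth_fun_on_add[OF _ _ smooth_fun_on_mult[OF _ smooth_fun_on_const[of _ "-1"]]] by fastforce

lemma smooth_fun_on_inverse:
  "open W \<Longrightarrow> smooth_fun_on A W f \<Longrightarrow> (\<And>p. p \<in> W \<Longrightarrow> f p \<noteq> 0) \<Longrightarrow>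
    smooth_fun_on A W (\<lambda>p. inverse (f p))"
  unfolding smooth_fun_on_def o_def
  by (intro ballI smooth_on_inverse open_chart_image) (auto simp del: split_paired_All split_paired_Ex, metis chart_inv_map fst_conv snd_conv)

lemma smooth_field_on_zero:
  assumes "open W"
  shows "smooth_field_on A W (\<lambda>p. 0)"
  unfolding smooth_field_on_def
proof
  fix c assume c: "c \<in> A"
  show "smooth_on (chart_map c ` (chart_dom c \<inter> W)) (field_in_chart A c (\<lambda>p. 0))"
    by (rule smooth_on_cong_open[OF open_chart_image[OF c assms] smooth_on_const[of _ 0]])
       (use c in \<open>auto simp: field_in_chart_map linear_0 linear_to_chart\<close>)
qed

lemma smooth_field_on_add:
  assumes "open W" "smooth_field_on A W X" "smooth_field_on A W Y"
  shows "smooth_field_on A W (\<lambda>p. X p + Y p)"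
  unfolding smooth_field_on_def
proof
  fix c assume c: "c \<in> A"
  note S = open_chart_image[OF c assms(1)]
  show "smooth_on (chart_map c ` (chart_dom c \<inter> W)) (field_in_chart A c (\<lambda>p. X p + Y p))"
    by (rule smooth_on_cong_open[OF S smooth_on_add[OF S smooth_field_onD[OF assms(2) c] smooth_field_onD[OF assms(3) c]]])
       (use c in \<open>auto simp: field_in_chart_map linear_add linear_to_chart\<close>)
qed

lemma smooth_field_on_scaleR:
  assumes "open W" "smooth_fun_on A W f" "smooth_field_on A W X"
  shows "smooth_field_on A W (\<lambda>p. f p *\<^sub>R X p)"
  unfolding smooth_field_on_def
proof
  fix c assume c: "c \<in> A"
  note S = open_chart_image[OF c assms(1)]
  show "smooth_on (chart_map c ` (chart_dom c \<inter> W)) (field_in_chart A c (\<lambda>p. f p *\<^sub>R X p))"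
    by (rule smooth_on_cong_open[OF S smooth_on_scaleR[OF S smooth_fun_onD[OF assms(2) c] smooth_field_onD[OF assms(3) c]]])
       (use c in \<open>auto simp: field_in_chart_map linear_cmul linear_to_chart\<close>)
qed

lemma smooth_field_on_diff:
  "open W \<Longrightarrow> smooth_field_on A W X \<Longrightarrow> smooth_field_on A W Y \<Longrightarrow> smooth_field_on A W (\<lambda>p. X p - Y p)"
  using smooth_field_on_add[of W X "\<lambda>p. (-1) *\<^sub>R Y p"]
    smooth_field_on_scaleR[OF _ smooth_fun_on_const[of _ "-1"], of W Y] by simp

text \<open>The chart selected at \<open>p\<close> may jump with \<open>p\<close>; to differentiate \<open>field_deriv A X f\<close> it has to be
  computed in one chart on a whole neighbourhood.\<close>

lemma field_deriv_in_chart: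
  assumes "c \<in> A" "open W" "p \<in> W" "p \<in> chart_dom c" "smooth_fun_on A W f"
  shows "field_deriv A X f p =
    frechet_derivative (f \<circ> chart_inv c) (at (chart_map c p)) (field_in_chart A c X (chart_map c p))"
  using frechet_derivative_at[OF has_derivative_through_chart[of "chart_at A p" c W p f]]
    smooth_fun_onD[OF assms(5)] assms
  by (simp add: field_deriv_def field_in_chart_map to_chart_eq fun_eq_iff)

lemma fun_has_derivative_in_chart:
  assumes "c \<in> A" "open W" "p \<in> W" "p \<in> chart_dom c" "smooth_fun_on A W f"
  shows "((f \<circ> chart_inv c) has_derivative frechet_derivative (f \<circ> chart_inv c) (at (chart_map c p)))
    (at (chart_map c p))"
  by (rule smooth_on_has_derivative[OF smooth_fun_onD[OF assms(5,1)]]) (use assms in auto)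

lemma smooth_fun_on_field_deriv:
  assumes "open W" "smooth_fun_on A W f" "smooth_field_on A W X"
  shows "smooth_fun_on A W (field_deriv A X f)"
  unfolding smooth_fun_on_def
proof
  fix c assume c: "c \<in> A"
  note S = open_chart_image[OF c assms(1)]
  show "smooth_on (chart_map c ` (chart_dom c \<inter> W)) (field_deriv A X f \<circ> chart_inv c)"
    by (rule smooth_on_cong_open[OF S smooth_on_directional_derivative[OF S smooth_fun_onD[OF assms(2) c] smooth_field_onD[OF assms(3) c]]])
       (use c assms in \<open>auto simp: field_deriv_in_chart[OF c assms(1) _ _ assms(2)]\<close>)
qed

lemma field_deriv_cong:
  assumes "open W" "p \<in> W" "smooth_fun_on A W f" "\<And>q. q \<in> W \<Longrightarrow> f q = h q" "X p = Y p"
  shows "field_deriv A X f p = field_deriv A Y h p"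
proof -
  let ?c = "chart_at A p"
  have "((h \<circ> chart_inv ?c) has_derivative frechet_derivative (f \<circ> chart_inv ?c) (at (chart_map ?c p)))
      (at (chart_map ?c p))"
    by (rule has_derivative_transform_within_open[OF fun_has_derivative_in_chart[OF _ assms(1,2) _ assms(3)]
          open_chart_image[OF _ assms(1)]])
       (use assms in auto)
  from frechet_derivative_at[OF this] show ?thesis
    by (simp add: field_deriv_def assms(5))
qed

lemma field_deriv_const [simp]: "field_deriv A X (\<lambda>q. k) p = 0"
  by (simp add: field_deriv_def o_def)

lemma field_deriv_add:
  assumes "open W" "p \<in> W" "smooth_fun_on A W f" "smooth_fun_on A W h"
  shows "field_deriv A X (\<lambda>q. f q + h q) p = field_deriv A X f p + field_deriv A X h p"
  using frechet_derivative_at[OF has_derivative_add[OF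
      fun_has_derivative_in_chart[OF chart_at(1) assms(1,2) chart_at(2) assms(3)]
      fun_has_derivative_in_chart[OF chart_at(1) assms(1,2) chart_at(2) assms(4)]]]
  by (auto simp: field_deriv_def fun_eq_iff o_def)

lemma field_deriv_mult:
  assumes "open W" "p \<in> W" "smooth_fun_on A W f" "smooth_fun_on A W h"
  shows "field_deriv A X (\<lambda>q. f q * h q) p = f p * field_deriv A X h p + field_deriv A X f p * h p"
  using frechet_derivative_at[OF has_derivative_mult[OF
      fun_has_derivative_in_chart[OF chart_at(1) assms(1,2) chart_at(2) assms(3)]
      fun_has_derivative_in_chart[OF chart_at(1) assms(1,2) chart_at(2) assms(4)]]]
  by (auto simp: field_deriv_def fun_eq_iff o_def)

lemma field_deriv_diff:
  assumes "open W" "p \<in> W" "smooth_fun_on A W f" "smooth_fun_on A W h"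
  shows "field_deriv A X (\<lambda>q. f q - h q) p = field_deriv A X f p - field_deriv A X h p"
  using frechet_derivative_at[OF has_derivative_diff[OF
      fun_has_derivative_in_chart[OF chart_at(1) assms(1,2) chart_at(2) assms(3)]
      fun_has_derivative_in_chart[OF chart_at(1) assms(1,2) chart_at(2) assms(4)]]]
  by (auto simp: field_deriv_def fun_eq_iff o_def)

lemma linear_field_deriv:
  assumes "open W" "p \<in> W" "smooth_fun_on A W f"
  shows "linear (\<lambda>v. field_deriv A (\<lambda>q. v) f p)"
  unfolding field_deriv_def
  using has_derivative_linear[OF fun_has_derivative_in_chart[OF chart_at(1) assms(1,2) chart_at(2) assms(3)]]
  by simp

lemma field_deriv_at: "field_deriv A X f p = field_deriv A (\<lambda>q. X p) f p"
  by (simp add: field_deriv_def)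

section \<open>The Lie bracket\<close>

lemma smooth_fun_on_coordinate: "c \<in> A \<Longrightarrow> smooth_fun_on A (chart_dom c) (\<lambda>q. chart_map c q \<bullet> b)"
proof (rule smooth_fun_onI)
  fix p assume c: "c \<in> A" "p \<in> chart_dom c"
  have S: "open (chart_map c ` chart_dom c)"
    using c by (simp add: open_chart_image' open_chart_dom)
  have "smooth_on (chart_map c ` chart_dom c) (\<lambda>y. y)"
    by (rule smooth_on_cong_open[OF S smooth_chart_change[OF c(1) c(1), unfolded Int_absorb]])
       (use c in auto)
  then have "smooth_on (chart_map c ` chart_dom c) (\<lambda>y. y \<bullet> b)"
    by (rule smooth_on_linear[OF S bounded_linear_inner_left])
  then have "smooth_on (chart_map c ` chart_dom c) ((\<lambda>q. chart_map c q \<bullet> b) \<circ> chart_inv c)"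
    by (rule smooth_on_cong_open[OF S]) (use c in auto)
  then show "\<exists>c'\<in>A. \<exists>U. open U \<and> p \<in> U \<and> U \<subseteq> chart_dom c' \<and>
      smooth_on (chart_map c' ` U) ((\<lambda>q. chart_map c q \<bullet> b) \<circ> chart_inv c')"
    using c open_chart_dom by blast
qed

lemma derivative_coordinate:
  assumes "c \<in> A" "p \<in> chart_dom c"
  shows "frechet_derivative ((\<lambda>q. chart_map c q \<bullet> b) \<circ> chart_inv c) (at (chart_map c p)) v = v \<bullet> b"
proof -
  have "((\<lambda>v. v \<bullet> b) has_derivative (\<lambda>v. v \<bullet> b)) (at (chart_map c p))"
    by (rule bounded_linear_imp_has_derivative[OF bounded_linear_inner_left])
  then have "(((\<lambda>q. chart_map c q \<bullet> b) \<circ> chart_inv c) has_derivative (\<lambda>v. v \<bullet> b)) (at (chart_map c p))"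
  proof (rule has_derivative_transform_within_open)
    show "open (chart_map c ` chart_dom c)" "chart_map c p \<in> chart_map c ` chart_dom c"
      using assms by (simp_all add: open_chart_image')
    fix y assume "y \<in> chart_map c ` chart_dom c"
    then obtain q where "y = chart_map c q" "q \<in> chart_dom c" by blast
    then show "y \<bullet> b = ((\<lambda>q. chart_map c q \<bullet> b) \<circ> chart_inv c) y"
      using assms(1) by simp
  qed
  from frechet_derivative_at[OF this] show ?thesis by (metis (no_types))
qed

text \<open>The coordinate functions of a chart already separate tangent vectors. So identities between vector
  fields, such as the rules for the bracket, can be verified on functions; these need to be defined near
  \<open>p\<close> only.\<close>

lemma vector_eqI:
  assumes "\<And>W f. open W \<Longrightarrow> p \<in> W \<Longrightarrow> smooth_fun_on A W f \<Longrightarrow>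
    field_deriv A X f p = field_deriv A Y f p"
  shows "X p = Y p"
proof (rule euclidean_eqI)
  fix b :: 'e
  show "X p \<bullet> b = Y p \<bullet> b"
    using assms[of "chart_dom (chart_at A p)" "\<lambda>q. chart_map (chart_at A p) q \<bullet> b"]
    by (simp add: field_deriv_def derivative_coordinate smooth_fun_on_coordinate)
qed

lemma commutator_in_chart:
  assumes "c \<in> A" "open W" "p \<in> W" "p \<in> chart_dom c"
    and "smooth_fun_on A W f" "smooth_field_on A W X" "smooth_field_on A W Y"
  shows "field_deriv A X (field_deriv A Y f) p - field_deriv A Y (field_deriv A X f) p =
    frechet_derivative (f \<circ> chart_inv c) (at (chart_map c p))
      (frechet_derivative (field_in_chart A c Y) (at (chart_map c p)) (field_in_chart A c X (chart_map c p)) -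
       frechet_derivative (field_in_chart A c X) (at (chart_map c p)) (field_in_chart A c Y (chart_map c p)))"
proof -
  let ?S = "chart_map c ` (chart_dom c \<inter> W)"
  note S = open_chart_image[OF assms(1,2)]
  have p: "chart_map c p \<in> ?S" using assms by auto
  have eq: "frechet_derivative (field_deriv A Z f \<circ> chart_inv c) (at (chart_map c p)) =
      frechet_derivative (\<lambda>y. frechet_derivative (f \<circ> chart_inv c) (at y) (field_in_chart A c Z y)) (at (chart_map c p))"
    if Z: "smooth_field_on A W Z" for Z
  proof (rule frechet_derivative_transform_within_open[OF _ S p])
    show "(field_deriv A Z f \<circ> chart_inv c) differentiable at (chart_map c p)"
      using fun_has_derivative_in_chart[OF assms(1-4) smooth_fun_on_field_deriv[OF assms(2,5) Z]]
      unfolding differentiable_def by blast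
  qed (use assms in \<open>auto simp: field_deriv_in_chart[OF assms(1,2) _ _ assms(5)]\<close>)
  show ?thesis
    using directional_derivative_commutator[OF S smooth_fun_onD[OF assms(5,1)]
        smooth_field_onD[OF assms(6,1)] smooth_field_onD[OF assms(7,1)] p]
    by (simp add: field_deriv_in_chart[OF assms(1-4) smooth_fun_on_field_deriv[OF assms(2,5)]] assms(6,7) eq)
qed

lemma lie_bracket_eq:
  "lie_bracket A X Y p =
    frechet_derivative (field_in_chart A (chart_at A p) Y) (at (chart_map (chart_at A p) p))
      (field_in_chart A (chart_at A p) X (chart_map (chart_at A p) p)) -
    frechet_derivative (field_in_chart A (chart_at A p) X) (at (chart_map (chart_at A p) p))
      (field_in_chart A (chart_at A p) Y (chart_map (chart_at A p) p))"
  by (simp add: lie_bracket_def Let_def field_in_chart_map)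

lemma field_deriv_lie_bracket:
  assumes "open W" "p \<in> W" "smooth_fun_on A W f" "smooth_field_on A W X" "smooth_field_on A W Y"
  shows "field_deriv A (lie_bracket A X Y) f p =
    field_deriv A X (field_deriv A Y f) p - field_deriv A Y (field_deriv A X f) p"
  unfolding commutator_in_chart[OF chart_at(1) assms(1,2) chart_at(2) assms(3-5)]
  by (simp add: field_deriv_def lie_bracket_eq)

text \<open>The commutator of two derivations does not mention a chart, so neither does the bracket. Applied to
  the coordinate functions of \<open>c\<close>, it yields the components of the bracket in \<open>c\<close>.\<close>

lemma lie_bracket_in_chart:
  assumes "c \<in> A" "open W" "p \<in> W" "p \<in> chart_dom c"
    and "smooth_field_on A W X" "smooth_field_on A W Y"
  shows "field_in_chart A c (lie_bracket A X Y) (chart_map c p) =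
      frechet_derivative (field_in_chart A c Y) (at (chart_map c p)) (field_in_chart A c X (chart_map c p)) -
      frechet_derivative (field_in_chart A c X) (at (chart_map c p)) (field_in_chart A c Y (chart_map c p))"
    (is "?l = ?r")
proof (rule euclidean_eqI)
  fix b :: 'e
  let ?f = "\<lambda>q. chart_map c q \<bullet> b" and ?W = "W \<inter> chart_dom c"
  have W: "open ?W" "p \<in> ?W" and f: "smooth_fun_on A ?W ?f"
    and XY: "smooth_field_on A ?W X" "smooth_field_on A ?W Y"
    using assms open_chart_dom smooth_field_on_subset smooth_fun_on_subset[OF smooth_fun_on_coordinate]
    by auto
  show "?l \<bullet> b = ?r \<bullet> b"
    using field_deriv_lie_bracket[OF W f XY] field_deriv_in_chart[OF assms(1) W assms(4) f, of "lie_bracket A X Y"]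
      commutator_in_chart[OF assms(1) W assms(4) f XY]
    by (simp add: derivative_coordinate assms)
qed

lemma smooth_field_on_lie_bracket:
  assumes "open W" "smooth_field_on A W X" "smooth_field_on A W Y"
  shows "smooth_field_on A W (lie_bracket A X Y)"
  unfolding smooth_field_on_def
proof
  fix c assume c: "c \<in> A"
  note S = open_chart_image[OF c assms(1)]
  let ?X = "field_in_chart A c X" and ?Y = "field_in_chart A c Y"
  note X = smooth_field_onD[OF assms(2) c] and Y = smooth_field_onD[OF assms(3) c]
  have "smooth_on (chart_map c ` (chart_dom c \<inter> W))
      (\<lambda>y. frechet_derivative ?Y (at y) (?X y) + (-1) *\<^sub>R frechet_derivative ?X (at y) (?Y y))"
    by (intro smooth_on_add S smooth_on_scaleR smooth_on_const smooth_on_directional_derivative X Y)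
  then show "smooth_on (chart_map c ` (chart_dom c \<inter> W)) (field_in_chart A c (lie_bracket A X Y))"
    by (rule smooth_on_cong_open[OF S])
       (use lie_bracket_in_chart[OF c assms(1) _ _ assms(2,3)] in auto)
qed

section \<open>Bump functions and global frames\<close>

text \<open>The extension is smooth on \<open>U\<close> and zero on the complement of \<open>K\<close>, and these two open sets cover the
  manifold.\<close>

lemma smooth_fun_on_extend_zero:
  assumes "open U" "closed K" "K \<subseteq> U" "smooth_fun_on A U f" "\<And>q. q \<in> U - K \<Longrightarrow> f q = 0"
  shows "smooth_fun_on A UNIV (\<lambda>q. if q \<in> U then f q else 0)"
proof (rule smooth_fun_on_local)
  fix p
  show "\<exists>V. open V \<and> p \<in> V \<and> smooth_fun_on A V (\<lambda>q. if q \<in> U then f q else 0)"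
  proof (cases "p \<in> U")
    case True
    then show ?thesis
      using assms(1) smooth_fun_on_cong[OF assms(1,4), of "\<lambda>q. if q \<in> U then f q else 0"] by auto
  next
    case False
    have "smooth_fun_on A (- K) (\<lambda>q. if q \<in> U then f q else 0)"
      by (rule smooth_fun_on_cong[OF _ smooth_fun_on_const[of _ 0]]) (use assms in auto)
    then show ?thesis using False assms by (intro exI[of _ "- K"]) auto
  qed
qed

lemma smooth_field_on_extend_zero:
  assumes "open U" "closed K" "K \<subseteq> U" "smooth_field_on A U X" "\<And>q. q \<in> U - K \<Longrightarrow> X q = 0"
  shows "smooth_field_on A UNIV (\<lambda>q. if q \<in> U then X q else 0)"
proof (rule smooth_field_on_local)
  fix p
  show "\<exists>V. open V \<and> p \<in> V \<and> smooth_field_on A V (\<lambda>q. if q \<in> U then X q else 0)"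
  proof (cases "p \<in> U")
    case True
    then show ?thesis
      using assms(1) smooth_field_on_cong[OF assms(1,4), of "\<lambda>q. if q \<in> U then X q else 0"] by auto
  next
    case False
    have "smooth_field_on A (- K) (\<lambda>q. if q \<in> U then X q else 0)"
      by (rule smooth_field_on_cong[OF _ smooth_field_on_zero]) (use assms in auto)
    then show ?thesis using False assms by (intro exI[of _ "- K"]) auto
  qed
qed

text \<open>A closed coordinate ball is compact, hence closed in the whole manifold, because the manifold is a
  Hausdorff space. This is what allows the extension by zero.\<close>

lemma bump_function:
  assumes "c \<in> A" "p \<in> chart_dom c"
  obtains \<beta> K U where "smooth_fun_on A UNIV \<beta>" "closed K" "K \<subseteq> chart_dom c" "\<And>q. q \<notin> K \<Longrightarrow> \<beta> q = 0"
    "open U" "p \<in> U" "U \<subseteq> K" "\<And>q. q \<in> U \<Longrightarrow> \<beta> q \<noteq> 0"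
proof -
  let ?y = "chart_map c p" and ?S = "chart_map c ` chart_dom c"
  have S: "open ?S" using assms by (simp add: open_chart_image' open_chart_dom)
  then obtain r where r: "r > 0" "cball ?y r \<subseteq> ?S"
    using assms by (metis imageI open_contains_cball)
  have inv: "continuous_on ?S (chart_inv c)" and cmap: "continuous_on (chart_dom c) (chart_map c)"
    using homeomorphism_chart[OF assms(1)] unfolding homeomorphism_def by auto
  define K where "K = chart_inv c ` cball ?y r"
  define U where "U = chart_dom c \<inter> chart_map c -` ball ?y r"
  have "compact K" unfolding K_def
    by (intro compact_continuous_image continuous_on_subset[OF inv r(2)] compact_cball)
  then have "closed K" by (rule compact_imp_closed)
  have K: "q \<in> K \<longleftrightarrow> q \<in> chart_dom c \<and> chart_map c q \<in> cball ?y r" for q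
  proof
    assume "q \<in> K"
    then obtain y where y: "y \<in> cball ?y r" "q = chart_inv c y" unfolding K_def by blast
    then obtain q' where "y = chart_map c q'" "q' \<in> chart_dom c" using r(2) by blast
    then show "q \<in> chart_dom c \<and> chart_map c q \<in> cball ?y r" using y assms(1) by simp
  next
    assume "q \<in> chart_dom c \<and> chart_map c q \<in> cball ?y r"
    then show "q \<in> K" unfolding K_def using assms(1) by (metis chart_inv_map image_eqI)
  qed
  have "open U" unfolding U_def
    by (rule continuous_open_preimage[OF cmap open_chart_dom[OF assms(1)] open_ball])
  \<comment> \<open>the argument of \<open>flat\<close> is positive exactly on the open ball\<close>
  define \<theta> where "\<theta> = (\<lambda>y. flat 0 (r\<^sup>2 - (y - ?y) \<bullet> (y - ?y)))"
  have "smooth_on ?S (\<lambda>y::'e. y)"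
    by (rule smooth_on_cong_open[OF S smooth_chart_change[OF assms(1) assms(1), unfolded Int_absorb]])
       (use assms in auto)
  then have d: "smooth_on ?S (\<lambda>y. y + (- ?y))"
    by (intro smooth_on_add S smooth_on_const)
  have "smooth_on ?S (\<lambda>y. r\<^sup>2 + (-1) * ((y + (- ?y)) \<bullet> (y + (- ?y))))"
    by (rule smooth_on_add[OF S smooth_on_const smooth_on_mult[OF S smooth_on_const
          smooth_on_bilinear[OF S bounded_bilinear_inner d d]]])
  then have "smooth_on ?S (\<lambda>y. r\<^sup>2 - (y - ?y) \<bullet> (y - ?y))" by simp
  from smooth_on_compose[OF S _ smooth_on_flat this] have \<theta>: "smooth_on ?S \<theta>"
    unfolding \<theta>_def by simp
  have "smooth_on ?S ((\<lambda>q. \<theta> (chart_map c q)) \<circ> chart_inv c)"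
    by (rule smooth_on_cong_open[OF S \<theta>]) (use assms in auto)
  then have "smooth_fun_on A (chart_dom c) (\<lambda>q. \<theta> (chart_map c q))"
    by (intro smooth_fun_onI) (use assms open_chart_dom in blast)
  moreover have nz: "\<theta> y = 0 \<longleftrightarrow> r \<le> dist ?y y" for y
  proof -
    have "\<theta> y \<noteq> 0 \<longleftrightarrow> (norm (y - ?y))\<^sup>2 < r\<^sup>2"
      by (auto simp: \<theta>_def flat_def power2_norm_eq_inner)
    also have "\<dots> \<longleftrightarrow> norm (y - ?y) < r"
      using r(1) by (meson abs_le_square_iff less_le_not_le norm_ge_zero power2_less_imp_less power_strict_mono zero_less_numeral)
    finally show ?thesis by (auto simp: dist_norm norm_minus_commute)
  qed
  ultimately have "smooth_fun_on A UNIV (\<lambda>q. if q \<in> chart_dom c then \<theta> (chart_map c q) else 0)"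
    by (intro smooth_fun_on_extend_zero[OF _ \<open>closed K\<close>]) (use K open_chart_dom assms in auto)
  then show ?thesis
    by (rule that[OF _ \<open>closed K\<close> _ _ \<open>open U\<close>]) (use K nz assms r in \<open>auto simp: U_def\<close>)
qed

text \<open>A global stand-in for a local frame. The coordinate fields of a chart, times a bump function, are
  global fields \<open>E\<close>, and so are the components of any field \<open>Z\<close>, times the bump function. Hence
  \<open>Z\<close> times the square of the bump function, here called \<open>\<beta>\<close>, is a combination of the \<open>E\<close> with smooth
  global coefficients. The isomorphism \<open>L q\<close> records that the \<open>E\<close> form a basis at \<open>q\<close>.\<close>

lemma global_frame:
  obtains \<beta> U L and E :: "'e \<Rightarrow> 'a \<Rightarrow> 'e" where "smooth_fun_on A UNIV \<beta>" "\<And>b. smooth_field_on A UNIV (E b)"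
    "open U" "p \<in> U" "\<And>q. q \<in> U \<Longrightarrow> \<beta> q \<noteq> 0"
    "\<And>q. q \<in> U \<Longrightarrow> linear (L q)" "\<And>q. q \<in> U \<Longrightarrow> bij (L q)" "\<And>q b. q \<in> U \<Longrightarrow> E b q = L q b"
    "\<And>Z. smooth_field_on A UNIV Z \<Longrightarrow> \<exists>f. (\<forall>b. smooth_fun_on A UNIV (f b)) \<and>
        (\<forall>q. \<beta> q *\<^sub>R Z q = (\<Sum>b\<in>Basis. f b q *\<^sub>R E b q))"
proof -
  let ?c = "chart_at A p"
  define D where "D = chart_dom ?c"
  have D: "open D" "p \<in> D" unfolding D_def by (simp_all add: open_chart_dom)
  obtain \<beta> K U where \<beta>: "smooth_fun_on A UNIV \<beta>" "closed K" "K \<subseteq> D" "\<And>q. q \<notin> K \<Longrightarrow> \<beta> q = 0"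
    "open U" "p \<in> U" "U \<subseteq> K" "\<And>q. q \<in> U \<Longrightarrow> \<beta> q \<noteq> 0"
    using bump_function[OF chart_at, of p] unfolding D_def by metis
  define T where "T = (\<lambda>q. chart_change ?c (chart_at A q) q)"
  have T: "linear (T q)" "to_chart A ?c q (T q v) = v" "T q (to_chart A ?c q v) = v" if "q \<in> D" for q v
    using that unfolding T_def D_def by (auto simp: linear_chart_change to_chart_eq chart_change_comp)
  have sT: "smooth_field_on A D (\<lambda>q. T q b)" for b
  proof (rule smooth_field_onI)
    fix q assume "q \<in> D"
    have "smooth_on (chart_map ?c ` D) (field_in_chart A ?c (\<lambda>q. T q b))"
      by (rule smooth_on_cong_open[OF open_chart_image' smooth_on_const[of _ b]])
         (use T D in \<open>auto simp: field_in_chart_map D_def\<close>)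
    then show "\<exists>c\<in>A. \<exists>U. open U \<and> q \<in> U \<and> U \<subseteq> chart_dom c \<and>
        smooth_on (chart_map c ` U) (field_in_chart A c (\<lambda>q. T q b))"
      using \<open>q \<in> D\<close> D by (intro bexI[of _ ?c] exI[of _ D]) (simp_all add: D_def)
  qed
  define E where "E = (\<lambda>b q. if q \<in> D then \<beta> q *\<^sub>R T q b else 0)"
  have E: "smooth_field_on A UNIV (E b)" for b
    unfolding E_def
    by (rule smooth_field_on_extend_zero[OF D(1) \<beta>(2,3) smooth_field_on_scaleR[OF D(1) smooth_fun_on_subset[OF \<beta>(1)] sT]])
       (use \<beta> in auto)
  have bij: "bij (\<lambda>v. \<beta> q *\<^sub>R T q v)" if "q \<in> U" for q
    by (rule o_bij[of "\<lambda>w. to_chart A ?c q (inverse (\<beta> q) *\<^sub>R w)"])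
       (use that \<beta> T in \<open>auto simp: fun_eq_iff subset_iff linear_cmul[OF T(1)]
          linear_cmul[OF linear_to_chart[OF chart_at(1)]] D_def\<close>)
  have lin: "linear (\<lambda>v. \<beta> q *\<^sub>R T q v)" if "q \<in> U" for q
    using that \<beta> T(1) by (intro linear_compose_scale_right) auto
  show ?thesis
  proof (rule that[of "\<lambda>q. \<beta> q * \<beta> q" E U "\<lambda>q v. \<beta> q *\<^sub>R T q v"])
    fix Z assume Z: "smooth_field_on A UNIV Z"
    define f where "f = (\<lambda>b q. if q \<in> D then \<beta> q * (to_chart A ?c q (Z q) \<bullet> b) else 0)"
    have "smooth_fun_on A D (\<lambda>q. to_chart A ?c q (Z q) \<bullet> b)" for b
    proof (rule smooth_fun_onI)
      fix q assume "q \<in> D"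
      note S = open_chart_image[OF chart_at(1) open_UNIV, of p, unfolded Int_UNIV_right]
      have "smooth_on (chart_map ?c ` D) ((\<lambda>q. to_chart A ?c q (Z q) \<bullet> b) \<circ> chart_inv ?c)"
        unfolding D_def
        by (rule smooth_on_cong_open[OF S smooth_on_linear[OF S bounded_linear_inner_left
                smooth_field_onD[OF Z chart_at(1), unfolded Int_UNIV_right]]])
           (auto simp: field_in_chart_map)
      then show "\<exists>c\<in>A. \<exists>U. open U \<and> q \<in> U \<and> U \<subseteq> chart_dom c \<and>
        smooth_on (chart_map c ` U) ((\<lambda>q. to_chart A ?c q (Z q) \<bullet> b) \<circ> chart_inv c)"
        using \<open>q \<in> D\<close> D by (intro bexI[of _ ?c] exI[of _ D]) (simp_all add: D_def)
    qed
    then have "smooth_fun_on A UNIV (f b)" for b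
      unfolding f_def
      by (intro smooth_fun_on_extend_zero[OF D(1) \<beta>(2,3)] smooth_fun_on_mult D smooth_fun_on_subset[OF \<beta>(1)])
         (use \<beta> in auto)
    moreover have "(\<beta> q * \<beta> q) *\<^sub>R Z q = (\<Sum>b\<in>Basis. f b q *\<^sub>R E b q)" for q
    proof (cases "q \<in> D")
      case True
      have "(\<Sum>b\<in>Basis. f b q *\<^sub>R E b q) =
          (\<beta> q * \<beta> q) *\<^sub>R T q (\<Sum>b\<in>Basis. (to_chart A ?c q (Z q) \<bullet> b) *\<^sub>R b)"
        using True unfolding f_def E_def
        by (simp add: linear_sum[OF T(1)] linear_cmul[OF T(1)] scaleR_sum_right mult_ac)
      then show ?thesis using True T by (simp add: euclidean_representation)
    next
      case False
      then show ?thesis using \<beta> by (auto simp: f_def)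
    qed
    ultimately show "\<exists>f. (\<forall>b. smooth_fun_on A UNIV (f b)) \<and>
        (\<forall>q. (\<beta> q * \<beta> q) *\<^sub>R Z q = (\<Sum>b\<in>Basis. f b q *\<^sub>R E b q))" by blast
  qed (use \<beta> E bij lin in \<open>auto intro!: smooth_fun_on_mult simp: E_def\<close>)
qed

section \<open>Vector fields as a module over the smooth functions\<close>

lemma smooth_funs_const: "(\<lambda>p. k) \<in> smooth_funs A"
  by (simp add: smooth_funs_def smooth_fun_on_const)

lemma smooth_funs_add: "f \<in> smooth_funs A \<Longrightarrow> h \<in> smooth_funs A \<Longrightarrow> (\<lambda>p. f p + h p) \<in> smooth_funs A"
  by (simp add: smooth_funs_def smooth_fun_on_add)

lemma smooth_funs_diff: "f \<in> smooth_funs A \<Longrightarrow> h \<in> smooth_funs A \<Longrightarrow> (\<lambda>p. f p - h p) \<in> smooth_funs A"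
  by (simp add: smooth_funs_def smooth_fun_on_diff)

lemma smooth_funs_mult: "f \<in> smooth_funs A \<Longrightarrow> h \<in> smooth_funs A \<Longrightarrow> (\<lambda>p. f p * h p) \<in> smooth_funs A"
  by (simp add: smooth_funs_def smooth_fun_on_mult)

lemma smooth_funs_sum:
  "(\<And>i. i \<in> I \<Longrightarrow> f i \<in> smooth_funs A) \<Longrightarrow> (\<lambda>p. \<Sum>i\<in>I. f i p) \<in> smooth_funs A"
  by (induction I rule: infinite_finite_induct) (auto simp: smooth_funs_const smooth_funs_add)

lemma vector_fields_zero: "(\<lambda>p. 0) \<in> vector_fields A"
  by (simp add: vector_fields_def smooth_field_on_zero)

lemma vector_fields_add:
  "X \<in> vector_fields A \<Longrightarrow> Y \<in> vector_fields A \<Longrightarrow> (\<lambda>p. X p + Y p) \<in> vector_fields A"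
  by (simp add: vector_fields_def smooth_field_on_add)

lemma vector_fields_scaleR:
  "f \<in> smooth_funs A \<Longrightarrow> X \<in> vector_fields A \<Longrightarrow> (\<lambda>p. f p *\<^sub>R X p) \<in> vector_fields A"
  by (simp add: smooth_funs_def vector_fields_def smooth_field_on_scaleR)

lemma vector_fields_sum:
  "(\<And>i. i \<in> I \<Longrightarrow> X i \<in> vector_fields A) \<Longrightarrow> (\<lambda>p. \<Sum>i\<in>I. X i p) \<in> vector_fields A"
  by (induction I rule: infinite_finite_induct) (auto simp: vector_fields_zero vector_fields_add)

lemma vector_fields_lie_bracket:
  "X \<in> vector_fields A \<Longrightarrow> Y \<in> vector_fields A \<Longrightarrow> lie_bracket A X Y \<in> vector_fields A"
  by (simp add: vector_fields_def smooth_field_on_lie_bracket)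

lemma smooth_funs_field_deriv:
  "X \<in> vector_fields A \<Longrightarrow> f \<in> smooth_funs A \<Longrightarrow> field_deriv A X f \<in> smooth_funs A"
  by (simp add: smooth_funs_def vector_fields_def smooth_fun_on_field_deriv)

lemma field_deriv_add_field:
  assumes "open W" "p \<in> W" "smooth_fun_on A W f"
  shows "field_deriv A (\<lambda>q. X q + Y q) f p = field_deriv A X f p + field_deriv A Y f p"
  using linear_add[OF linear_field_deriv[OF assms], of "X p" "Y p"]
  by (simp add: field_deriv_at[of X] field_deriv_at[of Y] field_deriv_at[of "\<lambda>q. X q + Y q"])

lemma field_deriv_scaleR_field:
  assumes "open W" "p \<in> W" "smooth_fun_on A W f"
  shows "field_deriv A (\<lambda>q. h q *\<^sub>R X q) f p = h p * field_deriv A X f p"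
  using linear_cmul[OF linear_field_deriv[OF assms], of "h p" "X p"]
  by (simp add: field_deriv_at[of X] field_deriv_at[of "\<lambda>q. h q *\<^sub>R X q"])

lemma lie_bracket_skew: "lie_bracket A Y X p = - lie_bracket A X Y p"
  by (simp add: lie_bracket_def Let_def)

text \<open>The sum and product rules for the bracket are checked on functions, where the bracket is a commutator.\<close>

lemma lie_bracket_add_left:
  assumes "X \<in> vector_fields A" "X' \<in> vector_fields A" "Y \<in> vector_fields A"
  shows "lie_bracket A (\<lambda>q. X q + X' q) Y p = lie_bracket A X Y p + lie_bracket A X' Y p"
proof (rule vector_eqI[of p "lie_bracket A (\<lambda>q. X q + X' q) Y"])
  fix W f assume W: "open W" "p \<in> W" "smooth_fun_on A W f"
  have S: "smooth_field_on A W X" "smooth_field_on A W X'" "smooth_field_on A W Y"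
    using assms smooth_field_on_subset unfolding vector_fields_def by blast+
  note F = smooth_fun_on_field_deriv[OF W(1,3)]
  have "field_deriv A Y (field_deriv A (\<lambda>q. X q + X' q) f) p =
      field_deriv A Y (\<lambda>q. field_deriv A X f q + field_deriv A X' f q) p"
    using W S by (intro field_deriv_cong[of W]) (auto simp: field_deriv_add_field[OF W(1) _ W(3)] intro: F smooth_field_on_add)
  then show "field_deriv A (lie_bracket A (\<lambda>q. X q + X' q) Y) f p =
      field_deriv A (\<lambda>q. lie_bracket A X Y q + lie_bracket A X' Y q) f p"
    by (simp add: field_deriv_lie_bracket[OF W] field_deriv_add_field[OF W(1,2)] S F W
        smooth_field_on_add field_deriv_add[OF W(1,2)])
qed

lemma lie_bracket_scaleR_left:
  assumes "h \<in> smooth_funs A" "X \<in> vector_fields A" "Y \<in> vector_fields A"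
  shows "lie_bracket A (\<lambda>q. h q *\<^sub>R X q) Y p = h p *\<^sub>R lie_bracket A X Y p - field_deriv A Y h p *\<^sub>R X p"
proof (rule vector_eqI[of p "lie_bracket A (\<lambda>q. h q *\<^sub>R X q) Y"
      "\<lambda>p. h p *\<^sub>R lie_bracket A X Y p - field_deriv A Y h p *\<^sub>R X p"])
  fix W f assume W: "open W" "p \<in> W" "smooth_fun_on A W f"
  have S: "smooth_field_on A W X" "smooth_field_on A W Y" "smooth_fun_on A W h"
    using assms smooth_field_on_subset smooth_fun_on_subset unfolding vector_fields_def smooth_funs_def by blast+
  note F = smooth_fun_on_field_deriv[OF W(1,3)]
  have "field_deriv A Y (field_deriv A (\<lambda>q. h q *\<^sub>R X q) f) p =
      field_deriv A Y (\<lambda>q. h q * field_deriv A X f q) p"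
    using W S by (intro field_deriv_cong[of W]) (auto simp: field_deriv_scaleR_field[OF W(1) _ W(3)] intro: F smooth_field_on_scaleR)
  moreover have "field_deriv A (\<lambda>p. h p *\<^sub>R lie_bracket A X Y p - field_deriv A Y h p *\<^sub>R X p) f p =
      h p * field_deriv A (lie_bracket A X Y) f p - field_deriv A Y h p * field_deriv A X f p"
    using field_deriv_add_field[OF W, of "\<lambda>p. h p *\<^sub>R lie_bracket A X Y p" "\<lambda>p. (- field_deriv A Y h p) *\<^sub>R X p"]
      field_deriv_scaleR_field[OF W, of h "lie_bracket A X Y"]
      field_deriv_scaleR_field[OF W, of "\<lambda>p. - field_deriv A Y h p" X] by simp
  ultimately show "field_deriv A (lie_bracket A (\<lambda>q. h q *\<^sub>R X q) Y) f p =
      field_deriv A (\<lambda>p. h p *\<^sub>R lie_bracket A X Y p - field_deriv A Y h p *\<^sub>R X p) f p"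
    by (simp add: field_deriv_lie_bracket[OF W] field_deriv_scaleR_field[OF W(1,2)] S F W
        smooth_field_on_scaleR field_deriv_mult[OF W(1,2)] algebra_simps)
qed

lemma field_deriv_double_bracket:
  assumes "X \<in> vector_fields A" "Y \<in> vector_fields A" "Z \<in> vector_fields A"
    and W: "open W" "p \<in> W" "smooth_fun_on A W f"
  shows "field_deriv A (lie_bracket A X (lie_bracket A Y Z)) f p =
    field_deriv A X (field_deriv A Y (field_deriv A Z f)) p -
    field_deriv A X (field_deriv A Z (field_deriv A Y f)) p -
    field_deriv A Y (field_deriv A Z (field_deriv A X f)) p +
    field_deriv A Z (field_deriv A Y (field_deriv A X f)) p"
proof -
  have S: "smooth_field_on A W X" "smooth_field_on A W Y" "smooth_field_on A W Z"
    using assms smooth_field_on_subset unfolding vector_fields_def by blast+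
  note F = smooth_fun_on_field_deriv[OF W(1)]
  have "field_deriv A X (field_deriv A (lie_bracket A Y Z) f) p =
      field_deriv A X (\<lambda>q. field_deriv A Y (field_deriv A Z f) q - field_deriv A Z (field_deriv A Y f) q) p"
    using W S by (intro field_deriv_cong[of W])
      (auto simp: field_deriv_lie_bracket[OF W(1) _ W(3)] intro: F smooth_field_on_lie_bracket)
  then show ?thesis
    using S W by (simp add: field_deriv_lie_bracket[OF W(1,2)] F smooth_field_on_lie_bracket field_deriv_diff[OF W(1,2)])
qed

text \<open>As operators on functions, the double brackets expand into twelve terms that cancel in pairs.\<close>

lemma jacobi:
  assumes "X \<in> vector_fields A" "Y \<in> vector_fields A" "Z \<in> vector_fields A"
  shows "lie_bracket A X (lie_bracket A Y Z) p + lie_bracket A Y (lie_bracket A Z X) p +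
    lie_bracket A Z (lie_bracket A X Y) p = 0"
proof (rule vector_eqI[of p "\<lambda>p. lie_bracket A X (lie_bracket A Y Z) p + lie_bracket A Y (lie_bracket A Z X) p +
    lie_bracket A Z (lie_bracket A X Y) p" "\<lambda>p. 0"])
  fix W f assume W: "open W" "p \<in> W" "smooth_fun_on A W f"
  have "field_deriv A (\<lambda>p. 0) f p = 0"
    using field_deriv_scaleR_field[OF W, of "\<lambda>q. 0" "\<lambda>q. 0"] by simp
  then show "field_deriv A (\<lambda>p. lie_bracket A X (lie_bracket A Y Z) p + lie_bracket A Y (lie_bracket A Z X) p +
      lie_bracket A Z (lie_bracket A X Y) p) f p = field_deriv A (\<lambda>p. 0) f p"
    using W by (simp add: field_deriv_add_field[OF W] field_deriv_double_bracket assms)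
qed

text \<open>Through every tangent vector passes a global vector field, so that equations between tensors that are
  known on global fields hold pointwise.\<close>

lemma ex_vector_field: "\<exists>X\<in>vector_fields A. X p = v"
proof -
  obtain \<beta> U L and E :: "'e \<Rightarrow> 'a \<Rightarrow> 'e" where \<beta>: "smooth_fun_on A UNIV \<beta>"
    and E: "\<And>b. smooth_field_on A UNIV (E b)" and U: "open U" "p \<in> U" and nz: "\<And>q. q \<in> U \<Longrightarrow> \<beta> q \<noteq> 0"
    and L: "\<And>q. q \<in> U \<Longrightarrow> linear (L q)" "\<And>q. q \<in> U \<Longrightarrow> bij (L q)" "\<And>q b. q \<in> U \<Longrightarrow> E b q = L q b"
    and Z: "\<And>Z. smooth_field_on A UNIV Z \<Longrightarrow> \<exists>f. (\<forall>b. smooth_fun_on A UNIV (f b)) \<and>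
      (\<forall>q. \<beta> q *\<^sub>R Z q = (\<Sum>b\<in>Basis. f b q *\<^sub>R E b q))"
    by (rule global_frame[of p], rule that, assumption+)
  obtain u where u: "v = L p u" using L(2)[OF U(2)] by (metis bij_pointE)
  have "(\<lambda>q. \<Sum>b\<in>Basis. (u \<bullet> b) *\<^sub>R E b q) \<in> vector_fields A"
    using E by (intro vector_fields_sum vector_fields_scaleR smooth_funs_const) (auto simp: vector_fields_def)
  moreover have "(\<Sum>b\<in>Basis. (u \<bullet> b) *\<^sub>R E b p) = L p (\<Sum>b\<in>Basis. (u \<bullet> b) *\<^sub>R b)"
    by (simp add: L(3)[OF U(2)] linear_sum[OF L(1)[OF U(2)]] linear_cmul[OF L(1)[OF U(2)]])
  ultimately show ?thesis
    using u by (auto simp: euclidean_representation intro!: bexI)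
qed

text \<open>Gaussian elimination with smooth coefficients. The part \<open>u\<close> of the new frame vector that is orthogonal
  to the previous ones does not vanish; adding a multiple of it to the solution for the previous
  vectors does not disturb their equations, and the multiple is chosen to meet the new one.\<close>

lemma local_riesz:
  assumes g: "riemannian_metric A g" and "open U"
    and E: "\<And>b. smooth_field_on A U (E b)"
    and L: "\<And>q. q \<in> U \<Longrightarrow> linear (L q)" "\<And>q. q \<in> U \<Longrightarrow> inj (L q)" "\<And>q b. q \<in> U \<Longrightarrow> E b q = L q b"
    and B: "B \<subseteq> Basis" and k: "\<And>b. smooth_fun_on A U (k b)"
  shows "\<exists>W. smooth_field_on A U W \<and> (\<forall>q\<in>U. W q \<in> span ((\<lambda>b. E b q) ` B) \<and> (\<forall>b\<in>B. g q (W q) (E b q) = k b q))"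
proof -
  have "finite B" using B finite_Basis finite_subset by blast
  then show ?thesis using B k
  proof (induction B arbitrary: k)
    case empty
    then show ?case using smooth_field_on_zero[OF \<open>open U\<close>] by auto
  next
    case (insert a B)
    have bil: "bilinear (g q)" and pos: "v \<noteq> 0 \<Longrightarrow> g q v v > 0" and sym: "g q u v = g q v u" for q u v
      using g unfolding riemannian_metric_def by auto
    have gs: "smooth_fun_on A U (\<lambda>q. g q (X q) (Y q))" if "smooth_field_on A U X" "smooth_field_on A U Y" for X Y
      using g that \<open>open U\<close> unfolding riemannian_metric_def metric_apply_def[abs_def] by blast
    obtain W0 where W0: "smooth_field_on A U W0" "\<And>q. q \<in> U \<Longrightarrow> W0 q \<in> span ((\<lambda>b. E b q) ` B)"
      "\<And>q b. q \<in> U \<Longrightarrow> b \<in> B \<Longrightarrow> g q (W0 q) (E b q) = k b q"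
      using insert.IH[of k] insert.prems by auto
    obtain P where P: "smooth_field_on A U P" "\<And>q. q \<in> U \<Longrightarrow> P q \<in> span ((\<lambda>b. E b q) ` B)"
      "\<And>q b. q \<in> U \<Longrightarrow> b \<in> B \<Longrightarrow> g q (P q) (E b q) = g q (E a q) (E b q)"
      using insert.IH[of "\<lambda>b q. g q (E a q) (E b q)"] insert.prems gs[OF E E] by auto
    define u where "u = (\<lambda>q. E a q - P q)"
    have su: "smooth_field_on A U u"
      unfolding u_def using E P \<open>open U\<close> by (simp add: smooth_field_on_diff)
    have orth: "g q (u q) (E b q) = 0" if "q \<in> U" "b \<in> B" for q b
      unfolding u_def using P that by (simp add: bilinear_lsub[OF bil])
    have orthP: "g q (u q) (P q) = 0" if "q \<in> U" for q
    proof (rule linear_eq_0_on_span[OF _ _ P(2)[OF that]])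
      show "linear (g q (u q))" using bil unfolding bilinear_def by blast
    qed (use orth that in auto)
    have pos': "g q (u q) (E a q) > 0" if q: "q \<in> U" for q
    proof -
      have "E a q \<notin> span ((\<lambda>b. E b q) ` B)"
      proof
        assume "E a q \<in> span ((\<lambda>b. E b q) ` B)"
        then have "L q a \<in> L q ` span B"
          using L q by (simp add: linear_span_image)
        then have "a \<in> span B" using L(2)[OF q] by (simp add: inj_image_mem_iff)
        moreover have "independent (insert a B)"
          using insert.prems(1) independent_Basis independent_mono by blast
        ultimately show False using insert.hyps(2) by (simp add: independent_insert)
      qed
      then have "u q \<noteq> 0" using P(2)[OF q] unfolding u_def by auto
      then have "g q (u q) (u q) > 0" by (rule pos)
      then show ?thesis using orthP[OF q] unfolding u_def by (simp add: bilinear_rsub[OF bil])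
    qed
    define c where "c = (\<lambda>q. (k a q - g q (W0 q) (E a q)) * inverse (g q (u q) (E a q)))"
    have "smooth_fun_on A U c"
      unfolding c_def using pos' insert.prems(2) \<open>open U\<close>
      by (intro smooth_fun_on_mult smooth_fun_on_diff smooth_fun_on_inverse gs W0 E su) force+
    then have "smooth_field_on A U (\<lambda>q. W0 q + c q *\<^sub>R u q)"
      using W0 su \<open>open U\<close> by (simp add: smooth_field_on_add smooth_field_on_scaleR)
    moreover have "W0 q + c q *\<^sub>R u q \<in> span ((\<lambda>b. E b q) ` insert a B)" if "q \<in> U" for q
      unfolding u_def using W0(2)[OF that] P(2)[OF that]
      by (intro span_add span_scale span_diff) (auto intro: span_base subsetD[OF span_mono[OF subset_insertI]])
    moreover have "g q (W0 q + c q *\<^sub>R u q) (E b q) = k b q" if "q \<in> U" "b \<in> insert a B" for q b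
      using that pos'[OF that(1)] W0(3)[OF that(1)] orth[OF that(1)]
      by (auto simp: bilinear_ladd[OF bil] bilinear_lmul[OF bil] c_def field_simps)
    ultimately show ?case by blast
  qed
qed

text \<open>Multiplying \<open>Z\<close> by the function of a global frame turns it into a combination of the frame fields, so
  a function-linear \<open>K\<close> is known near a point once it is known on these; there the equations can be solved
  smoothly. The local solutions fit together, because enough global fields exist to make them unique.
  This is what turns the Koszul formula into a connection.\<close>

lemma riesz:
  assumes g: "riemannian_metric A g"
    and K: "\<And>Z. Z \<in> vector_fields A \<Longrightarrow> K Z \<in> smooth_funs A"
    and K_add: "\<And>Z Z' p. Z \<in> vector_fields A \<Longrightarrow> Z' \<in> vector_fields A \<Longrightarrow> K (\<lambda>q. Z q + Z' q) p = K Z p + K Z' p"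
    and K_scale: "\<And>f Z p. f \<in> smooth_funs A \<Longrightarrow> Z \<in> vector_fields A \<Longrightarrow> K (\<lambda>q. f q *\<^sub>R Z q) p = f p * K Z p"
  shows "\<exists>W\<in>vector_fields A. \<forall>Z\<in>vector_fields A. \<forall>p. g p (W p) (Z p) = K Z p"
proof -
  have bil: "bilinear (g q)" and pos: "v \<noteq> 0 \<Longrightarrow> g q v v > 0" for q v
    using g unfolding riemannian_metric_def by auto
  define R where "R = (\<lambda>q w. \<forall>Z\<in>vector_fields A. g q w (Z q) = K Z q)"
  have unique: "w = w'" if "R q w" "R q w'" for q w w'
  proof -
    obtain Z where "Z \<in> vector_fields A" "Z q = w - w'" using ex_vector_field by blast
    then have "g q (w - w') (w - w') = 0" using that unfolding R_def by (metis bil bilinear_lsub diff_self)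
    then show ?thesis using pos[of "w - w'" q] by force
  qed
  have K0: "K (\<lambda>q. 0) p = 0" for p
    using K_scale[OF smooth_funs_const[of 0] vector_fields_zero, of p] by simp
  have K_sum: "K (\<lambda>q. \<Sum>i\<in>I. X i q) p = (\<Sum>i\<in>I. K (X i) p)"
    if "finite I" "\<And>i. i \<in> I \<Longrightarrow> X i \<in> vector_fields A" for I p and X :: "'e \<Rightarrow> 'a \<Rightarrow> 'e"
    using that by (induction I) (auto simp: K0 K_add vector_fields_sum)
  have local: "\<exists>U W. open U \<and> p \<in> U \<and> smooth_field_on A U W \<and> (\<forall>q\<in>U. R q (W q))" for p
  proof -
    obtain \<beta> U L and E :: "'e \<Rightarrow> 'a \<Rightarrow> 'e" where \<beta>: "smooth_fun_on A UNIV \<beta>"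
      and E: "\<And>b. smooth_field_on A UNIV (E b)" and U: "open U" "p \<in> U" and nz: "\<And>q. q \<in> U \<Longrightarrow> \<beta> q \<noteq> 0"
      and L: "\<And>q. q \<in> U \<Longrightarrow> linear (L q)" "\<And>q. q \<in> U \<Longrightarrow> bij (L q)" "\<And>q b. q \<in> U \<Longrightarrow> E b q = L q b"
      and Z: "\<And>Z. smooth_field_on A UNIV Z \<Longrightarrow> \<exists>f. (\<forall>b. smooth_fun_on A UNIV (f b)) \<and>
        (\<forall>q. \<beta> q *\<^sub>R Z q = (\<Sum>b\<in>Basis. f b q *\<^sub>R E b q))"
      by (rule global_frame[of p], rule that, assumption+)
    have EV: "E b \<in> vector_fields A" for b using E by (simp add: vector_fields_def)
    have "\<exists>W. smooth_field_on A U W \<and> (\<forall>q\<in>U. W q \<in> span ((\<lambda>b. E b q) ` Basis) \<and>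
        (\<forall>b\<in>Basis. g q (W q) (E b q) = K (E b) q))"
      using L bij_is_inj[OF L(2)] K[OF EV] smooth_fun_on_subset[of UNIV _ U] smooth_field_on_subset[OF E, of U]
      by (intro local_riesz[OF g U(1), where L = L]) (auto simp: smooth_funs_def)
    then obtain W where W: "smooth_field_on A U W" "\<And>q b. q \<in> U \<Longrightarrow> b \<in> Basis \<Longrightarrow> g q (W q) (E b q) = K (E b) q"
      by blast
    have "g q (W q) (Y q) = K Y q" if q: "q \<in> U" and Y: "Y \<in> vector_fields A" for q Y
    proof -
      obtain f where f: "\<And>b. f b \<in> smooth_funs A" "\<And>q. \<beta> q *\<^sub>R Y q = (\<Sum>b\<in>Basis. f b q *\<^sub>R E b q)"
        using Z[of Y] Y unfolding vector_fields_def smooth_funs_def by blast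
      have "\<beta> q * K Y q = K (\<lambda>q. \<beta> q *\<^sub>R Y q) q"
        using \<beta> Y by (simp add: K_scale smooth_funs_def)
      also have "\<dots> = (\<Sum>b\<in>Basis. f b q * K (E b) q)"
        unfolding f(2) using f EV by (subst K_sum) (auto intro: vector_fields_scaleR simp: K_scale)
      also have "\<dots> = (\<Sum>b\<in>Basis. f b q * g q (W q) (E b q))"
        using W(2)[OF q] by simp
      also have "\<dots> = g q (W q) (\<beta> q *\<^sub>R Y q)"
        unfolding f(2) using bil[of q] unfolding bilinear_def by (simp add: linear_sum linear_cmul)
      also have "\<dots> = \<beta> q * g q (W q) (Y q)" by (simp add: bilinear_rmul[OF bil])
      finally show ?thesis using nz[OF q] by simp
    qed
    then show ?thesis using U W(1) unfolding R_def by blast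
  qed
  then have "\<exists>w. R p w" for p by blast
  then obtain W where W: "R p (W p)" for p by metis
  have "smooth_field_on A UNIV W"
  proof (rule smooth_field_on_local)
    fix p
    obtain U V where UV: "open U" "p \<in> U" "smooth_field_on A U V" "\<And>q. q \<in> U \<Longrightarrow> R q (V q)"
      using local[of p] by blast
    then have "smooth_field_on A U W"
      using unique W by (intro smooth_field_on_cong[OF UV(1,3)]) blast
    then show "\<exists>V. open V \<and> p \<in> V \<and> smooth_field_on A V W" using UV by blast
  qed
  then show ?thesis using W unfolding R_def vector_fields_def by blast
qed

lemma field_deriv_funs:
  assumes "f \<in> smooth_funs A" "h \<in> smooth_funs A"
  shows "field_deriv A X (\<lambda>q. f q + h q) p = field_deriv A X f p + field_deriv A X h p"
    and "field_deriv A X (\<lambda>q. f q - h q) p = field_deriv A X f p - field_deriv A X h p"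
    and "field_deriv A X (\<lambda>q. f q * h q) p = f p * field_deriv A X h p + field_deriv A X f p * h p"
  using assms by (auto simp: smooth_funs_def field_deriv_add[of UNIV] field_deriv_diff[of UNIV] field_deriv_mult[of UNIV])

lemma field_deriv_fields:
  assumes "f \<in> smooth_funs A"
  shows "field_deriv A (\<lambda>q. X q + Y q) f p = field_deriv A X f p + field_deriv A Y f p"
    and "field_deriv A (\<lambda>q. h q *\<^sub>R X q) f p = h p * field_deriv A X f p"
  using assms by (auto simp: smooth_funs_def field_deriv_add_field[of UNIV] field_deriv_scaleR_field[of UNIV])

lemma field_deriv_sum:
  "(\<And>i. i \<in> I \<Longrightarrow> f i \<in> smooth_funs A) \<Longrightarrow>
    field_deriv A X (\<lambda>q. \<Sum>i\<in>I. f i q) p = (\<Sum>i\<in>I. field_deriv A X (f i) p)"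
  by (induction I rule: infinite_finite_induct) (auto simp: field_deriv_funs(1) smooth_funs_sum)

lemma field_deriv_commutator:
  "X \<in> vector_fields A \<Longrightarrow> Y \<in> vector_fields A \<Longrightarrow> f \<in> smooth_funs A \<Longrightarrow>
    field_deriv A (lie_bracket A X Y) f p =
      field_deriv A X (field_deriv A Y f) p - field_deriv A Y (field_deriv A X f) p"
  using field_deriv_lie_bracket[of UNIV] by (simp add: smooth_funs_def vector_fields_def)

lemma lie_bracket_add_right:
  "X \<in> vector_fields A \<Longrightarrow> X' \<in> vector_fields A \<Longrightarrow> Y \<in> vector_fields A \<Longrightarrow>
    lie_bracket A Y (\<lambda>q. X q + X' q) p = lie_bracket A Y X p + lie_bracket A Y X' p"
  using lie_bracket_add_left[of X X' Y p] lie_bracket_skew[of Y X p] lie_bracket_skew[of Y X' p]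
    lie_bracket_skew[of Y "\<lambda>q. X q + X' q" p] by simp

lemma lie_bracket_scaleR_right:
  "h \<in> smooth_funs A \<Longrightarrow> X \<in> vector_fields A \<Longrightarrow> Y \<in> vector_fields A \<Longrightarrow>
    lie_bracket A Y (\<lambda>q. h q *\<^sub>R X q) p = h p *\<^sub>R lie_bracket A Y X p + field_deriv A Y h p *\<^sub>R X p"
  using lie_bracket_scaleR_left[of h X Y p] lie_bracket_skew[of Y X p]
    lie_bracket_skew[of Y "\<lambda>q. h q *\<^sub>R X q" p] by simp

lemma lie_bracket_zero:
  assumes "Y \<in> vector_fields A"
  shows "lie_bracket A (\<lambda>q. 0) Y p = 0" "lie_bracket A Y (\<lambda>q. 0) p = 0"
  using lie_bracket_scaleR_left[OF smooth_funs_const[of 0] vector_fields_zero assms, of p]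
    lie_bracket_scaleR_right[OF smooth_funs_const[of 0] vector_fields_zero assms, of p] by auto

end

section \<open>Pointwise algebra of a contact metric f-structure\<close>

locale contact_metric_f =
  fixes A :: "('a::{t2_space,second_countable_topology}, 'e::euclidean_space) chart set"
    and n s :: nat
    and \<phi> :: "'a \<Rightarrow> 'e \<Rightarrow> 'e"
    and \<xi> :: "nat \<Rightarrow> 'a \<Rightarrow> 'e"
    and \<eta> :: "nat \<Rightarrow> 'a \<Rightarrow> 'e \<Rightarrow> real"
    and g :: "'a \<Rightarrow> 'e \<Rightarrow> 'e \<Rightarrow> real"
  assumes s: "s \<ge> 1" and contact: "contact_metric_f_manifold A n s \<phi> \<xi> \<eta> g"
begin

lemma metric_f: "metric_f_manifold A n s \<phi> \<xi> \<eta> g"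
  using contact unfolding contact_metric_f_manifold_def by blast

lemma atlas: "atlas A"
  using metric_f unfolding metric_f_manifold_def smooth_manifold_def atlas_def by blast

end

sublocale contact_metric_f \<subseteq> atlas A by (rule atlas)

context contact_metric_f
begin

lemma g_riemannian: "riemannian_metric A g"
  using metric_f unfolding metric_f_manifold_def by blast

lemma g_bilinear: "bilinear (g p)" and g_sym: "g p u v = g p v u" and g_pos: "v \<noteq> 0 \<Longrightarrow> g p v v > 0"
  using g_riemannian unfolding riemannian_metric_def by auto

lemmas g_simps [simp] =
  bilinear_ladd[OF g_bilinear] bilinear_radd[OF g_bilinear] bilinear_lsub[OF g_bilinear]
  bilinear_rsub[OF g_bilinear] bilinear_lneg[OF g_bilinear] bilinear_rneg[OF g_bilinear]
  bilinear_lmul[OF g_bilinear] bilinear_rmul[OF g_bilinear] bilinear_lzero[OF g_bilinear]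
  bilinear_rzero[OF g_bilinear]

lemma g_sum [simp]:
  "g p (\<Sum>i\<in>I. f i) v = (\<Sum>i\<in>I. g p (f i) v)" "g p v (\<Sum>i\<in>I. f i) = (\<Sum>i\<in>I. g p v (f i))"
  using g_bilinear[of p] linear_sum[of "\<lambda>x. g p x v"] linear_sum[of "g p v"]
  unfolding bilinear_def by blast+

lemma phi_linear: "linear (\<phi> p)"
  using metric_f unfolding metric_f_manifold_def endo_field_def by blast

lemmas phi_simps [simp] =
  linear_add[OF phi_linear] linear_diff[OF phi_linear] linear_neg[OF phi_linear]
  linear_cmul[OF phi_linear] linear_0[OF phi_linear]

lemma eta_linear: "i \<in> {1..s} \<Longrightarrow> linear (\<eta> i p)"
  using metric_f unfolding metric_f_manifold_def one_form_def by blast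

lemma phi_phi: "\<phi> p (\<phi> p v) = - v + (\<Sum>i\<in>{1..s}. \<eta> i p v *\<^sub>R \<xi> i p)"
  using metric_f unfolding metric_f_manifold_def by blast

lemma eta_xi: "i \<in> {1..s} \<Longrightarrow> j \<in> {1..s} \<Longrightarrow> \<eta> i p (\<xi> j p) = (if i = j then 1 else 0)"
  using metric_f unfolding metric_f_manifold_def by blast

lemma eta_phi [simp]: "i \<in> {1..s} \<Longrightarrow> \<eta> i p (\<phi> p v) = 0"
  using metric_f unfolding metric_f_manifold_def by blast

lemma phi_xi [simp]: "i \<in> {1..s} \<Longrightarrow> \<phi> p (\<xi> i p) = 0"
proof -
  assume "i \<in> {1..s}"
  then have "\<xi> i p \<in> span ((\<lambda>i. \<xi> i p) ` {1..s})" by (simp add: span_base)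
  moreover have "{v. \<phi> p v = 0} = span ((\<lambda>i. \<xi> i p) ` {1..s})"
    using metric_f unfolding metric_f_manifold_def by blast
  ultimately show ?thesis by blast
qed

lemma g_phi_phi: "g p (\<phi> p u) (\<phi> p v) = g p u v - (\<Sum>i\<in>{1..s}. \<eta> i p u * \<eta> i p v)"
  using metric_f unfolding metric_f_manifold_def by blast

text \<open>The compatibility of \<open>g\<close> with \<open>\<phi>\<close>, evaluated on \<open>\<xi>\<^sub>i\<close>, which \<open>\<phi>\<close> annihilates.\<close>

lemma g_xi:
  assumes i: "i \<in> {1..s}"
  shows "g p v (\<xi> i p) = \<eta> i p v" "g p (\<xi> i p) v = \<eta> i p v"
proof -
  have "(\<Sum>j\<in>{1..s}. \<eta> j p v * \<eta> j p (\<xi> i p)) = (\<Sum>j\<in>{1..s}. if j = i then \<eta> i p v else 0)"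
    using i by (intro sum.cong) (auto simp: eta_xi)
  then show "g p v (\<xi> i p) = \<eta> i p v"
    using g_phi_phi[of p v "\<xi> i p"] i by simp
  then show "g p (\<xi> i p) v = \<eta> i p v" by (simp add: g_sym)
qed

lemma g_phi_skew: "g p (\<phi> p u) v = - g p u (\<phi> p v)"
proof -
  have "g p (\<phi> p u) (\<phi> p (\<phi> p v)) = g p u (\<phi> p v)"
    by (simp add: g_phi_phi)
  moreover have "g p (\<phi> p u) (\<phi> p (\<phi> p v)) = - g p (\<phi> p u) v"
    by (simp add: phi_phi[of p v] g_xi)
  ultimately show ?thesis by simp
qed

lemma g_phi_alt: "g p u (\<phi> p v) = - g p v (\<phi> p u)"
  using g_phi_skew g_sym by metis

text \<open>The image of \<open>\<phi>\<close> and the vectors \<open>\<xi>\<^sub>i\<close> together span the tangent space, by the formula for \<open>\<phi>\<^sup>2\<close>. The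
  equations \<open>\<nabla>\<xi>\<^sub>i = 0\<close> and \<open>\<nabla>\<phi> = 0\<close> are tested on these two kinds of vectors separately.\<close>

lemma vector_zeroI:
  assumes "\<And>u. g p w (\<phi> p u) = 0" "\<And>i. i \<in> {1..s} \<Longrightarrow> g p w (\<xi> i p) = 0"
  shows "w = 0"
proof (rule ccontr)
  assume "w \<noteq> 0"
  moreover have "g p w w = 0"
    using assms(1)[of "\<phi> p w"] assms(2) by (simp add: phi_phi)
  ultimately show False using g_pos[of w p] by simp
qed

lemma g_eqI:
  assumes "\<And>Z. Z \<in> vector_fields A \<Longrightarrow> g p v (Z p) = g p w (Z p)"
  shows "v = w"
proof -
  obtain Z where "Z \<in> vector_fields A" "Z p = v - w" using ex_vector_field by blast
  then have "g p (v - w) (v - w) = 0" using assms[of Z] by simp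
  then show ?thesis using g_pos[of "v - w" p] by force
qed

abbreviation bar :: "'a \<Rightarrow> 'e \<Rightarrow> real" where "bar \<equiv> eta_bar s \<eta>"

lemma bar_linear: "linear (bar p)"
  unfolding eta_bar_def[abs_def] by (intro linear_compose_sum) (auto intro: eta_linear)

lemmas bar_simps [simp] =
  linear_add[OF bar_linear] linear_diff[OF bar_linear] linear_neg[OF bar_linear]
  linear_cmul[OF bar_linear] linear_0[OF bar_linear]

lemma bar_phi [simp]: "bar p (\<phi> p v) = 0"
  by (simp add: eta_bar_def)

lemma bar_xi [simp]: "i \<in> {1..s} \<Longrightarrow> bar p (\<xi> i p) = 1"
proof -
  assume i: "i \<in> {1..s}"
  then have "(\<Sum>j\<in>{1..s}. \<eta> j p (\<xi> i p)) = (\<Sum>j\<in>{1..s}. if j = i then 1 else 0)"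
    by (intro sum.cong) (auto simp: eta_xi)
  then show ?thesis using i by (simp add: eta_bar_def)
qed

text \<open>The 3-form \<open>2 \<eta>bar \<and> F\<close> on a tangent space.\<close>

definition tor :: "'a \<Rightarrow> 'e \<Rightarrow> 'e \<Rightarrow> 'e \<Rightarrow> real" where
  "tor p u v w = 2 * (bar p u * g p v (\<phi> p w) - bar p v * g p u (\<phi> p w) + bar p w * g p u (\<phi> p v))"

lemma g_phi_phi_phi: "g p (\<phi> p u) (\<phi> p (\<phi> p v)) = g p u (\<phi> p v)"
  by (simp add: g_phi_phi)

lemma tor_skew: "tor p v u w = - tor p u v w" "tor p u w v = - tor p u v w"
  using g_phi_alt[of p u v] g_phi_alt[of p v w] by (auto simp: tor_def algebra_simps)

lemma tor_xi: "i \<in> {1..s} \<Longrightarrow> tor p u v (\<xi> i p) = 2 * g p u (\<phi> p v)"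
  by (simp add: tor_def)

text \<open>Expanding leaves a cyclic sum of terms \<open>\<eta>bar(u) g(v, \<phi>\<phi> w)\<close> antisymmetrised in \<open>v, w\<close>, and
  \<open>\<phi>\<phi>\<close> is symmetric for \<open>g\<close>. The left-hand side is the contribution of the torsion to \<open>dF\<close>.\<close>

lemma tor_cyclic: "tor p u v (\<phi> p w) + tor p v w (\<phi> p u) + tor p w u (\<phi> p v) = 0"
  using g_sym[of p v "\<phi> p (\<phi> p w)"] g_sym[of p u "\<phi> p (\<phi> p w)"] g_sym[of p u "\<phi> p (\<phi> p v)"]
    g_phi_skew[of p "\<phi> p w" v] g_phi_skew[of p "\<phi> p w" u] g_phi_skew[of p "\<phi> p v" u]
    g_phi_skew[of p w "\<phi> p v"] g_phi_skew[of p w "\<phi> p u"] g_phi_skew[of p v "\<phi> p u"]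
  by (simp add: tor_def algebra_simps)

text \<open>On each side every term has a factor \<open>\<eta>bar\<close>, which vanishes on the image of \<open>\<phi>\<close>, and \<open>F(\<phi>u, \<phi>v) = F(u, v)\<close>; so the three
  summands on the left reproduce the three terms of \<open>tor\<close>. The difference of the two sides is the contribution of the torsion
  to the normality tensor.\<close>

lemma tor_type: "tor p (\<phi> p u) (\<phi> p v) w + tor p u (\<phi> p v) (\<phi> p w) + tor p (\<phi> p u) v (\<phi> p w) = tor p u v w"
  by (simp add: tor_def g_phi_phi_phi algebra_simps)

text \<open>By the condition on the \<open>\<xi>\<^sub>i\<close>, two 3-forms that satisfy the hypotheses differ only in their values on
  horizontal vectors, those with \<open>\<phi>\<phi> u = - u\<close>. There the values of \<open>t\<close> are zero: the cyclic condition implies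
  that \<open>t(\<phi>u, \<phi>v, w) = t(u, v, w) / 2\<close>, and applying this twice gives \<open>t = t / 4\<close>.\<close>

lemma three_form_eq_tor:
  fixes t :: "'e \<Rightarrow> 'e \<Rightarrow> 'e \<Rightarrow> real"
  assumes lin: "\<And>u v. linear (t u v)"
    and skew1: "\<And>u v w. t v u w = - t u v w" and skew2: "\<And>u v w. t u w v = - t u v w"
    and xi: "\<And>u v i. i \<in> {1..s} \<Longrightarrow> t u v (\<xi> i p) = 2 * g p u (\<phi> p v)"
    and cyc: "\<And>u v w. t u v (\<phi> p w) + t v w (\<phi> p u) + t w u (\<phi> p v) = 0"
  shows "t u v w = tor p u v w"
proof -
  have rot: "t u v w = t v w u" for u v w
    using skew1[of u v w] skew2[of v u w] by simp
  have neg: "t u v (- w) = - t u v w" for u v w using lin by (simp add: linear_neg)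
  \<comment> \<open>the horizontal part of a vector\<close>
  define h where "h = (\<lambda>x. - \<phi> p (\<phi> p x))"
  have split: "t u v w = t u v (h w) + 2 * bar p w * g p u (\<phi> p v)" for u v w
  proof -
    have "w = h w + (\<Sum>i\<in>{1..s}. \<eta> i p w *\<^sub>R \<xi> i p)" by (simp add: h_def phi_phi)
    then have "t u v w = t u v (h w + (\<Sum>i\<in>{1..s}. \<eta> i p w *\<^sub>R \<xi> i p))" by simp
    also have "\<dots> = t u v (h w) + (\<Sum>i\<in>{1..s}. \<eta> i p w * (2 * g p u (\<phi> p v)))"
      using lin[of u v] by (simp add: linear_add linear_sum linear_cmul xi)
    finally show ?thesis by (simp add: eta_bar_def sum_distrib_right sum_distrib_left mult_ac)
  qed
  have gh: "g p (h u) (\<phi> p v) = g p u (\<phi> p v)" for u v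
    by (simp add: h_def g_phi_skew[of p "\<phi> p u"] g_phi_phi_phi)
  have zero: "t u v w = 0" if "\<phi> p (\<phi> p u) = - u" "\<phi> p (\<phi> p v) = - v" "\<phi> p (\<phi> p w) = - w" for u v w
  proof -
    have step: "t u v w = t (\<phi> p u) v (\<phi> p w) + t u (\<phi> p v) (\<phi> p w)"
      if "\<phi> p (\<phi> p w) = - w" for u v w
      using cyc[of u v "\<phi> p w"] rot[of "\<phi> p u" v "\<phi> p w"] rot[of "\<phi> p w" u "\<phi> p v"] neg[of u v w]
      unfolding that by linarith
    \<comment> \<open>of the three terms with two \<open>\<phi>\<close>, any two add up to \<open>t u v w\<close>, so all three are equal\<close>
    have half: "t (\<phi> p u) (\<phi> p v) w = t u v w / 2"
      if "\<phi> p (\<phi> p u) = - u" "\<phi> p (\<phi> p v) = - v" "\<phi> p (\<phi> p w) = - w" for u v w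
      using step[of w u v] step[of u v w] step[of v w u] that
        rot[of u v w] rot[of v w u] rot[of "\<phi> p u" v "\<phi> p w"] rot[of v "\<phi> p w" "\<phi> p u"]
        rot[of u "\<phi> p v" "\<phi> p w"] rot[of "\<phi> p v" "\<phi> p w" u] rot[of "\<phi> p u" "\<phi> p v" w]
        rot[of "\<phi> p v" w "\<phi> p u"] by linarith
    have "t (- u) (- v) w = t u v w"
      using rot[of "- u" "- v" w] neg[of "- v" w u] rot[of u "- v" w] rot[of w u "- v"] neg[of w u v] rot[of v w u] rot[of u v w] rot[of "-v" w u]
      by linarith
    then show ?thesis
      using half[OF that] half[of "\<phi> p u" "\<phi> p v" w] that by simp
  qed
  have hh: "\<phi> p (\<phi> p (h x)) = - h x" for x
    unfolding h_def using phi_phi[of p "\<phi> p (\<phi> p x)"] by simp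
  have "t u v w = t u v (h w) + 2 * bar p w * g p u (\<phi> p v)" by (rule split)
  also have "t u v (h w) = t (h w) u (h v) + 2 * bar p v * g p w (\<phi> p u)"
    using split[of "h w" u v] by (simp add: gh rot)
  also have "t (h w) u (h v) = t (h v) (h w) (h u) + 2 * bar p u * g p v (\<phi> p w)"
    using split[of "h v" "h w" u] gh[of v "h w"] g_phi_alt[of p v "h w"] g_phi_alt[of p v w] gh[of w v]
      rot[of "h v" "h w" u] by simp
  also have "t (h v) (h w) (h u) = 0" by (rule zero) (rule hh)+
  finally show ?thesis using g_phi_alt[of p w u] by (simp add: tor_def algebra_simps)
qed

section \<open>The fundamental form is closed\<close>

lemma vf_phi: "X \<in> vector_fields A \<Longrightarrow> endo_apply \<phi> X \<in> vector_fields A"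
proof -
  have "endo_field A \<phi>" using metric_f unfolding metric_f_manifold_def by blast
  then show "X \<in> vector_fields A \<Longrightarrow> endo_apply \<phi> X \<in> vector_fields A"
    by (simp add: endo_field_def vector_fields_def)
qed

lemma vf_xi: "i \<in> {1..s} \<Longrightarrow> \<xi> i \<in> vector_fields A"
  using metric_f unfolding metric_f_manifold_def by blast

lemma sf_eta: "i \<in> {1..s} \<Longrightarrow> X \<in> vector_fields A \<Longrightarrow> form_apply (\<eta> i) X \<in> smooth_funs A"
proof -
  assume "i \<in> {1..s}"
  then have "one_form A (\<eta> i)" using metric_f unfolding metric_f_manifold_def by blast
  then show "X \<in> vector_fields A \<Longrightarrow> form_apply (\<eta> i) X \<in> smooth_funs A"
    by (simp add: one_form_def vector_fields_def smooth_funs_def)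
qed

lemma sf_g: "X \<in> vector_fields A \<Longrightarrow> Y \<in> vector_fields A \<Longrightarrow> metric_apply g X Y \<in> smooth_funs A"
  using g_riemannian by (simp add: riemannian_metric_def vector_fields_def smooth_funs_def)

lemma sf_F: "X \<in> vector_fields A \<Longrightarrow> Y \<in> vector_fields A \<Longrightarrow> fundamental_form \<phi> g X Y \<in> smooth_funs A"
  unfolding fundamental_form_def by (intro sf_g vf_phi)

lemma sf_bar: "X \<in> vector_fields A \<Longrightarrow> form_apply bar X \<in> smooth_funs A"
  using smooth_funs_sum[of "{1..s}" "\<lambda>i. form_apply (\<eta> i) X"] sf_eta
  by (simp add: form_apply_def[abs_def] eta_bar_def)

lemmas closure_rules = vf_phi vf_xi sf_eta sf_g sf_F sf_bar vector_fields_lie_bracket smooth_funs_field_deriv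
  vector_fields_add vector_fields_scaleR smooth_funs_add smooth_funs_diff smooth_funs_mult smooth_funs_const

lemmas apply_defs = endo_apply_def form_apply_def metric_apply_def

lemma ext_deriv_eta:
  "i \<in> {1..s} \<Longrightarrow> X \<in> vector_fields A \<Longrightarrow> Y \<in> vector_fields A \<Longrightarrow>
    ext_deriv A (\<eta> i) X Y p = 2 * g p (X p) (\<phi> p (Y p))"
  using contact unfolding contact_metric_f_manifold_def
  by (auto simp: fundamental_form_def apply_defs)

lemma eta_lie_bracket:
  "i \<in> {1..s} \<Longrightarrow> X \<in> vector_fields A \<Longrightarrow> Y \<in> vector_fields A \<Longrightarrow>
    \<eta> i p (lie_bracket A X Y p) =
      field_deriv A X (form_apply (\<eta> i) Y) p - field_deriv A Y (form_apply (\<eta> i) X) p - 2 * g p (X p) (\<phi> p (Y p))"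
  using ext_deriv_eta[of i X Y p] by (simp add: ext_deriv_def form_apply_def)

text \<open>This is \<open>d(d\<eta>\<^sub>i) = 0\<close> for some \<open>i\<close>, which exists as \<open>s \<ge> 1\<close>: writing \<open>2F\<close> as \<open>d\<eta>\<^sub>i\<close>, the
  second derivatives cancel and the rest is \<open>\<eta>\<^sub>i\<close> of the Jacobi identity.\<close>

lemma fundamental_form_closed:
  assumes X: "X \<in> vector_fields A" and Y: "Y \<in> vector_fields A" and Z: "Z \<in> vector_fields A"
  shows "field_deriv A X (fundamental_form \<phi> g Y Z) p + field_deriv A Y (fundamental_form \<phi> g Z X) p
    + field_deriv A Z (fundamental_form \<phi> g X Y) p
    = g p (lie_bracket A X Y p) (\<phi> p (Z p)) + g p (lie_bracket A Y Z p) (\<phi> p (X p))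
    + g p (lie_bracket A Z X p) (\<phi> p (Y p))"
proof -
  obtain i where i: "i \<in> {1..s}" using s by force
  let ?e = "form_apply (\<eta> i)" and ?D = "field_deriv A" and ?b = "lie_bracket A"
  have D: "2 * ?D U (fundamental_form \<phi> g V W) p = ?D U (?D V (?e W)) p - ?D U (?D W (?e V)) p - ?D U (?e (?b V W)) p"
    if "U \<in> vector_fields A" "V \<in> vector_fields A" "W \<in> vector_fields A" for U V W
  proof -
    have "(\<lambda>q. 2 * fundamental_form \<phi> g V W q) = (\<lambda>q. ?D V (?e W) q - ?D W (?e V) q - ?e (?b V W) q)"
      using eta_lie_bracket[OF i that(2,3)] by (auto simp: fundamental_form_def apply_defs)
    moreover have "?D U (\<lambda>q. 2 * fundamental_form \<phi> g V W q) p = 2 * ?D U (fundamental_form \<phi> g V W) p"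
      using field_deriv_funs(3)[OF smooth_funs_const[of 2] sf_F[OF that(2,3)], of U p] by simp
    ultimately show ?thesis
      using that i by (simp add: field_deriv_funs closure_rules)
  qed
  have B: "2 * g p (?b U V p) (\<phi> p (W p)) = ?D U (?D V (?e W)) p - ?D V (?D U (?e W)) p
      - ?D W (?e (?b U V)) p + \<eta> i p (?b W (?b U V) p)"
    if "U \<in> vector_fields A" "V \<in> vector_fields A" "W \<in> vector_fields A" for U V W
    using eta_lie_bracket[OF i vector_fields_lie_bracket[OF that(1,2)] that(3), of p] that
      lie_bracket_skew[of "?b U V" W p] field_deriv_commutator[OF that(1,2) sf_eta[OF i that(3)], of p]
    by (simp add: linear_neg[OF eta_linear[OF i]])
  have "\<eta> i p (?b X (?b Y Z) p) + \<eta> i p (?b Y (?b Z X) p) + \<eta> i p (?b Z (?b X Y) p) = 0"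
    using jacobi[OF X Y Z, of p] linear_0[OF eta_linear[OF i]]
    by (simp add: linear_add[OF eta_linear[OF i], symmetric])
  then show ?thesis
    using D[OF X Y Z] D[OF Y Z X] D[OF Z X Y] B[OF X Y Z] B[OF Y Z X] B[OF Z X Y] by linarith
qed

section \<open>Metric connections and their torsion\<close>

lemma lie_bracket_torsion: "lie_bracket A X Y p = D X Y p - D Y X p - torsion A D X Y p"
  by (simp add: torsion_def)

lemma torsion3_eq: "torsion3 A g D X Y Z p = g p (torsion A D X Y p) (Z p)"
  by (simp add: torsion3_def metric_apply_def)

text \<open>The equation \<open>dF = 0\<close> in terms of a metric connection: brackets are replaced by covariant derivatives
  and torsion, and the covariant derivatives of the fields cancel.\<close>

lemma metric_connection_closed:
  assumes metric: "\<And>X Y Z p. X \<in> vector_fields A \<Longrightarrow> Y \<in> vector_fields A \<Longrightarrow> Z \<in> vector_fields A \<Longrightarrow>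
      cov_metric A D g X Y Z p = 0"
    and X: "X \<in> vector_fields A" and Y: "Y \<in> vector_fields A" and Z: "Z \<in> vector_fields A"
  shows "g p (cov_endo D \<phi> X Z p) (Y p) + g p (cov_endo D \<phi> Y X p) (Z p) + g p (cov_endo D \<phi> Z Y p) (X p)
    + torsion3 A g D X Y (endo_apply \<phi> Z) p + torsion3 A g D Y Z (endo_apply \<phi> X) p
    + torsion3 A g D Z X (endo_apply \<phi> Y) p = 0"
proof -
  have D: "field_deriv A U (fundamental_form \<phi> g V W) p =
      g p (D U V p) (\<phi> p (W p)) - g p (D U W p) (\<phi> p (V p)) + g p (cov_endo D \<phi> U W p) (V p)"
    if "U \<in> vector_fields A" "V \<in> vector_fields A" "W \<in> vector_fields A" for U V W
    using metric[OF that(1,2) vf_phi[OF that(3)], of p] g_sym[of p "V p"] g_phi_skew[of p "D U W p" "V p"]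
    by (simp add: cov_metric_def fundamental_form_def cov_endo_def apply_defs)
  show ?thesis
    using fundamental_form_closed[OF X Y Z, of p] D[OF X Y Z] D[OF Y Z X] D[OF Z X Y]
    unfolding lie_bracket_torsion[of _ _ _ D] torsion3_eq
    by (simp add: apply_defs)
qed

text \<open>Once every bracket is replaced by covariant derivatives and torsion, the covariant
  derivatives of the fields combine into the covariant derivative of \<open>\<phi>\<close>.\<close>

lemma nijenhuis_connection:
  "nijenhuis A \<phi> X Y p =
    cov_endo D \<phi> (endo_apply \<phi> X) Y p - cov_endo D \<phi> (endo_apply \<phi> Y) X p
    - \<phi> p (cov_endo D \<phi> X Y p) + \<phi> p (cov_endo D \<phi> Y X p)
    - torsion A D (endo_apply \<phi> X) (endo_apply \<phi> Y) p - \<phi> p (\<phi> p (torsion A D X Y p))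
    + \<phi> p (torsion A D X (endo_apply \<phi> Y) p) + \<phi> p (torsion A D (endo_apply \<phi> X) Y p)"
  unfolding nijenhuis_def lie_bracket_torsion[of _ _ _ D] cov_endo_def endo_apply_def
  by (simp add: algebra_simps lie_bracket_torsion[of _ _ _ D])

text \<open>If the torsion is \<open>tor\<close>, its contribution cancels by \<open>tor_type\<close>; the terms \<open>d\<eta>\<^sub>i \<otimes> \<xi>\<^sub>i\<close> compensate the
  vertical part that \<open>\<phi>\<phi>\<close> removes from the torsion.\<close>

lemma normality_connection:
  assumes tor: "\<And>X Y Z p. X \<in> vector_fields A \<Longrightarrow> Y \<in> vector_fields A \<Longrightarrow> Z \<in> vector_fields A \<Longrightarrow>
      torsion3 A g D X Y Z p = tor p (X p) (Y p) (Z p)"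
    and X: "X \<in> vector_fields A" and Y: "Y \<in> vector_fields A" and Z: "Z \<in> vector_fields A"
  shows "g p (normality_tensor A s \<phi> \<xi> \<eta> X Y p) (Z p) =
    g p (cov_endo D \<phi> (endo_apply \<phi> X) Y p) (Z p) - g p (cov_endo D \<phi> (endo_apply \<phi> Y) X p) (Z p)
    + g p (cov_endo D \<phi> X Y p) (\<phi> p (Z p)) - g p (cov_endo D \<phi> Y X p) (\<phi> p (Z p))"
proof -
  have T: "g p (torsion A D U V p) (W p) = tor p (U p) (V p) (W p)"
    if "U \<in> vector_fields A" "V \<in> vector_fields A" "W \<in> vector_fields A" for U V W
    using tor[OF that, of p] by (simp add: torsion3_eq)
  have "g p (\<phi> p (\<phi> p (torsion A D X Y p))) (Z p) =
      - tor p (X p) (Y p) (Z p) + (\<Sum>i\<in>{1..s}. 2 * g p (X p) (\<phi> p (Y p)) * \<eta> i p (Z p))"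
    using T[OF X Y vf_xi] by (simp add: phi_phi T[OF X Y Z] g_xi tor_xi)
  moreover have "g p (\<Sum>i\<in>{1..s}. ext_deriv A (\<eta> i) X Y p *\<^sub>R \<xi> i p) (Z p) =
      (\<Sum>i\<in>{1..s}. 2 * g p (X p) (\<phi> p (Y p)) * \<eta> i p (Z p))"
    by (simp add: ext_deriv_eta X Y g_xi)
  moreover have "g p (torsion A D X (endo_apply \<phi> Y) p) (\<phi> p (Z p)) = tor p (X p) (\<phi> p (Y p)) (\<phi> p (Z p))"
    "g p (torsion A D (endo_apply \<phi> X) Y p) (\<phi> p (Z p)) = tor p (\<phi> p (X p)) (Y p) (\<phi> p (Z p))"
    using T[OF X vf_phi[OF Y] vf_phi[OF Z]] T[OF vf_phi[OF X] Y vf_phi[OF Z]] by (simp_all add: endo_apply_def)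
  moreover have "g p (torsion A D (endo_apply \<phi> X) (endo_apply \<phi> Y) p) (Z p) = tor p (\<phi> p (X p)) (\<phi> p (Y p)) (Z p)"
    using T[OF vf_phi[OF X] vf_phi[OF Y] Z] by (simp add: endo_apply_def)
  ultimately show ?thesis
    using tor_type[of p "X p" "Y p" "Z p"]
    unfolding normality_tensor_def nijenhuis_connection[of X Y p D]
    by (simp add: g_phi_skew[of p _ "Z p"])
qed

text \<open>Otherwise simplification rewrites \<open>i \<in> {1..s}\<close> into inequalities, which the premises of the facts above
  do not match.\<close>

declare One_nat_def [simp del] atLeastAtMost_iff [simp del]

text \<open>The torsion is given on vector fields. It visibly depends on its last argument only through the value
  at \<open>p\<close>, and skew-symmetry extends this to the other arguments; so it comes from a 3-form \<open>t\<close> on the tangent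
  space, which satisfies the hypotheses of \<open>three_form_eq_tor\<close>.\<close>

lemma torsion_determined:
  assumes D: "almost_metric_phi_connection A s \<phi> \<xi> \<eta> g D" and skew: "has_skew_torsion A g D"
    and X: "X \<in> vector_fields A" and Y: "Y \<in> vector_fields A" and Z: "Z \<in> vector_fields A"
  shows "torsion3 A g D X Y Z p = tor p (X p) (Y p) (Z p)"
proof -
  have skew1: "torsion3 A g D V U W q = - torsion3 A g D U V W q"
    and skew2: "torsion3 A g D U W V q = - torsion3 A g D U V W q"
    if "U \<in> vector_fields A" "V \<in> vector_fields A" "W \<in> vector_fields A" for U V W q
    using skew that unfolding has_skew_torsion_def three_form_def by blast+
  have metric: "cov_metric A D g U V W q = 0" and endo: "cov_endo D \<phi> U V q = 0"
    and form: "i \<in> {1..s} \<Longrightarrow> cov_form A D (\<eta> i) U V q = 0"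
    if "U \<in> vector_fields A" "V \<in> vector_fields A" "W \<in> vector_fields A" for U V W q i
    using D that unfolding almost_metric_phi_connection_def by blast+
  have "\<exists>E. \<forall>v. E v \<in> vector_fields A \<and> E v p = v"
    using ex_vector_field by (intro choice) blast
  then obtain E where E: "\<And>v. E v \<in> vector_fields A" "\<And>v. E v p = v" by blast
  define t where "t = (\<lambda>u v w. torsion3 A g D (E u) (E v) (E w) p)"
  have last: "torsion3 A g D U V W p = torsion3 A g D U V W' p" if "W p = W' p" for U V W W'
    using that by (simp add: torsion3_eq)
  have t: "torsion3 A g D U V W p = t (U p) (V p) (W p)"
    if U: "U \<in> vector_fields A" and V: "V \<in> vector_fields A" and W: "W \<in> vector_fields A" for U V W
  proof -
    have "torsion3 A g D U V W p = torsion3 A g D U V (E (W p)) p"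
      by (rule last) (simp add: E)
    also have "\<dots> = - torsion3 A g D U (E (W p)) V p" using skew2[OF U V E(1)[of "W p"], of p] by linarith
    also have "\<dots> = - torsion3 A g D U (E (W p)) (E (V p)) p" by (subst last[of V "E (V p)"]) (simp_all add: E)
    also have "\<dots> = torsion3 A g D (E (W p)) U (E (V p)) p" using skew1[OF U E(1)[of "W p"] E(1)[of "V p"], of p] by linarith
    also have "\<dots> = - torsion3 A g D (E (W p)) (E (V p)) U p" using skew2[OF E(1)[of "W p"] E(1)[of "V p"] U, of p] by linarith
    also have "\<dots> = - torsion3 A g D (E (W p)) (E (V p)) (E (U p)) p" by (subst last[of U "E (U p)"]) (simp_all add: E)
    also have "\<dots> = torsion3 A g D (E (W p)) (E (U p)) (E (V p)) p" using skew2[OF E(1)[of "W p"] E(1)[of "U p"] E(1)[of "V p"], of p] by linarith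
    also have "\<dots> = - torsion3 A g D (E (U p)) (E (W p)) (E (V p)) p" using skew1[OF E(1)[of "U p"] E(1)[of "W p"] E(1)[of "V p"], of p] by linarith
    also have "\<dots> = t (U p) (V p) (W p)" unfolding t_def using skew2[OF E(1)[of "U p"] E(1)[of "V p"] E(1)[of "W p"], of p] by linarith
    finally show ?thesis .
  qed
  have "t u v w = tor p u v w" for u v w
  proof (rule three_form_eq_tor)
    show "linear (t u v)" for u v
      unfolding t_def torsion3_eq using g_bilinear[of p] by (simp add: E(2) bilinear_def)
    show "t v u w = - t u v w" "t u w v = - t u v w" for u v w
      unfolding t_def using skew1[OF E(1)[of u] E(1)[of v] E(1)[of w], of p] skew2[OF E(1)[of u] E(1)[of v] E(1)[of w], of p]
      by linarith+
    show "t u v (\<xi> i p) = 2 * g p u (\<phi> p v)" if i: "i \<in> {1..s}" for u v i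
    proof -
      have "t u v (\<xi> i p) = \<eta> i p (torsion A D (E u) (E v) p)"
        using t[OF E(1) E(1) vf_xi[OF i]] by (simp add: torsion3_eq g_xi i E)
      also have "\<dots> = ext_deriv A (\<eta> i) (E u) (E v) p"
        using form[OF E(1) E(1) E(1) i, of u v p] form[OF E(1) E(1) E(1) i, of v u p]
        by (simp add: torsion_def ext_deriv_def cov_form_def form_apply_def linear_diff[OF eta_linear[OF i]])
      finally show ?thesis by (simp add: ext_deriv_eta i E)
    qed
    show "t u v (\<phi> p w) + t v w (\<phi> p u) + t w u (\<phi> p v) = 0" for u v w
      using metric_connection_closed[where p = p, OF metric E(1)[of u] E(1)[of v] E(1)[of w]]
      by (simp add: endo[OF E(1) E(1) E(1)] t E vf_phi endo_apply_def)
  qed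
  then show ?thesis using t[OF X Y Z] by simp
qed

lemma normal_if_connection:
  assumes "almost_metric_phi_connection A s \<phi> \<xi> \<eta> g D" "has_skew_torsion A g D"
  shows "S_manifold A n s \<phi> \<xi> \<eta> g"
proof -
  have endo: "cov_endo D \<phi> U V q = 0"
    if "U \<in> vector_fields A" "V \<in> vector_fields A" for U V q
    using assms(1) that unfolding almost_metric_phi_connection_def by blast
  have "normality_tensor A s \<phi> \<xi> \<eta> X Y p = 0" if "X \<in> vector_fields A" "Y \<in> vector_fields A" for X Y p
    by (rule g_eqI[of p]) (simp add: normality_connection[OF torsion_determined[OF assms] that] endo vf_phi that)
  then show ?thesis using contact unfolding S_manifold_def by blast
qed

section \<open>The metric connection with prescribed torsion\<close>

text \<open>The Koszul formula for \<open>g(\<nabla>\<^sub>X Y, Z)\<close>, where \<open>\<nabla>\<close> is the metric connection with torsion form \<open>tor\<close>.\<close>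

definition koszul :: "('a \<Rightarrow> 'e) \<Rightarrow> ('a \<Rightarrow> 'e) \<Rightarrow> ('a \<Rightarrow> 'e) \<Rightarrow> 'a \<Rightarrow> real" where
  "koszul X Y Z p =
    (field_deriv A X (metric_apply g Y Z) p + field_deriv A Y (metric_apply g X Z) p
     - field_deriv A Z (metric_apply g X Y) p + g p (lie_bracket A X Y p) (Z p)
     - g p (lie_bracket A X Z p) (Y p) - g p (lie_bracket A Y Z p) (X p) + tor p (X p) (Y p) (Z p)) / 2"

lemma metric_apply_add:
  "metric_apply g X (\<lambda>q. Y q + Z q) = (\<lambda>q. metric_apply g X Y q + metric_apply g X Z q)"
  "metric_apply g (\<lambda>q. Y q + Z q) X = (\<lambda>q. metric_apply g Y X q + metric_apply g Z X q)"
  by (auto simp: metric_apply_def)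

lemma metric_apply_scaleR:
  "metric_apply g X (\<lambda>q. f q *\<^sub>R Y q) = (\<lambda>q. f q * metric_apply g X Y q)"
  "metric_apply g (\<lambda>q. f q *\<^sub>R Y q) X = (\<lambda>q. f q * metric_apply g Y X q)"
  by (auto simp: metric_apply_def)

lemma metric_apply_sym: "metric_apply g X Y = metric_apply g Y X"
  by (auto simp: metric_apply_def g_sym)

lemma tor_linear:
  "tor p (u + u') v w = tor p u v w + tor p u' v w" "tor p (a *\<^sub>R u) v w = a * tor p u v w"
  "tor p u (v + v') w = tor p u v w + tor p u v' w" "tor p u (a *\<^sub>R v) w = a * tor p u v w"
  "tor p u v (w + w') = tor p u v w + tor p u v w'" "tor p u v (a *\<^sub>R w) = a * tor p u v w"
  by (simp_all add: tor_def algebra_simps)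

lemma sf_tor:
  assumes "X \<in> vector_fields A" "Y \<in> vector_fields A" "Z \<in> vector_fields A"
  shows "(\<lambda>p. tor p (X p) (Y p) (Z p)) \<in> smooth_funs A"
proof -
  have "(\<lambda>p. 2 * (form_apply bar X p * fundamental_form \<phi> g Y Z p - form_apply bar Y p * fundamental_form \<phi> g X Z p
      + form_apply bar Z p * fundamental_form \<phi> g X Y p)) \<in> smooth_funs A"
    using assms by (intro smooth_funs_mult smooth_funs_add smooth_funs_diff smooth_funs_const sf_bar sf_F)
  then show ?thesis by (simp add: tor_def fundamental_form_def apply_defs)
qed

lemma sf_g': "X \<in> vector_fields A \<Longrightarrow> Y \<in> vector_fields A \<Longrightarrow> (\<lambda>p. g p (X p) (Y p)) \<in> smooth_funs A"
  using sf_g by (simp add: metric_apply_def[abs_def])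

lemma koszul_smooth:
  assumes "X \<in> vector_fields A" "Y \<in> vector_fields A" "Z \<in> vector_fields A"
  shows "koszul X Y Z \<in> smooth_funs A"
proof -
  have "(\<lambda>p. (field_deriv A X (metric_apply g Y Z) p + field_deriv A Y (metric_apply g X Z) p
     - field_deriv A Z (metric_apply g X Y) p + g p (lie_bracket A X Y p) (Z p)
     - g p (lie_bracket A X Z p) (Y p) - g p (lie_bracket A Y Z p) (X p) + tor p (X p) (Y p) (Z p)) * (1 / 2)) \<in> smooth_funs A"
    using assms by (intro smooth_funs_mult smooth_funs_add smooth_funs_diff smooth_funs_const sf_tor sf_g'
        smooth_funs_field_deriv sf_g vector_fields_lie_bracket)
  then show ?thesis by (simp add: koszul_def[abs_def])
qed

lemma koszul_add:
  assumes "X \<in> vector_fields A" "Y \<in> vector_fields A" "Z \<in> vector_fields A" "V \<in> vector_fields A"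
  shows "koszul X Y (\<lambda>q. Z q + V q) p = koszul X Y Z p + koszul X Y V p"
    and "koszul X (\<lambda>q. Z q + V q) Y p = koszul X Z Y p + koszul X V Y p"
    and "koszul (\<lambda>q. Z q + V q) X Y p = koszul Z X Y p + koszul V X Y p"
  using assms
  by (simp_all add: koszul_def metric_apply_add field_deriv_funs field_deriv_fields closure_rules
      lie_bracket_add_right lie_bracket_add_left tor_linear field_simps)

text \<open>The derivatives of \<open>f\<close> that come from the derivatives of the metric cancel those that come from the
  brackets, except for the one in the Leibniz rule for the differentiated field.\<close>

lemma koszul_scaleR:
  assumes "X \<in> vector_fields A" "Y \<in> vector_fields A" "Z \<in> vector_fields A" "f \<in> smooth_funs A"
  shows "koszul X Y (\<lambda>q. f q *\<^sub>R Z q) p = f p * koszul X Y Z p"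
    and "koszul X (\<lambda>q. f q *\<^sub>R Y q) Z p = f p * koszul X Y Z p + field_deriv A X f p * g p (Y p) (Z p)"
    and "koszul (\<lambda>q. f q *\<^sub>R X q) Y Z p = f p * koszul X Y Z p"
  using assms g_sym[of p "X p" "Y p"] g_sym[of p "X p" "Z p"] g_sym[of p "Y p" "Z p"]
  by (simp_all add: koszul_def metric_apply_scaleR field_deriv_funs field_deriv_fields closure_rules
      lie_bracket_scaleR_right lie_bracket_scaleR_left tor_linear metric_apply_def[of _ _ _ p] field_simps)

definition nabla :: "('a \<Rightarrow> 'e) \<Rightarrow> ('a \<Rightarrow> 'e) \<Rightarrow> 'a \<Rightarrow> 'e" where
  "nabla X Y = (SOME W. W \<in> vector_fields A \<and> (\<forall>Z\<in>vector_fields A. \<forall>p. g p (W p) (Z p) = koszul X Y Z p))"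

lemma nabla:
  assumes X: "X \<in> vector_fields A" and Y: "Y \<in> vector_fields A"
  shows "nabla X Y \<in> vector_fields A"
    and "Z \<in> vector_fields A \<Longrightarrow> g p (nabla X Y p) (Z p) = koszul X Y Z p"
proof -
  have "\<exists>W. W \<in> vector_fields A \<and> (\<forall>Z\<in>vector_fields A. \<forall>p. g p (W p) (Z p) = koszul X Y Z p)"
    using riesz[OF g_riemannian, of "koszul X Y"] koszul_smooth[OF X Y] koszul_add(1)[OF X Y]
      koszul_scaleR(1)[OF X Y] by blast
  then have "nabla X Y \<in> vector_fields A \<and> (\<forall>Z\<in>vector_fields A. \<forall>p. g p (nabla X Y p) (Z p) = koszul X Y Z p)"
    unfolding nabla_def by (rule someI_ex)
  then show "nabla X Y \<in> vector_fields A"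
    "Z \<in> vector_fields A \<Longrightarrow> g p (nabla X Y p) (Z p) = koszul X Y Z p" by blast+
qed

lemma nabla_affine: "affine_connection A nabla"
  unfolding affine_connection_def
proof (intro ballI conjI allI)
  fix X Y assume XY: "X \<in> vector_fields A" "Y \<in> vector_fields A"
  show "nabla X Y \<in> vector_fields A" using nabla XY by blast
  show "nabla (\<lambda>q. X q + X' q) Y p = nabla X Y p + nabla X' Y p" if "X' \<in> vector_fields A" for X' p
    by (rule g_eqI[of p]) (use XY that in \<open>simp add: nabla closure_rules koszul_add\<close>)
  show "nabla X (\<lambda>q. Y q + Y' q) p = nabla X Y p + nabla X Y' p" if "Y' \<in> vector_fields A" for Y' p
    by (rule g_eqI[of p]) (use XY that in \<open>simp add: nabla closure_rules koszul_add\<close>)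
  show "nabla (\<lambda>q. f q *\<^sub>R X q) Y p = f p *\<^sub>R nabla X Y p" if "f \<in> smooth_funs A" for f p
    by (rule g_eqI[of p]) (use XY that in \<open>simp add: nabla closure_rules koszul_scaleR\<close>)
  show "nabla X (\<lambda>q. f q *\<^sub>R Y q) p = field_deriv A X f p *\<^sub>R Y p + f p *\<^sub>R nabla X Y p" if "f \<in> smooth_funs A" for f p
    by (rule g_eqI[of p]) (use XY that in \<open>simp add: nabla closure_rules koszul_scaleR\<close>)
qed

lemma nabla_metric:
  assumes "X \<in> vector_fields A" "Y \<in> vector_fields A" "Z \<in> vector_fields A"
  shows "cov_metric A nabla g X Y Z p = 0"
  using nabla(2)[OF assms(1,2,3), of p] nabla(2)[OF assms(1,3,2), of p] tor_skew(2)[of p "X p" "Z p" "Y p"]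
    g_sym[of p "Y p" "nabla X Z p"] lie_bracket_skew[of Z Y p]
  by (simp add: cov_metric_def metric_apply_def[of _ _ _ p] koszul_def metric_apply_sym[of Z Y])

lemma nabla_torsion:
  assumes "X \<in> vector_fields A" "Y \<in> vector_fields A" "Z \<in> vector_fields A"
  shows "torsion3 A g nabla X Y Z p = tor p (X p) (Y p) (Z p)"
  using nabla(2)[OF assms(1,2,3), of p] nabla(2)[OF assms(2,1,3), of p] tor_skew(1)[of p "X p" "Y p" "Z p"]
    lie_bracket_skew[of Y X p]
  by (simp add: torsion3_eq torsion_def koszul_def metric_apply_sym[of Y X] field_simps)

text \<open>Expressing all derivatives and brackets in the Koszul formula through \<open>D\<close> recovers \<open>D\<close>.\<close>

lemma nabla_unique:
  assumes metric: "\<And>X Y Z p. X \<in> vector_fields A \<Longrightarrow> Y \<in> vector_fields A \<Longrightarrow> Z \<in> vector_fields A \<Longrightarrow>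
      cov_metric A D g X Y Z p = 0"
    and tor: "\<And>X Y Z p. X \<in> vector_fields A \<Longrightarrow> Y \<in> vector_fields A \<Longrightarrow> Z \<in> vector_fields A \<Longrightarrow>
      torsion3 A g D X Y Z p = tor p (X p) (Y p) (Z p)"
    and X: "X \<in> vector_fields A" and Y: "Y \<in> vector_fields A"
  shows "D X Y = nabla X Y"
proof
  fix p
  show "D X Y p = nabla X Y p"
  proof (rule g_eqI[of p])
    fix Z assume Z: "Z \<in> vector_fields A"
    have M: "field_deriv A U (metric_apply g V W) p = g p (D U V p) (W p) + g p (D U W p) (V p)"
      if "U \<in> vector_fields A" "V \<in> vector_fields A" "W \<in> vector_fields A" for U V W
      using metric[OF that, of p] g_sym[of p "V p" "D U W p"]
      by (simp add: cov_metric_def metric_apply_def[of _ _ _ p])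
    have T: "g p (lie_bracket A U V p) (W p) = g p (D U V p) (W p) - g p (D V U p) (W p) - tor p (U p) (V p) (W p)"
      if "U \<in> vector_fields A" "V \<in> vector_fields A" "W \<in> vector_fields A" for U V W
      using tor[OF that, of p] by (simp add: torsion3_eq torsion_def)
    show "g p (D X Y p) (Z p) = g p (nabla X Y p) (Z p)"
      using tor_skew[of p "X p" "Y p" "Z p"] tor_skew[of p "Y p" "X p" "Z p"] tor_skew[of p "Y p" "Z p" "X p"]
      by (simp add: nabla X Y Z koszul_def M T)
  qed
qed

end

section \<open>The connection of a normal structure\<close>

locale normal_contact_metric_f = contact_metric_f +
  assumes normal: "\<And>X Y p. X \<in> vector_fields A \<Longrightarrow> Y \<in> vector_fields A \<Longrightarrow> normality_tensor A s \<phi> \<xi> \<eta> X Y p = 0"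
begin

lemma phi_xi_field: "i \<in> {1..s} \<Longrightarrow> endo_apply \<phi> (\<xi> i) = (\<lambda>q. 0)"
  by (auto simp: endo_apply_def)

lemma eta_phi_field: "i \<in> {1..s} \<Longrightarrow> form_apply (\<eta> i) (endo_apply \<phi> X) = (\<lambda>q. 0)"
  by (auto simp: apply_defs)

lemma eta_xi_field: "i \<in> {1..s} \<Longrightarrow> j \<in> {1..s} \<Longrightarrow> form_apply (\<eta> i) (\<xi> j) = (\<lambda>q. if i = j then 1 else 0)"
  by (auto simp: form_apply_def eta_xi)

lemma phi_zero_imp: "\<phi> p w = 0 \<Longrightarrow> (\<And>i. i \<in> {1..s} \<Longrightarrow> \<eta> i p w = 0) \<Longrightarrow> w = 0"
  using phi_phi[of p w] by simp

text \<open>Normality on the pair \<open>\<xi>\<^sub>i, Y\<close> is \<open>\<phi>\<close> applied to this equation, since \<open>d\<eta>\<^sub>j(\<xi>\<^sub>i, Y) = 2F(\<xi>\<^sub>i, Y)\<close>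
  vanishes. The same vanishing shows that both sides are annihilated by every \<open>\<eta>\<^sub>j\<close>.\<close>

lemma lie_xi_phi:
  assumes i: "i \<in> {1..s}" and Y: "Y \<in> vector_fields A"
  shows "lie_bracket A (\<xi> i) (endo_apply \<phi> Y) p = \<phi> p (lie_bracket A (\<xi> i) Y p)"
proof -
  define w where "w = \<phi> p (lie_bracket A (\<xi> i) Y p) - lie_bracket A (\<xi> i) (endo_apply \<phi> Y) p"
  have "w = 0"
  proof (rule phi_zero_imp[of p])
    show "\<phi> p w = 0"
      using normal[OF vf_xi[OF i] Y, of p]
      by (simp add: normality_tensor_def nijenhuis_def phi_xi_field[OF i] lie_bracket_zero Y vf_phi
          ext_deriv_eta vf_xi[OF i] g_xi[OF i] i w_def endo_apply_def)
    show "\<eta> j p w = 0" if j: "j \<in> {1..s}" for j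
      unfolding w_def
      by (simp add: linear_diff[OF eta_linear[OF j]] j eta_lie_bracket[OF j vf_xi[OF i] vf_phi[OF Y]]
          eta_phi_field[OF j] eta_xi_field[OF j i] g_xi[OF i] i)
  qed
  then show ?thesis by (simp add: w_def)
qed

lemma lie_xi_xi:
  assumes i: "i \<in> {1..s}" and j: "j \<in> {1..s}"
  shows "lie_bracket A (\<xi> i) (\<xi> j) p = 0"
proof (rule phi_zero_imp[of p])
  show "\<phi> p (lie_bracket A (\<xi> i) (\<xi> j) p) = 0"
    using lie_xi_phi[OF i vf_xi[OF j], of p] by (simp add: phi_xi_field[OF j] lie_bracket_zero vf_xi[OF i])
  show "\<eta> k p (lie_bracket A (\<xi> i) (\<xi> j) p) = 0" if k: "k \<in> {1..s}" for k
    by (simp add: eta_lie_bracket[OF k vf_xi[OF i] vf_xi[OF j]] eta_xi_field[OF k i] eta_xi_field[OF k j] j)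
qed

lemma metric_apply_xi: "i \<in> {1..s} \<Longrightarrow> metric_apply g X (\<xi> i) = form_apply (\<eta> i) X"
  "i \<in> {1..s} \<Longrightarrow> metric_apply g (\<xi> i) X = form_apply (\<eta> i) X"
  by (auto simp: apply_defs g_xi)

text \<open>The Killing equation for \<open>\<xi>\<^sub>i\<close> on the image of \<open>\<phi>\<close>: \<open>F\<close> is invariant under \<open>\<xi>\<^sub>i\<close>, as it is closed
  and annihilated by \<open>\<xi>\<^sub>i\<close>, and so is \<open>\<phi>\<close>.\<close>

lemma killing_phi:
  assumes i: "i \<in> {1..s}" and Y: "Y \<in> vector_fields A" and Z: "Z \<in> vector_fields A"
  shows "field_deriv A (\<xi> i) (metric_apply g Y (endo_apply \<phi> Z)) p =
    g p (lie_bracket A (\<xi> i) Y p) (\<phi> p (Z p)) + g p (Y p) (lie_bracket A (\<xi> i) (endo_apply \<phi> Z) p)"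
proof -
  have "fundamental_form \<phi> g Z (\<xi> i) = (\<lambda>q. 0)" "fundamental_form \<phi> g (\<xi> i) Y = (\<lambda>q. 0)"
    by (auto simp: fundamental_form_def apply_defs i g_xi)
  then show ?thesis
    using fundamental_form_closed[OF vf_xi[OF i] Y Z, of p] lie_bracket_skew[of Z "\<xi> i" p]
      g_phi_skew[of p "lie_bracket A (\<xi> i) Z p" "Y p"]
    by (simp add: lie_xi_phi[OF i Z] i fundamental_form_def g_sym[of p "Y p"])
qed

text \<open>The Killing equation on the \<open>\<xi>\<^sub>j\<close>, where the metric is \<open>\<eta>\<^sub>j\<close> and \<open>d\<eta>\<^sub>j(\<xi>\<^sub>i, Y) = 0\<close>.\<close>

lemma killing_xi:
  assumes i: "i \<in> {1..s}" and j: "j \<in> {1..s}" and Y: "Y \<in> vector_fields A"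
  shows "field_deriv A (\<xi> i) (metric_apply g Y (\<xi> j)) p =
    g p (lie_bracket A (\<xi> i) Y p) (\<xi> j p) + g p (Y p) (lie_bracket A (\<xi> i) (\<xi> j) p)"
  by (simp add: metric_apply_xi[OF j] lie_xi_xi[OF i j] g_xi[OF j] eta_lie_bracket[OF j vf_xi[OF i] Y]
      eta_xi_field[OF j i] g_xi[OF i] i)

text \<open>The Koszul formula for \<open>\<nabla>\<^sub>X \<xi>\<^sub>i\<close> consists of \<open>d\<eta>\<^sub>i(X,Z)\<close>, the Lie derivative of \<open>g\<close>, and the
  torsion; the torsion \<open>tor(X, \<xi>\<^sub>i, Z) = - 2F(X,Z)\<close> cancels the first.\<close>

lemma koszul_xi:
  assumes i: "i \<in> {1..s}" and X: "X \<in> vector_fields A" and Z: "Z \<in> vector_fields A"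
  shows "2 * koszul X (\<xi> i) Z p = field_deriv A (\<xi> i) (metric_apply g X Z) p
    - g p (lie_bracket A (\<xi> i) X p) (Z p) - g p (X p) (lie_bracket A (\<xi> i) Z p)"
  using lie_bracket_skew[of X "\<xi> i" p] eta_lie_bracket[OF i X Z, of p]
  by (simp add: koszul_def metric_apply_xi[OF i] g_xi[OF i] tor_def i g_sym[of p _ "X p"])

lemma nabla_xi:
  assumes i: "i \<in> {1..s}" and X: "X \<in> vector_fields A"
  shows "nabla X (\<xi> i) p = 0"
proof (rule vector_zeroI[of p])
  fix u
  obtain Z where Z: "Z \<in> vector_fields A" "Z p = u" using ex_vector_field by blast
  have "2 * koszul X (\<xi> i) (endo_apply \<phi> Z) p = 0"
    using koszul_xi[OF i X vf_phi[OF Z(1)], of p] killing_phi[OF i X Z(1), of p] by (simp add: endo_apply_def)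
  then show "g p (nabla X (\<xi> i) p) (\<phi> p u) = 0"
    using nabla(2)[OF X vf_xi[OF i] vf_phi[OF Z(1)], of p] Z(2) by (simp add: endo_apply_def)
next
  fix j assume j: "j \<in> {1..s}"
  have "2 * koszul X (\<xi> i) (\<xi> j) p = 0"
    using koszul_xi[OF i X vf_xi[OF j], of p] killing_xi[OF i j X, of p] by simp
  then show "g p (nabla X (\<xi> i) p) (\<xi> j p) = 0"
    using nabla(2)[OF X vf_xi[OF i] vf_xi[OF j], of p] by simp
qed

lemma nabla_eta:
  assumes i: "i \<in> {1..s}" and X: "X \<in> vector_fields A" and Y: "Y \<in> vector_fields A"
  shows "field_deriv A X (form_apply (\<eta> i) Y) p = \<eta> i p (nabla X Y p)"
  using nabla_metric[OF X Y vf_xi[OF i], of p] nabla_xi[OF i X, of p]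
  by (simp add: cov_metric_def metric_apply_xi[OF i] form_apply_def metric_apply_def g_xi[OF i])

lemma nabla_g:
  assumes "X \<in> vector_fields A" "Y \<in> vector_fields A" "Z \<in> vector_fields A"
  shows "field_deriv A X (metric_apply g Y Z) p = g p (nabla X Y p) (Z p) + g p (Y p) (nabla X Z p)"
  using nabla_metric[OF assms, of p] by (simp add: cov_metric_def metric_apply_def)

text \<open>Differentiating \<open>g(\<phi>Y, Z) + g(Y, \<phi>Z) = 0\<close> with a metric connection.\<close>

lemma nabla_phi_skew:
  assumes X: "X \<in> vector_fields A" and Y: "Y \<in> vector_fields A" and Z: "Z \<in> vector_fields A"
  shows "g p (cov_endo nabla \<phi> X Z p) (Y p) = - g p (cov_endo nabla \<phi> X Y p) (Z p)"
proof -
  have "(\<lambda>q. metric_apply g (endo_apply \<phi> Y) Z q + metric_apply g Y (endo_apply \<phi> Z) q) = (\<lambda>q. 0)"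
    by (auto simp: apply_defs g_phi_skew)
  then have "field_deriv A X (metric_apply g (endo_apply \<phi> Y) Z) p + field_deriv A X (metric_apply g Y (endo_apply \<phi> Z)) p = 0"
    using field_deriv_funs(1)[OF sf_g[OF vf_phi[OF Y] Z] sf_g[OF Y vf_phi[OF Z]], of X p] by simp
  then show ?thesis
    using g_sym[of p "Y p"] g_phi_skew[of p "nabla X Y p" "Z p"] g_phi_skew[of p "nabla X Z p" "Y p"]
    by (simp add: nabla_g closure_rules X Y Z cov_endo_def endo_apply_def g_sym[of p "\<phi> p (Y p)"])
qed

text \<open>\<open>\<phi>\<^sup>2\<close> is parallel, because by its formula it is built from the \<open>\<eta>\<^sub>i\<close> and \<open>\<xi>\<^sub>i\<close>.\<close>

lemma nabla_phi_phi:
  assumes X: "X \<in> vector_fields A" and Y: "Y \<in> vector_fields A"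
  shows "nabla X (endo_apply \<phi> (endo_apply \<phi> Y)) p = \<phi> p (\<phi> p (nabla X Y p))"
proof (rule g_eqI[of p])
  fix Z assume Z: "Z \<in> vector_fields A"
  let ?f = "\<lambda>i. \<lambda>q. form_apply (\<eta> i) Y q * form_apply (\<eta> i) Z q"
  have "(\<lambda>q. metric_apply g (endo_apply \<phi> (endo_apply \<phi> Y)) Z q + metric_apply g Y Z q) = (\<lambda>q. \<Sum>i\<in>{1..s}. ?f i q)"
    by (auto simp: apply_defs phi_phi g_xi)
  then have "field_deriv A X (metric_apply g (endo_apply \<phi> (endo_apply \<phi> Y)) Z) p + field_deriv A X (metric_apply g Y Z) p
      = field_deriv A X (\<lambda>q. \<Sum>i\<in>{1..s}. ?f i q) p"
    using field_deriv_funs(1)[OF sf_g[OF vf_phi[OF vf_phi[OF Y]] Z] sf_g[OF Y Z], of X p] by simp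
  also have "\<dots> = (\<Sum>i\<in>{1..s}. field_deriv A X (?f i) p)"
    by (rule field_deriv_sum) (intro smooth_funs_mult sf_eta Y Z)
  also have "\<dots> = (\<Sum>i\<in>{1..s}. \<eta> i p (Y p) * \<eta> i p (nabla X Z p) + \<eta> i p (nabla X Y p) * \<eta> i p (Z p))"
    by (rule sum.cong) (simp_all add: field_deriv_funs(3) sf_eta nabla_eta X Y Z del: atLeastAtMost_iff, simp add: form_apply_def)
  finally show "g p (nabla X (endo_apply \<phi> (endo_apply \<phi> Y)) p) (Z p) = g p (\<phi> p (\<phi> p (nabla X Y p))) (Z p)"
    by (simp add: nabla_g vf_phi X Y Z phi_phi g_xi sum.distrib endo_apply_def)
qed

lemma cov_endo_phi:
  assumes X: "X \<in> vector_fields A" and Y: "Y \<in> vector_fields A"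
  shows "g p (cov_endo nabla \<phi> X (endo_apply \<phi> Y) p) w = g p (cov_endo nabla \<phi> X Y p) (\<phi> p w)"
  using nabla_phi_phi[OF assms, of p] g_phi_skew[of p "nabla X (endo_apply \<phi> Y) p" w]
     g_phi_skew[of p "\<phi> p (nabla X Y p)" w]
  by (simp add: cov_endo_def endo_apply_def[of _ _ p])

text \<open>Let \<open>P(X,Y,Z) = g((\<nabla>\<^sub>X \<phi>) Y, Z)\<close>. It is skew in the last two arguments, and \<open>\<phi>\<close> may be moved between
  them. By \<open>dF = 0\<close> its cyclic sum vanishes, and the normality tensor gives one more linear relation; the torsion
  drops out of both. As for a Kaehler structure, these relations force \<open>P(X, Y, \<phi>Z) = 0\<close>.\<close>

lemma nabla_phi:
  assumes X: "X \<in> vector_fields A" and Y: "Y \<in> vector_fields A"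
  shows "cov_endo nabla \<phi> X Y p = 0"
proof (rule vector_zeroI[of p])
  fix j assume j: "j \<in> {1..s}"
  have "\<eta> j p (nabla X (endo_apply \<phi> Y) p) = 0"
    using nabla_eta[OF j X vf_phi[OF Y], of p] by (simp add: eta_phi_field[OF j])
  then show "g p (cov_endo nabla \<phi> X Y p) (\<xi> j p) = 0"
    by (simp add: cov_endo_def g_xi[OF j] linear_diff[OF eta_linear[OF j]] endo_apply_def j)
next
  fix u
  obtain Z where Z: "Z \<in> vector_fields A" and Zp: "Z p = u" using ex_vector_field by blast
  define P where "P = (\<lambda>X Y Z. g p (cov_endo nabla \<phi> X Y p) (Z p))"
  let ?f = "endo_apply \<phi>"
  have skew: "P U W V = - P U V W"
    if "U \<in> vector_fields A" "V \<in> vector_fields A" "W \<in> vector_fields A" for U V W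
    unfolding P_def using nabla_phi_skew that by blast
  have phi: "P U (?f V) W = P U V (?f W)"
    if "U \<in> vector_fields A" "V \<in> vector_fields A" "W \<in> vector_fields A" for U V W
    unfolding P_def using cov_endo_phi[OF that(1,2)] by (simp add: endo_apply_def[of _ W])
  have cyc: "P U V W + P V W U + P W U V = 0"
    if "U \<in> vector_fields A" "V \<in> vector_fields A" "W \<in> vector_fields A" for U V W
    using metric_connection_closed[OF nabla_metric that, of p] tor_cyclic[of p "U p" "V p" "W p"]
      skew[OF that] skew[OF that(2,3,1)] skew[OF that(3,1,2)]
    by (simp add: nabla_torsion that vf_phi endo_apply_def[of _ _ p] P_def)
  have nor: "P (?f U) V W - P (?f V) U W + P U V (?f W) - P V U (?f W) = 0"
    if "U \<in> vector_fields A" "V \<in> vector_fields A" "W \<in> vector_fields A" for U V W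
    using normality_connection[OF nabla_torsion that, of p] normal[OF that(1,2), of p]
    by (simp add: P_def endo_apply_def[of _ W])
  note f = vf_phi
  \<comment> \<open>the relation from normality, and the cyclic relation with \<open>\<phi>\<close> put on each argument in turn\<close>
  have "P X Y (?f Z) = 0"
    using nor[OF Y Z X] cyc[OF f[OF X] Y Z] cyc[OF X f[OF Y] Z] cyc[OF X Y f[OF Z]]
      skew[OF Z Y f[OF X]] phi[OF Z X Y] phi[OF Y Z X] phi[OF X Y Z] skew[OF f[OF Z] X Y]
    by linarith
  then show "g p (cov_endo nabla \<phi> X Y p) (\<phi> p u) = 0"
    by (simp add: P_def endo_apply_def Zp)
qed

lemma nabla_almost_metric_phi: "almost_metric_phi_connection A s \<phi> \<xi> \<eta> g nabla"
  unfolding almost_metric_phi_connection_def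
  by (auto simp: nabla_affine nabla_metric nabla_phi nabla_xi cov_form_def nabla_eta form_apply_def)

lemma nabla_skew_torsion: "has_skew_torsion A g nabla"
  unfolding has_skew_torsion_def three_form_def
proof (intro ballI conjI allI)
  fix X Y Z assume V: "X \<in> vector_fields A" "Y \<in> vector_fields A" "Z \<in> vector_fields A"
  have "torsion3 A g nabla X Y Z = (\<lambda>p. tor p (X p) (Y p) (Z p))"
    by (intro ext nabla_torsion V)
  then show "torsion3 A g nabla X Y Z \<in> smooth_funs A" using sf_tor V by simp
  show "torsion3 A g nabla Y X Z p = - torsion3 A g nabla X Y Z p"
    "torsion3 A g nabla X Z Y p = - torsion3 A g nabla X Y Z p" for p
    using V tor_skew by (metis nabla_torsion)+
  show "torsion3 A g nabla (\<lambda>q. X q + X' q) Y Z p = torsion3 A g nabla X Y Z p + torsion3 A g nabla X' Y Z p"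
    if "X' \<in> vector_fields A" for X' p
    using V that by (simp add: nabla_torsion closure_rules tor_linear)
  show "torsion3 A g nabla (\<lambda>q. f q *\<^sub>R X q) Y Z p = f p * torsion3 A g nabla X Y Z p"
    if "f \<in> smooth_funs A" for f p
    using V that by (simp add: nabla_torsion closure_rules tor_linear)
qed

lemma nabla_bar:
  assumes "X \<in> vector_fields A" "Y \<in> vector_fields A"
  shows "field_deriv A X (form_apply bar Y) p = bar p (nabla X Y p)"
proof -
  have "form_apply bar Y = (\<lambda>q. \<Sum>i\<in>{1..s}. form_apply (\<eta> i) Y q)"
    by (auto simp: form_apply_def eta_bar_def)
  then have "field_deriv A X (form_apply bar Y) p = (\<Sum>i\<in>{1..s}. field_deriv A X (form_apply (\<eta> i) Y) p)"
    using assms by (simp only:) (intro field_deriv_sum sf_eta)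
  then show ?thesis using assms by (simp add: nabla_eta eta_bar_def)
qed

lemma nabla_F:
  assumes X: "X \<in> vector_fields A" and Y: "Y \<in> vector_fields A" and Z: "Z \<in> vector_fields A"
  shows "field_deriv A X (fundamental_form \<phi> g Y Z) p = g p (nabla X Y p) (\<phi> p (Z p)) + g p (Y p) (\<phi> p (nabla X Z p))"
  using nabla_phi[OF X Z, of p] nabla_g[OF X Y vf_phi[OF Z], of p]
  by (simp add: fundamental_form_def cov_endo_def endo_apply_def)

text \<open>The torsion is a polynomial in \<open>\<eta>bar\<close> and \<open>F\<close>, both of which are parallel.\<close>

lemma nabla_parallel_torsion: "parallel_three_form A nabla (torsion3 A g nabla)"
  unfolding parallel_three_form_def
proof (intro ballI allI)
  fix X Y Z V p assume X: "X \<in> vector_fields A" and W: "Y \<in> vector_fields A" "Z \<in> vector_fields A" "V \<in> vector_fields A"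
  let ?F = "fundamental_form \<phi> g" and ?b = "form_apply bar"
  have "torsion3 A g nabla Y Z V = (\<lambda>q. 2 * (?b Y q * ?F Z V q - ?b Z q * ?F Y V q + ?b V q * ?F Y Z q))"
    using W by (auto simp: nabla_torsion tor_def fundamental_form_def apply_defs)
  then show "cov_three_form A nabla (torsion3 A g nabla) X Y Z V p = 0"
    using X W
    by (simp add: cov_three_form_def field_deriv_funs closure_rules nabla_bar nabla_F nabla_torsion nabla(1))
       (simp add: tor_def fundamental_form_def apply_defs algebra_simps)
qed

end

context contact_metric_f
begin

text \<open>Both expressions agree termwise with \<open>tor\<close>, since all \<open>d\<eta>\<^sub>i\<close> equal \<open>2F\<close>.\<close>

lemma tor_eq_wedge:
  assumes "X \<in> vector_fields A" "Y \<in> vector_fields A" "Z \<in> vector_fields A"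
  shows "tor p (X p) (Y p) (Z p) = (\<Sum>i\<in>{1..s}. wedge12 (\<eta> i) (ext_deriv A (\<eta> i)) X Y Z p)"
    and "tor p (X p) (Y p) (Z p) = 2 * wedge12 bar (fundamental_form \<phi> g) X Y Z p"
proof -
  have "(\<Sum>i\<in>{1..s}. wedge12 (\<eta> i) (ext_deriv A (\<eta> i)) X Y Z p) =
      (\<Sum>i\<in>{1..s}. \<eta> i p (X p) * (2 * g p (Y p) (\<phi> p (Z p))) - \<eta> i p (Y p) * (2 * g p (X p) (\<phi> p (Z p)))
        + \<eta> i p (Z p) * (2 * g p (X p) (\<phi> p (Y p))))"
    using assms by (intro sum.cong) (simp_all add: wedge12_def ext_deriv_eta form_apply_def)
  then show "tor p (X p) (Y p) (Z p) = (\<Sum>i\<in>{1..s}. wedge12 (\<eta> i) (ext_deriv A (\<eta> i)) X Y Z p)"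
    by (simp add: tor_def eta_bar_def sum.distrib sum_subtractf sum_distrib_left sum_distrib_right algebra_simps)
  show "tor p (X p) (Y p) (Z p) = 2 * wedge12 bar (fundamental_form \<phi> g) X Y Z p"
    by (simp add: tor_def wedge12_def fundamental_form_def apply_defs)
qed

end

theorem theorem4p3:
  fixes A :: "('a::{t2_space,second_countable_topology}, 'e::euclidean_space) chart set"
    and n s :: nat
    and \<phi> :: "'a \<Rightarrow> 'e \<Rightarrow> 'e"
    and \<xi> :: "nat \<Rightarrow> 'a \<Rightarrow> 'e"
    and \<eta> :: "nat \<Rightarrow> 'a \<Rightarrow> 'e \<Rightarrow> real"
    and g :: "'a \<Rightarrow> 'e \<Rightarrow> 'e \<Rightarrow> real"
  assumes "s \<ge> 1"
    and "contact_metric_f_manifold A n s \<phi> \<xi> \<eta> g"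
  shows "((\<exists>D. almost_metric_phi_connection A s \<phi> \<xi> \<eta> g D \<and> has_skew_torsion A g D)
            \<longleftrightarrow> S_manifold A n s \<phi> \<xi> \<eta> g) \<and>
         (S_manifold A n s \<phi> \<xi> \<eta> g \<longrightarrow>
            (\<exists>D. almost_metric_phi_connection A s \<phi> \<xi> \<eta> g D \<and> has_skew_torsion A g D \<and>
              (\<forall>D'. almost_metric_phi_connection A s \<phi> \<xi> \<eta> g D' \<and> has_skew_torsion A g D' \<longrightarrow>
                 (\<forall>X\<in>vector_fields A. \<forall>Y\<in>vector_fields A. D' X Y = D X Y)) \<and>
              parallel_three_form A D (torsion3 A g D) \<and>
              (\<forall>X\<in>vector_fields A. \<forall>Y\<in>vector_fields A. \<forall>Z\<in>vector_fields A. \<forall>p.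
                 torsion3 A g D X Y Z p = (\<Sum>i\<in>{1..s}. wedge12 (\<eta> i) (ext_deriv A (\<eta> i)) X Y Z p) \<and>
                 torsion3 A g D X Y Z p
                   = 2 * wedge12 (eta_bar s \<eta>) (fundamental_form \<phi> g) X Y Z p)))"
    (is "(?L \<longleftrightarrow> ?S) \<and> (?S \<longrightarrow> (\<exists>D. ?Q D))")
proof -
  interpret contact_metric_f A n s \<phi> \<xi> \<eta> g
    using assms by unfold_locales
  have conv: "\<exists>D. ?Q D" if S: ?S
  proof -
    interpret normal_contact_metric_f A n s \<phi> \<xi> \<eta> g
      using S unfolding S_manifold_def by unfold_locales blast
    have unique: "D' X Y = nabla X Y"
      if D': "almost_metric_phi_connection A s \<phi> \<xi> \<eta> g D'" "has_skew_torsion A g D'"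
        and XY: "X \<in> vector_fields A" "Y \<in> vector_fields A" for D' X Y
    proof (rule nabla_unique[OF _ torsion_determined[OF D'] XY])
      show "cov_metric A D' g U V W p = 0"
        if "U \<in> vector_fields A" "V \<in> vector_fields A" "W \<in> vector_fields A" for U V W p
        using D'(1) that unfolding almost_metric_phi_connection_def by blast
    qed
    show ?thesis
    proof (intro exI[of _ nabla] conjI allI impI ballI)
      fix X Y Z p assume "X \<in> vector_fields A" "Y \<in> vector_fields A" "Z \<in> vector_fields A"
      then show "torsion3 A g nabla X Y Z p = (\<Sum>i\<in>{1..s}. wedge12 (\<eta> i) (ext_deriv A (\<eta> i)) X Y Z p)"
        "torsion3 A g nabla X Y Z p = 2 * wedge12 (eta_bar s \<eta>) (fundamental_form \<phi> g) X Y Z p"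
        by (simp_all only: nabla_torsion flip: tor_eq_wedge)
    qed (use nabla_almost_metric_phi nabla_skew_torsion unique nabla_parallel_torsion in blast)+
  qed
  show ?thesis using conv normal_if_connection by blast
qed

end
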